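(* Let $W^{(1)},W^{(2)},\ldots$ be an infinite sequence of finite Coxeter groups such that $W^{(n)}$ has rank $n$ and maximal degree $d_n$. Let $X^{(n)}$ be the number of $W^{(n)}$-inversions of a uniformly random element of $W^{(n)}$, with variance $s_n^2$. Then $X^{(n)}$ satisfies the CLT if and only if $d_n/s_n\to0$ as $n\to\infty$.
   Context: For a finite Coxeter group with root system $\Phi=\Phi^+\sqcup\Phi^-$, the number of inversions of $w$ is $\#\{\beta\in\Phi^+ : w(\beta)\in\Phi^-\}$. Degrees are those of the basic invariants (multiset union over irreducible components). A sequence of random variables $X^{(n)}$ satisfies the CLT if $(X^{(n)}-\mathbb{E}X^{(n)})/\sqrt{\mathbb{V}X^{(n)}}$ converges in distribution to the standard normal $N(0,1)$. *)

theory Defs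
  imports "HOL-Probability.Probability"
begin

definition vecs :: "nat \<Rightarrow> (nat \<Rightarrow> real) set" where
  "vecs n = {v. \<forall>i\<ge>n. v i = 0}"

definition ip :: "nat \<Rightarrow> (nat \<Rightarrow> real) \<Rightarrow> (nat \<Rightarrow> real) \<Rightarrow> real" where
  "ip n u v = (\<Sum>i<n. u i * v i)"

definition refl :: "nat \<Rightarrow> (nat \<Rightarrow> real) \<Rightarrow> (nat \<Rightarrow> real) \<Rightarrow> (nat \<Rightarrow> real)" where
  "refl n a v = (\<lambda>i. v i - (2 * ip n v a / ip n a a) * a i)"

text \<open>A (reduced, not necessarily crystallographic) root system in R^n which spans R^n,
  i.e. the root system of an essential finite reflection group of rank n.\<close>
definition root_system :: "nat \<Rightarrow> (nat \<Rightarrow> real) set \<Rightarrow> bool" where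
  "root_system n \<Phi> \<longleftrightarrow>
     finite \<Phi> \<and> \<Phi> \<subseteq> vecs n - {(\<lambda>_. 0)} \<and>
     (\<forall>a\<in>\<Phi>. \<forall>c::real. (\<lambda>i. c * a i) \<in> \<Phi> \<longleftrightarrow> c = 1 \<or> c = -1) \<and>
     (\<forall>a\<in>\<Phi>. refl n a ` \<Phi> = \<Phi>) \<and>
     (\<forall>v\<in>vecs n. \<exists>c. v = (\<lambda>i. \<Sum>a\<in>\<Phi>. c a * a i))"

inductive_set coxgrp :: "nat \<Rightarrow> (nat \<Rightarrow> real) set \<Rightarrow> ((nat \<Rightarrow> real) \<Rightarrow> (nat \<Rightarrow> real)) set"
  for n \<Phi> where
  id_in: "id \<in> coxgrp n \<Phi>"
| refl_in: "w \<in> coxgrp n \<Phi> \<Longrightarrow> a \<in> \<Phi> \<Longrightarrow> w \<circ> refl n a \<in> coxgrp n \<Phi>"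

definition positive_system :: "nat \<Rightarrow> (nat \<Rightarrow> real) set \<Rightarrow> (nat \<Rightarrow> real) set \<Rightarrow> bool" where
  "positive_system n \<Phi> P \<longleftrightarrow>
     (\<exists>c\<in>vecs n. (\<forall>a\<in>\<Phi>. ip n a c \<noteq> 0) \<and> P = {a\<in>\<Phi>. ip n a c > 0})"

definition ninv :: "(nat \<Rightarrow> real) set \<Rightarrow> (nat \<Rightarrow> real) set \<Rightarrow> ((nat \<Rightarrow> real) \<Rightarrow> (nat \<Rightarrow> real)) \<Rightarrow> nat" where
  "ninv \<Phi> P w = card {b\<in>P. w b \<in> \<Phi> - P}"

definition homog_poly :: "nat \<Rightarrow> nat \<Rightarrow> ((nat \<Rightarrow> real) \<Rightarrow> real) \<Rightarrow> bool" where
  "homog_poly n k f \<longleftrightarrow>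
     (\<exists>(C :: (nat \<Rightarrow> nat) \<Rightarrow> real) E. finite E \<and>
        (\<forall>e\<in>E. (\<forall>i\<ge>n. e i = 0) \<and> (\<Sum>i<n. e i) = k) \<and>
        (\<forall>v. f v = (\<Sum>e\<in>E. C e * (\<Prod>i<n. v i ^ e i))))"

definition inv_polys :: "nat \<Rightarrow> (nat \<Rightarrow> real) set \<Rightarrow> nat \<Rightarrow> ((nat \<Rightarrow> real) \<Rightarrow> real) set" where
  "inv_polys n \<Phi> k = {f. homog_poly n k f \<and> (\<forall>w\<in>coxgrp n \<Phi>. \<forall>v\<in>vecs n. f (w v) = f v)}"

text \<open>Degree-k part of (R^W_+)^2: sums of products of invariants of positive degrees a, k-a.\<close>
definition decomposable :: "nat \<Rightarrow> (nat \<Rightarrow> real) set \<Rightarrow> nat \<Rightarrow> ((nat \<Rightarrow> real) \<Rightarrow> real) \<Rightarrow> bool" where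
  "decomposable n \<Phi> k f \<longleftrightarrow>
     (\<exists>m g h (d :: nat \<Rightarrow> nat).
        (\<forall>j<m. 1 \<le> d j \<and> d j < k \<and> g j \<in> inv_polys n \<Phi> (d j) \<and> h j \<in> inv_polys n \<Phi> (k - d j)) \<and>
        (\<forall>v\<in>vecs n. f v = (\<Sum>j<m. g j v * h j v)))"

text \<open>Degrees of basic invariants (as a set): the degrees k >= 1 in which a minimal
  homogeneous generating set of the invariant algebra has an element, i.e.
  (R^W_+ / (R^W_+)^2)_k is nonzero.\<close>
definition basic_degrees :: "nat \<Rightarrow> (nat \<Rightarrow> real) set \<Rightarrow> nat set" where
  "basic_degrees n \<Phi> = {k. 1 \<le> k \<and> (\<exists>f\<in>inv_polys n \<Phi> k. \<not> decomposable n \<Phi> k f)}"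

definition max_degree :: "nat \<Rightarrow> (nat \<Rightarrow> real) set \<Rightarrow> nat" where
  "max_degree n \<Phi> = Max (basic_degrees n \<Phi>)"

definition inv_pmf :: "nat \<Rightarrow> (nat \<Rightarrow> real) set \<Rightarrow> (nat \<Rightarrow> real) set \<Rightarrow> real pmf" where
  "inv_pmf n \<Phi> P = map_pmf (\<lambda>w. real (ninv \<Phi> P w)) (pmf_of_set (coxgrp n \<Phi>))"

definition satisfies_CLT :: "(nat \<Rightarrow> real pmf) \<Rightarrow> bool" where
  "satisfies_CLT X \<longleftrightarrow>
     weak_conv_m
       (\<lambda>n. distr (measure_pmf (X n)) borel
              (\<lambda>x. (x - measure_pmf.expectation (X n) (\<lambda>y. y))
                   / sqrt (measure_pmf.variance (X n) (\<lambda>y. y))))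
       std_normal_distribution"

end

theory Submission
  imports Defs "HOL-Library.Function_Algebras" "HOL-Computational_Algebra.Polynomial_FPS"
begin

text \<open>The number of inversions is distributed as a sum of independent uniform variables on
  \<open>{0..<d i}\<close>, where the \<open>d i\<close> are the degrees. This follows without the classification, from functions
  on the orbit of a regular vector \<open>c\<close>. There \<open>len y\<close>, the number of positive roots negative at \<open>y\<close>, is the
  number of inversions. Divided differences along simple reflections show that polynomials of degree
  less than \<open>k\<close> are determined by, and prescribable on, the points of length less than \<open>k\<close>, and that a
  form which agrees on the orbit with a polynomial of smaller degree lies in the ideal of the positive
  invariants. So the coinvariant algebra has as many basis elements of degree \<open>k\<close> as there
  are points of length \<open>k\<close>. By Chevalley's lemma it gives a basis of the polynomials over the
  invariants, and applied to gradients the lemma makes the basic invariants algebraically independent.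
  Comparing Hilbert series yields the factorization of the length generating function.

  The characteristic function of the standardized statistic is then a product of those of uniform
  variables. It is within \<open>O(\<delta>)\<close> of the normal one, \<open>\<delta>\<close> being the quotient of the maximal degree and the
  standard deviation, and it vanishes at \<open>2 * pi / \<delta>\<close>, which forces \<open>\<delta>\<close> to tend to zero in the limit theorem.\<close>

section \<open>Roots and reflections\<close>

text \<open>Finite generation, algebraic independence and the number of basic invariants are
  outcomes of the argument, not inputs. Generators need degree at most \<open>Suc (card P)\<close>:
  partial derivatives of invariants of larger degree lie in the ideal, and Euler's identity then
  decomposes the invariant. The count \<open>n\<close> comes last, from the order of vanishing at 1
  on both sides of the Poincare identity.

  Polynomials are real functions, so equality is pointwise and a linear factor is cancelled by
  continuity; degrees are predicates, because the zero function has every degree.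

  In the limit theorem, the third-order error of one uniform factor is at most a constant times its
  degree times its variance. Summing gives the maximal degree times the total variance, and
  standardizing leaves the quotient of degree and standard deviation. For the converse, unit
  variance makes all the characteristic functions Lipschitz with constant 1, so a zero near a point
  forces a small value at that point.\<close>

lemma ip_commute: "ip n u v = ip n v u"
  by (simp add: ip_def mult.commute)

lemma ip_add_left: "ip n (\<lambda>i. u i + v i) w = ip n u w + ip n v w"
  by (simp add: ip_def sum.distrib algebra_simps)

lemma ip_diff_left: "ip n (\<lambda>i. u i - v i) w = ip n u w - ip n v w"
  by (simp add: ip_def sum_subtractf algebra_simps)

lemma ip_scale_left: "ip n (\<lambda>i. k * u i) w = k * ip n u w"
  by (simp add: ip_def sum_distrib_left algebra_simps)

lemma ip_sum_left: "ip n (\<lambda>i. \<Sum>j\<in>J. k j * u j i) w = (\<Sum>j\<in>J. k j * ip n (u j) w)"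
proof -
  have "ip n (\<lambda>i. \<Sum>j\<in>J. k j * u j i) w = (\<Sum>i<n. \<Sum>j\<in>J. k j * u j i * w i)"
    by (simp add: ip_def sum_distrib_right)
  also have "\<dots> = (\<Sum>j\<in>J. \<Sum>i<n. k j * u j i * w i)"
    by (rule sum.swap)
  finally show ?thesis
    by (simp add: ip_def sum_distrib_left algebra_simps)
qed

lemma ip_self_pos:
  assumes "a \<in> vecs n" "a \<noteq> (\<lambda>_. 0)"
  shows "ip n a a > 0"
proof -
  obtain i where "a i \<noteq> 0"
    using assms(2) by auto
  then have "i < n"
    using assms(1) by (auto simp: vecs_def not_less[symmetric])
  then have "a i * a i \<le> ip n a a"
    unfolding ip_def by (intro member_le_sum) auto
  moreover have "0 < a i * a i"
    using \<open>a i \<noteq> 0\<close> by (metis not_real_square_gt_zero)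
  ultimately show ?thesis by linarith
qed

lemma ip_refl_left: "ip n (refl n a v) w = ip n v w - 2 * ip n v a / ip n a a * ip n a w"
  unfolding refl_def ip_diff_left ip_scale_left by simp

lemma refl_refl:
  assumes "ip n a a \<noteq> 0"
  shows "refl n a (refl n a v) = v"
proof -
  have "ip n (refl n a v) a = - ip n v a"
    using assms by (simp add: ip_refl_left)
  then have "refl n a (refl n a v) i = v i" for i
    by (simp add: refl_def[of n a "refl n a v"]) (simp add: refl_def)
  then show ?thesis by blast
qed

lemma ip_refl_symm: "ip n (refl n a u) v = ip n u (refl n a v)"
proof -
  have "ip n u (refl n a v) = ip n (refl n a v) u"
    by (rule ip_commute)
  moreover have "ip n u a = ip n a u" "ip n v u = ip n u v" "ip n v a = ip n a v"
    by (rule ip_commute)+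
  ultimately show ?thesis
    by (simp add: ip_refl_left)
qed

lemma ip_refl_refl:
  assumes "ip n a a \<noteq> 0"
  shows "ip n (refl n a u) (refl n a v) = ip n u v"
  using assms by (simp add: ip_refl_symm refl_refl)

lemma refl_conj:
  assumes "ip n a a \<noteq> 0"
  shows "refl n (refl n a b) v = refl n a (refl n b (refl n a v))"
proof
  fix i
  have "refl n a (\<lambda>i. u i - k * b i) i = refl n a u i - k * refl n a b i" for u k
    by (simp add: refl_def ip_diff_left ip_scale_left algebra_simps diff_divide_distrib add_divide_distrib)
  then have "refl n a (refl n b (refl n a v)) i
      = refl n a (refl n a v) i - (2 * ip n (refl n a v) b / ip n b b) * refl n a b i"
    by (simp only: refl_def[of n b])
  also have "\<dots> = refl n (refl n a b) v i"
    using assms by (simp add: refl_refl refl_def[of n "refl n a b"] ip_refl_refl) (simp add: ip_refl_symm)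
  finally show "refl n (refl n a b) v i = refl n a (refl n b (refl n a v)) i" ..
qed

lemma refl_eq_if_parallel:
  assumes "k \<noteq> 0"
  shows "refl n (\<lambda>i. k * a i) = refl n a"
proof -
  have "ip n (\<lambda>i. k * a i) (\<lambda>i. k * a i) = k * k * ip n a a"
    by (simp add: ip_def sum_distrib_left algebra_simps)
  moreover have "ip n v (\<lambda>i. k * a i) = k * ip n v a" for v
    by (simp add: ip_def sum_distrib_left algebra_simps)
  ultimately show ?thesis
    using assms by (auto simp: refl_def fun_eq_iff)
qed

lemma refl_restrict:
  assumes "a \<in> vecs n"
  shows "refl n a (\<lambda>i. if i < n then v i else 0) = (\<lambda>i. if i < n then refl n a v i else 0)"
  using assms by (auto simp: refl_def ip_def vecs_def fun_eq_iff)

lemma refl_in_vecs: "a \<in> vecs n \<Longrightarrow> v \<in> vecs n \<Longrightarrow> refl n a v \<in> vecs n"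
  by (auto simp: vecs_def refl_def)

lemma coxgrp_compose:
  assumes "w \<in> coxgrp n \<Phi>" "u \<in> coxgrp n \<Phi>"
  shows "u \<circ> w \<in> coxgrp n \<Phi>"
  using assms(1)
proof (induction w rule: coxgrp.induct)
  case id_in
  then show ?case using assms(2) by simp
next
  case (refl_in w a)
  then show ?case
    by (metis coxgrp.refl_in comp_assoc)
qed

lemma coxgrp_refl: "a \<in> \<Phi> \<Longrightarrow> refl n a \<in> coxgrp n \<Phi>"
  using coxgrp.refl_in[OF coxgrp.id_in, of a \<Phi> n] by simp

lemma coxgrp_refl_left: "w \<in> coxgrp n \<Phi> \<Longrightarrow> a \<in> \<Phi> \<Longrightarrow> refl n a \<circ> w \<in> coxgrp n \<Phi>"
  by (intro coxgrp_compose coxgrp_refl)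

text \<open>The vector \<open>c\<close> that witnesses the positive system is a parameter, since its
  orbit is the set of points on which polynomials are evaluated throughout.\<close>

locale refl_system =
  fixes n :: nat and \<Phi> P :: "(nat \<Rightarrow> real) set" and c :: "nat \<Rightarrow> real"
  assumes roots: "root_system n \<Phi>"
    and c_vecs: "c \<in> vecs n"
    and c_regular: "\<And>a. a \<in> \<Phi> \<Longrightarrow> ip n a c \<noteq> 0"
    and P_eq: "P = {a\<in>\<Phi>. ip n a c > 0}"
begin

lemma finite_Phi: "finite \<Phi>"
  using roots by (simp add: root_system_def)

lemma finite_P: "finite P"
  using finite_Phi by (simp add: P_eq)

lemma P_sub: "P \<subseteq> \<Phi>"
  by (auto simp: P_eq)

lemma root_vecs: "a \<in> \<Phi> \<Longrightarrow> a \<in> vecs n"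
  using roots by (auto simp: root_system_def)

lemma root_ip_pos: "a \<in> \<Phi> \<Longrightarrow> ip n a a > 0"
  using roots by (intro ip_self_pos) (auto simp: root_system_def)

lemma root_ip_nz: "a \<in> \<Phi> \<Longrightarrow> ip n a a \<noteq> 0"
  using root_ip_pos by fastforce

lemma refl_root: "a \<in> \<Phi> \<Longrightarrow> b \<in> \<Phi> \<Longrightarrow> refl n a b \<in> \<Phi>"
  using roots unfolding root_system_def by blast

lemma spanning: "v \<in> vecs n \<Longrightarrow> \<exists>k. v = (\<lambda>i. \<Sum>a\<in>\<Phi>. k a * a i)"
  using roots unfolding root_system_def by (elim conjE) (erule bspec)

lemma scale_root_iff: "a \<in> \<Phi> \<Longrightarrow> (\<lambda>i. k * a i) \<in> \<Phi> \<longleftrightarrow> k = 1 \<or> k = -1"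
  using roots by (auto simp: root_system_def)

lemma neg_root: "a \<in> \<Phi> \<Longrightarrow> (\<lambda>i. - a i) \<in> \<Phi>"
  using scale_root_iff[of a "-1"] by simp

lemma ip_neg_left: "ip n (\<lambda>i. - u i) w = - ip n u w"
  using ip_scale_left[of n "-1" u w] by simp

lemma neg_P_iff: "a \<in> \<Phi> \<Longrightarrow> (\<lambda>i. - a i) \<in> P \<longleftrightarrow> a \<notin> P"
  using neg_root[of a] c_regular[of a] by (auto simp: P_eq ip_neg_left)

lemma refl_neg: "refl n (\<lambda>i. - a i) = refl n a"
  using refl_eq_if_parallel[of "-1" n a] by simp

lemma refl_self: "a \<in> \<Phi> \<Longrightarrow> refl n a a = (\<lambda>i. - a i)"
  using root_ip_nz[of a] by (auto simp: refl_def)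

lemma refl_refl_root: "a \<in> \<Phi> \<Longrightarrow> refl n a (refl n a v) = v"
  by (rule refl_refl[OF root_ip_nz])

lemma coxgrp_root: "w \<in> coxgrp n \<Phi> \<Longrightarrow> b \<in> \<Phi> \<Longrightarrow> w b \<in> \<Phi>"
  by (induction w arbitrary: b rule: coxgrp.induct) (auto intro: refl_root)

text \<open>Group elements are bare compositions of reflections, so the inverse is built along the
  word. It is adjoint to \<open>w\<close> because reflections are self-adjoint, and this later turns
  inversions of \<open>w\<close> into the length of \<open>u c\<close>.\<close>

lemma coxgrp_inverse:
  assumes "w \<in> coxgrp n \<Phi>"
  shows "\<exists>u\<in>coxgrp n \<Phi>. u \<circ> w = id \<and> w \<circ> u = id \<and> (\<forall>x y. ip n (w x) y = ip n x (u y))"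
  using assms
proof (induction w rule: coxgrp.induct)
  case id_in
  then show ?case by (intro bexI[of _ id] coxgrp.id_in) auto
next
  case (refl_in w a)
  then obtain u where u: "u \<in> coxgrp n \<Phi>" "u \<circ> w = id" "w \<circ> u = id"
    "\<And>x y. ip n (w x) y = ip n x (u y)" by blast
  have uw: "u (w x) = x" "w (u x) = x" for x
    using u(2,3) by (auto simp: fun_eq_iff)
  have "refl n a \<circ> u \<in> coxgrp n \<Phi>"
    using u refl_in by (intro coxgrp_refl_left)
  moreover have "refl n a \<circ> u \<circ> (w \<circ> refl n a) = id" "w \<circ> refl n a \<circ> (refl n a \<circ> u) = id"
    using refl_in(2) by (simp_all add: fun_eq_iff uw refl_refl_root)
  moreover have "ip n ((w \<circ> refl n a) x) y = ip n x ((refl n a \<circ> u) y)" for x y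
    using u(4) by (simp add: ip_refl_symm)
  ultimately show ?case by blast
qed

text \<open>The summand \<open>t\<close> is the tail beyond coordinate \<open>n\<close>, which every
  reflection fixes. Equality in the group is equality on all sequences, so the tail has to be
  carried along.\<close>

lemma coxgrp_linear:
  assumes "w \<in> coxgrp n \<Phi>" "\<And>i. i < n \<Longrightarrow> t i = 0"
  shows "w (\<lambda>i. (\<Sum>j\<in>J. k j * u j i) + t i) = (\<lambda>i. (\<Sum>j\<in>J. k j * w (u j) i) + t i)"
  using assms(1)
proof (induction w arbitrary: u rule: coxgrp.induct)
  case id_in
  then show ?case by simp
next
  case (refl_in w a)
  have "ip n t a = 0" using assms(2) by (simp add: ip_def)
  then have "refl n a (\<lambda>i. (\<Sum>j\<in>J. k j * u j i) + t i) = (\<lambda>i. (\<Sum>j\<in>J. k j * refl n a (u j) i) + t i)"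
    by (simp add: refl_def ip_add_left ip_sum_left fun_eq_iff sum_distrib_left sum_distrib_right
        sum_subtractf algebra_simps sum_divide_distrib)
  then show ?case
    using refl_in.IH[of "\<lambda>j. refl n a (u j)"] by simp
qed

lemma coxgrp_determined:
  assumes "w \<in> coxgrp n \<Phi>" "w' \<in> coxgrp n \<Phi>" "\<And>a. a \<in> \<Phi> \<Longrightarrow> w a = w' a"
  shows "w = w'"
proof
  fix v :: "nat \<Rightarrow> real"
  define t where "t = (\<lambda>i. if i < n then 0 else v i)"
  have "(\<lambda>i. if i < n then v i else 0 :: real) \<in> vecs n" for v by (simp add: vecs_def)
  then obtain k where k: "(\<lambda>i. if i < n then v i else 0) = (\<lambda>i. \<Sum>a\<in>\<Phi>. k a * a i)"
    using spanning by blast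
  have v: "v = (\<lambda>i. (\<Sum>a\<in>\<Phi>. k a * a i) + t i)"
    by (simp add: fun_cong[OF k, symmetric] t_def fun_eq_iff)
  have t: "i < n \<Longrightarrow> t i = 0" for i by (simp add: t_def)
  have "w v = (\<lambda>i. (\<Sum>a\<in>\<Phi>. k a * w a i) + t i)"
    by (subst v) (rule coxgrp_linear[OF assms(1) t])
  also have "\<dots> = (\<lambda>i. (\<Sum>a\<in>\<Phi>. k a * w' a i) + t i)"
    using assms(3) by (intro ext) (simp cong: sum.cong)
  also have "\<dots> = w' v"
    by (subst v) (rule coxgrp_linear[OF assms(2) t, symmetric])
  finally show "w v = w' v" .
qed

lemma finite_coxgrp: "finite (coxgrp n \<Phi>)"
proof (rule inj_on_finite)
  show "inj_on (\<lambda>w. restrict w \<Phi>) (coxgrp n \<Phi>)"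
    by (rule inj_onI, rule coxgrp_determined) (auto simp: restrict_def fun_eq_iff split: if_splits)
  show "(\<lambda>w. restrict w \<Phi>) ` coxgrp n \<Phi> \<subseteq> (\<Pi>\<^sub>E a\<in>\<Phi>. \<Phi>)"
    using coxgrp_root by auto
  show "finite (\<Pi>\<^sub>E a\<in>\<Phi>. \<Phi>)"
    using finite_Phi by (intro finite_PiE) auto
qed

section \<open>The orbit of the regular vector and the length function\<close>

definition orb :: "(nat \<Rightarrow> real) set" where
  "orb = (\<lambda>w. w c) ` coxgrp n \<Phi>"

text \<open>The number of root hyperplanes that separate \<open>y\<close> from
  \<open>c\<close>.\<close>

definition len :: "(nat \<Rightarrow> real) \<Rightarrow> nat" where
  "len y = card {b\<in>P. ip n b y < 0}"

lemma finite_orb: "finite orb"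
  by (simp add: orb_def finite_coxgrp)

lemma c_orb: "c \<in> orb"
  unfolding orb_def by (rule image_eqI[of _ _ id]) (auto intro: coxgrp.id_in)

lemma refl_orb: "a \<in> \<Phi> \<Longrightarrow> y \<in> orb \<Longrightarrow> refl n a y \<in> orb"
  unfolding orb_def using coxgrp_refl_left[of _ n \<Phi> a] by (metis (no_types, lifting) comp_apply imageE imageI)

lemma orb_induct [consumes 1, case_names base step]:
  assumes "y \<in> orb" "Q c" "\<And>a y. y \<in> orb \<Longrightarrow> Q y \<Longrightarrow> a \<in> \<Phi> \<Longrightarrow> Q (refl n a y)"
  shows "Q y"
proof -
  \<comment> \<open>Words grow on the right, so the newest reflection acts first; the claim for
    \<open>w\<close> must therefore cover every starting point in the orbit.\<close>
  have "\<forall>v. v \<in> orb \<and> Q v \<longrightarrow> Q (w v)" if "w \<in> coxgrp n \<Phi>" for w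
    using that by (induction rule: coxgrp.induct) (auto intro: assms refl_orb)
  then show ?thesis
    using assms(1,2) c_orb by (auto simp: orb_def)
qed

lemma orb_regular:
  assumes "y \<in> orb" "b \<in> \<Phi>"
  shows "ip n b y \<noteq> 0"
  using assms
proof (induction arbitrary: b rule: orb_induct)
  case base
  then show ?case by (rule c_regular)
next
  case (step a y)
  then show ?case by (metis ip_refl_symm refl_root)
qed

lemma orb_vecs: "y \<in> orb \<Longrightarrow> y \<in> vecs n"
  by (induction rule: orb_induct) (auto intro: refl_in_vecs root_vecs c_vecs)

lemma len_le: "len y \<le> card P"
  unfolding len_def using finite_P by (intro card_mono) auto

lemma len_c: "len c = 0"
proof -
  have "{b\<in>P. ip n b c < 0} = {}" by (auto simp: P_eq)
  then show ?thesis unfolding len_def by (metis card.empty)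
qed

section \<open>Simple roots and their effect on lengths\<close>

definition nnspan :: "(nat \<Rightarrow> real) set \<Rightarrow> (nat \<Rightarrow> real) \<Rightarrow> bool" where
  "nnspan D b \<longleftrightarrow> (\<exists>x. (\<forall>d\<in>D. x d \<ge> 0) \<and> b = (\<lambda>i. \<Sum>d\<in>D. x d * d i))"

text \<open>Simple roots as an irredundant set of positive roots whose cone contains
  \<open>P\<close>, rather than as a basis or as the indecomposable roots.\<close>

definition simple_sys :: "(nat \<Rightarrow> real) set \<Rightarrow> bool" where
  "simple_sys D \<longleftrightarrow> D \<subseteq> P \<and> (\<forall>b\<in>P. nnspan D b) \<and> (\<forall>a\<in>D. \<exists>b\<in>P. \<not> nnspan (D - {a}) b)"

lemma simple_sys_exists: "\<exists>D. simple_sys D"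
proof -
  let ?G = "\<lambda>D. D \<subseteq> P \<and> (\<forall>b\<in>P. nnspan D b)"
  have "nnspan P b" if "b \<in> P" for b
  proof -
    have "(\<Sum>d\<in>P. of_bool (d = b) * d i) = b i" for i
      using that finite_P by (simp add: of_bool_def if_distrib[of "\<lambda>z. z * _"] cong: if_cong)
    then show ?thesis
      unfolding nnspan_def by (intro exI[of _ "\<lambda>d. of_bool (d = b)"]) auto
  qed
  then have "?G P" by auto
  then obtain D where D: "?G D" "\<And>E. ?G E \<Longrightarrow> card D \<le> card E"
    using ex_has_least_nat[of ?G P card] by blast
  have "\<not> ?G (D - {a})" if "a \<in> D" for a
    using D(2)[of "D - {a}"] card_Diff1_less[of D a] that finite_subset[OF _ finite_P, of D] D(1)
    by (metis not_less)
  then have "simple_sys D"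
    unfolding simple_sys_def using D(1) by blast
  then show ?thesis ..
qed

definition simple :: "(nat \<Rightarrow> real) set" where
  "simple = (SOME D. simple_sys D)"

lemma simple_sys_simple: "simple_sys simple"
  unfolding simple_def by (rule someI_ex[OF simple_sys_exists])

lemma simple_sub: "simple \<subseteq> P"
  using simple_sys_simple by (simp add: simple_sys_def)

lemma simple_root: "a \<in> simple \<Longrightarrow> a \<in> \<Phi>"
  using simple_sub P_sub by blast

lemma finite_simple: "finite simple"
  using simple_sub finite_P finite_subset by blast

lemma P_nnspan:
  assumes "b \<in> P"
  obtains x where "\<And>d. d \<in> simple \<Longrightarrow> x d \<ge> 0" "b = (\<lambda>i. \<Sum>d\<in>simple. x d * d i)"
  using simple_sys_simple assms unfolding simple_sys_def nnspan_def by blast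

lemma P_ip_simple_pos:
  assumes "b \<in> P" "ip n b y > 0"
  shows "\<exists>a\<in>simple. ip n a y > 0"
proof (rule ccontr)
  assume "\<not> ?thesis"
  then have *: "\<And>a. a \<in> simple \<Longrightarrow> ip n a y \<le> 0" by force
  obtain x where x: "\<And>d. d \<in> simple \<Longrightarrow> x d \<ge> 0" "b = (\<lambda>i. \<Sum>d\<in>simple. x d * d i)"
    using P_nnspan[OF assms(1)] by blast
  have "ip n b y \<le> 0"
    by (subst x(2), subst ip_sum_left, rule sum_nonpos) (auto simp: * x mult_nonneg_nonpos)
  with assms(2) show False by simp
qed

text \<open>Minimality of the simple system enters here: if the reflection in \<open>a\<close> made a second
  positive root negative, then \<open>a\<close> itself would lie in the cone of the other simple roots.\<close>
lemma simple_refl_P: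
  assumes a: "a \<in> simple" and b: "b \<in> P" "b \<noteq> a"
  shows "refl n a b \<in> P - {a}"
proof -
  have aP: "a \<in> P" "a \<in> \<Phi>" using a simple_sub P_sub by auto
  have bP: "b \<in> \<Phi>" using b P_sub by auto
  define \<kappa> where "\<kappa> = 2 * ip n b a / ip n a a"
  have sab: "refl n a b = (\<lambda>i. b i - \<kappa> * a i)"
    by (simp add: refl_def \<kappa>_def)
  have "refl n a b \<noteq> a"
  proof
    assume "refl n a b = a"
    then have "b = refl n a a" using refl_refl_root[OF aP(2)] by metis
    then have "b = (\<lambda>i. - a i)" by (simp add: refl_self aP)
    then show False using neg_P_iff[OF aP(2)] aP b by simp
  qed
  moreover have "refl n a b \<in> P"
  proof (rule ccontr)
    assume "refl n a b \<notin> P"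
    then have neg: "(\<lambda>i. - refl n a b i) \<in> P"
      using neg_P_iff[OF refl_root[OF aP(2) bP]] by simp
    obtain x where x: "\<And>d. d \<in> simple \<Longrightarrow> x d \<ge> 0" "b = (\<lambda>i. \<Sum>d\<in>simple. x d * d i)"
      using P_nnspan[OF b(1)] by blast
    obtain y where y: "\<And>d. d \<in> simple \<Longrightarrow> y d \<ge> 0"
      "(\<lambda>i. - refl n a b i) = (\<lambda>i. \<Sum>d\<in>simple. y d * d i)"
      using P_nnspan[OF neg] by blast
    let ?D = "simple - {a}"
    \<comment> \<open>Adding the cone expansions of \<open>b\<close> and of
      \<open>\<kappa> a - b\<close> and moving the \<open>a\<close> terms to one side writes
      \<open>m a\<close> as a nonnegative combination of the other simple roots.\<close>
    define m where "m = \<kappa> - x a - y a"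
    have split: "(\<Sum>d\<in>simple. z d * d i) = z a * a i + (\<Sum>d\<in>?D. z d * d i)" for z :: "(nat \<Rightarrow> real) \<Rightarrow> real" and i
      using a finite_simple by (simp add: sum.remove)
    have eq: "m * a i = (\<Sum>d\<in>?D. (x d + y d) * d i)" for i
    proof -
      have "b i = x a * a i + (\<Sum>d\<in>?D. x d * d i)"
        using fun_cong[OF x(2), of i] split by simp
      moreover have "\<kappa> * a i - b i = y a * a i + (\<Sum>d\<in>?D. y d * d i)"
        using fun_cong[OF y(2), of i] split sab by simp
      moreover have "(\<Sum>d\<in>?D. (x d + y d) * d i) = (\<Sum>d\<in>?D. x d * d i) + (\<Sum>d\<in>?D. y d * d i)"
        by (simp add: sum.distrib algebra_simps)
      ultimately show ?thesis by (simp add: m_def algebra_simps)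
    qed
    show False
    proof (cases "m > 0")
      case True
      have a_eq: "a = (\<lambda>i. \<Sum>d\<in>?D. (x d + y d) / m * d i)"
      proof
        fix i
        have "a i = (m * a i) / m" using True by simp
        also have "\<dots> = (\<Sum>d\<in>?D. (x d + y d) * d i) / m" by (simp only: eq)
        finally show "a i = (\<Sum>d\<in>?D. (x d + y d) / m * d i)" by (simp add: sum_divide_distrib)
      qed
      have "nnspan ?D b'" if b': "b' \<in> P" for b'
      proof -
        obtain z where z: "\<And>d. d \<in> simple \<Longrightarrow> z d \<ge> 0" "b' = (\<lambda>i. \<Sum>d\<in>simple. z d * d i)"
          using P_nnspan[OF b'] by blast
        have "b' = (\<lambda>i. \<Sum>d\<in>?D. (z d + z a * ((x d + y d) / m)) * d i)"
        proof
          fix i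
          have "b' i = z a * a i + (\<Sum>d\<in>?D. z d * d i)"
            using fun_cong[OF z(2), of i] split by simp
          also have "a i = (\<Sum>d\<in>?D. (x d + y d) / m * d i)"
            by (subst a_eq) simp
          finally show "b' i = (\<Sum>d\<in>?D. (z d + z a * ((x d + y d) / m)) * d i)"
            by (simp add: sum_distrib_left sum.distrib algebra_simps)
        qed
        moreover have "z d + z a * ((x d + y d) / m) \<ge> 0" if "d \<in> ?D" for d
          using that x(1) y(1) z(1) a True by (intro add_nonneg_nonneg mult_nonneg_nonneg divide_nonneg_pos) auto
        ultimately show ?thesis
          unfolding nnspan_def
          by (intro exI[of _ "\<lambda>d. z d + z a * ((x d + y d) / m)"] conjI ballI)
      qed
      then show False using simple_sys_simple a unfolding simple_sys_def by blast
    next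
      case False
      \<comment> \<open>Pairing with \<open>c\<close> gives a nonpositive left and a nonnegative
        right side, so all coefficients vanish and \<open>b\<close> is a nonnegative multiple of
        \<open>a\<close>, which reducedness and \<open>b \<noteq> a\<close> exclude.\<close>
      have pos: "d \<in> simple \<Longrightarrow> ip n d c > 0" for d using simple_sub by (auto simp: P_eq)
      have "0 \<ge> m * ip n a c" using False pos[OF a] by (simp add: mult_nonpos_nonneg)
      also have "m * ip n a c = ip n (\<lambda>i. m * a i) c" by (simp add: ip_scale_left)
      also have "\<dots> = (\<Sum>d\<in>?D. (x d + y d) * ip n d c)"
        unfolding eq by (rule ip_sum_left)
      finally have le: "(\<Sum>d\<in>?D. (x d + y d) * ip n d c) \<le> 0" .
      have nn: "d \<in> ?D \<Longrightarrow> (x d + y d) * ip n d c \<ge> 0" for d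
        using x(1)[of d] y(1)[of d] pos[of d] by simp
      have "(\<Sum>d\<in>?D. (x d + y d) * ip n d c) = 0"
        by (rule antisym[OF le sum_nonneg[OF nn]])
      then have *: "\<forall>d\<in>?D. (x d + y d) * ip n d c = 0"
        using sum_nonneg_eq_0_iff[of ?D "\<lambda>d. (x d + y d) * ip n d c"] nn finite_simple
        by blast
      have "x d = 0" if "d \<in> ?D" for d
      proof -
        have "(x d + y d) * ip n d c = 0" "ip n d c > 0" "x d \<ge> 0" "y d \<ge> 0"
          using that * x(1)[of d] y(1)[of d] pos[of d] by auto
        then show ?thesis by (auto simp: mult_eq_0_iff)
      qed
      then have bxa: "b = (\<lambda>i. x a * a i)"
        using x(2) by (simp add: split)
      then have "x a = 1 \<or> x a = -1"
        using scale_root_iff[OF aP(2), of "x a"] bP by simp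
      then show False using b x(1)[OF a] bxa by auto
    qed
  qed
  ultimately show ?thesis by simp
qed

text \<open>The reflection permutes the positive roots other than \<open>a\<close>, so only the sign
  at \<open>a\<close> changes.\<close>

lemma len_refl_simple:
  assumes a: "a \<in> simple" and y: "y \<in> orb"
  shows "ip n a y > 0 \<Longrightarrow> len (refl n a y) = Suc (len y)"
    and "ip n a y < 0 \<Longrightarrow> Suc (len (refl n a y)) = len y"
proof -
  have aP: "a \<in> P" "a \<in> \<Phi>" using a simple_sub P_sub by auto
  let ?N = "\<lambda>y. {b\<in>P - {a}. ip n b y < 0}"
  have inv: "refl n a (refl n a b) = b" for b by (rule refl_refl_root[OF aP(2)])
  have "bij_betw (refl n a) (?N (refl n a y)) (?N y)"
    by (rule bij_betw_byWitness[of _ "refl n a"])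
      (use simple_refl_P[OF a] in \<open>auto simp: inv ip_refl_symm\<close>)
  then have eq: "card (?N (refl n a y)) = card (?N y)" by (rule bij_betw_same_card)
  have 1: "len z = card (?N z)" if "ip n a z > 0" for z
  proof -
    have "{b\<in>P. ip n b z < 0} = ?N z" using that by auto
    then show ?thesis unfolding len_def by simp
  qed
  have 2: "len z = Suc (card (?N z))" if "ip n a z < 0" for z
  proof -
    have "{b\<in>P. ip n b z < 0} = insert a (?N z)" using that aP by auto
    then show ?thesis unfolding len_def using finite_P by simp
  qed
  have "ip n a (refl n a y) = - ip n a y"
    by (simp add: ip_refl_symm[symmetric] refl_self aP ip_neg_left)
  then show "ip n a y > 0 \<Longrightarrow> len (refl n a y) = Suc (len y)"
    "ip n a y < 0 \<Longrightarrow> Suc (len (refl n a y)) = len y"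
    using 1 2 eq by auto
qed

lemma len_refl_simple_le: "a \<in> simple \<Longrightarrow> y \<in> orb \<Longrightarrow> len (refl n a y) \<le> Suc (len y)"
  using len_refl_simple[of a y] orb_regular[of y a] simple_root[of a]
  by (cases "ip n a y" "0::real" rule: linorder_cases) auto

text \<open>Induction on the position of \<open>b\<close> in the order of \<open>ip n b c\<close>: a
  simple \<open>a\<close> with \<open>ip n a b > 0\<close> moves a non-simple \<open>b\<close> down,
  and the reflection in \<open>b\<close> is conjugate, by that in \<open>a\<close>, to the one in
  the lower root. A set \<open>T\<close> closed under simple reflections takes the place of the
  subgroup they generate.\<close>

lemma simple_refl_generate:
  assumes T: "\<And>a y. a \<in> simple \<Longrightarrow> y \<in> T \<Longrightarrow> refl n a y \<in> T"
    and b: "b \<in> \<Phi>" "y \<in> T"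
  shows "refl n b y \<in> T"
proof -
  have pos: "refl n b y \<in> T" if "b \<in> P" "y \<in> T" for b y
    using that
  proof (induction "card {b'\<in>P. ip n b' c < ip n b c}" arbitrary: b y rule: less_induct)
    case less
    show ?case
    proof (cases "b \<in> simple")
      case True
      then show ?thesis using T less.prems by blast
    next
      case False
      have bP: "b \<in> \<Phi>" using less.prems P_sub by auto
      obtain a where a: "a \<in> simple" "ip n a b > 0"
        using P_ip_simple_pos[OF less.prems(1) root_ip_pos[OF bP]] by blast
      have aP: "a \<in> \<Phi>" "ip n a c > 0" using a simple_sub by (auto simp: P_eq)
      let ?b = "refl n a b"
      have b': "?b \<in> P"
        using simple_refl_P[OF a(1) less.prems(1)] a False by auto
      have "2 * ip n b a / ip n a a * ip n a c > 0"
        using a aP root_ip_pos[OF aP(1)] by (simp add: ip_commute[of n b])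
      then have lt: "ip n ?b c < ip n b c"
        by (simp add: ip_refl_left)
      have "card {b'\<in>P. ip n b' c < ip n ?b c} < card {b'\<in>P. ip n b' c < ip n b c}"
        using lt b' finite_P by (intro psubset_card_mono) auto
      then have IH: "refl n ?b z \<in> T" if "z \<in> T" for z
        using less.hyps b' that by blast
      have "refl n b y = refl n (refl n a ?b) y"
        by (simp add: refl_refl_root aP)
      also have "\<dots> = refl n a (refl n ?b (refl n a y))"
        by (rule refl_conj[OF root_ip_nz[OF aP(1)]])
      finally show ?thesis using T a(1) IH less.prems(2) by auto
    qed
  qed
  show ?thesis
  proof (cases "b \<in> P")
    case True
    then show ?thesis using pos b by blast
  next
    case False
    then show ?thesis
      using pos[of "\<lambda>i. - b i" y] neg_P_iff[OF b(1)] b by (simp add: refl_neg)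
  qed
qed

lemma orb_simple_induct [consumes 1, case_names base step]:
  assumes "y \<in> orb" "Q c" "\<And>a y. y \<in> orb \<Longrightarrow> Q y \<Longrightarrow> a \<in> simple \<Longrightarrow> Q (refl n a y)"
  shows "Q y"
  using assms(1)
proof (induction rule: orb_induct)
  case base
  then show ?case by (rule assms(2))
next
  case (step a y)
  have "refl n a y \<in> {y \<in> orb. Q y}"
    by (rule simple_refl_generate) (use step assms(3) refl_orb simple_root in auto)
  then show ?case by simp
qed

lemma orb_ascend:
  assumes "y \<in> orb" "len y < card P"
  obtains a where "a \<in> simple" "ip n a y > 0"
proof -
  have "{b\<in>P. ip n b y < 0} \<noteq> P"
    using assms(2) unfolding len_def by auto
  then obtain b where b: "b \<in> P" "\<not> ip n b y < 0" by auto
  then have "ip n b y > 0" using orb_regular[OF assms(1)] P_sub by fastforce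
  then show thesis using P_ip_simple_pos b that by blast
qed

text \<open>By adjointness the value of \<open>w b\<close> at \<open>c\<close> is the value of
  \<open>b\<close> at \<open>u c\<close>.\<close>

lemma inv_vs_len:
  assumes "w \<in> coxgrp n \<Phi>" "u \<in> coxgrp n \<Phi>" "\<And>x y. ip n (w x) y = ip n x (u y)"
  shows "ninv \<Phi> P w = len (u c)"
proof -
  have "w b \<in> \<Phi> - P \<longleftrightarrow> ip n b (u c) < 0" if "b \<in> P" for b
    using that coxgrp_root[OF assms(1)] c_regular[of "w b"] P_sub
    by (auto simp: P_eq assms(3) linorder_neq_iff)
  then have "{b\<in>P. w b \<in> \<Phi> - P} = {b\<in>P. ip n b (u c) < 0}" by auto
  then show ?thesis unfolding ninv_def len_def by simp
qed

end

section \<open>Homogeneous polynomial functions\<close>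

text \<open>Generated by multiplication with coordinates, so that the facts below follow by rule
  induction; \<open>homog_poly_iff\<close> identifies it with the definition by
  coefficients.\<close>

inductive hp :: "nat \<Rightarrow> nat \<Rightarrow> ((nat \<Rightarrow> real) \<Rightarrow> real) \<Rightarrow> bool" for n where
  hp_zero: "hp n k (\<lambda>_. 0)"
| hp_const: "hp n 0 (\<lambda>_. c)"
| hp_var: "i < n \<Longrightarrow> hp n k f \<Longrightarrow> hp n (Suc k) (\<lambda>v. v i * f v)"
| hp_add: "hp n k f \<Longrightarrow> hp n k g \<Longrightarrow> hp n k (\<lambda>v. f v + g v)"

lemma hp_scale: "hp n k f \<Longrightarrow> hp n k (\<lambda>v. c * f v)"
proof (induction rule: hp.induct)
  case (hp_var i k f)
  then show ?case
    using hp.hp_var[OF hp_var(1) hp_var.IH] by (simp add: mult.left_commute)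
qed (auto simp: distrib_left intro: hp.intros)

lemma hp_minus: "hp n k f \<Longrightarrow> hp n k (\<lambda>v. - f v)"
  using hp_scale[of n k f "-1"] by simp

lemma hp_diff: "hp n k f \<Longrightarrow> hp n k g \<Longrightarrow> hp n k (\<lambda>v. f v - g v)"
  using hp_add[OF _ hp_minus, of n k f g] by simp

lemma hp_sum: "(\<And>x. x \<in> A \<Longrightarrow> hp n k (f x)) \<Longrightarrow> hp n k (\<lambda>v. \<Sum>x\<in>A. f x v)"
  by (induction A rule: infinite_finite_induct) (auto intro: hp.intros)

lemma hp_mult: "hp n j f \<Longrightarrow> hp n k g \<Longrightarrow> hp n (j + k) (\<lambda>v. f v * g v)"
proof (induction rule: hp.induct)
  case (hp_zero j)
  then show ?case by (simp add: hp.hp_zero)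
next
  case (hp_const c)
  then show ?case by (simp add: hp_scale)
next
  case (hp_var i j f)
  then show ?case using hp.hp_var[OF hp_var(1) hp_var.IH] by (simp add: mult.assoc)
next
  case (hp_add j f1 f2)
  then show ?case by (simp add: distrib_right hp.hp_add)
qed

lemma hp_coord: "i < n \<Longrightarrow> hp n (Suc 0) (\<lambda>v. v i)"
  using hp_var[OF _ hp_const[of n 1], of i] by simp

lemma hp_ip: "hp n (Suc 0) (\<lambda>v. ip n v a)"
  unfolding ip_commute[of n _ a] unfolding ip_def by (intro hp_sum hp_scale hp_coord) simp

lemma hp_prod:
  assumes "\<And>x. x \<in> A \<Longrightarrow> hp n (d x) (f x)"
  shows "hp n (\<Sum>x\<in>A. d x) (\<lambda>v. \<Prod>x\<in>A. f x v)"
  using assms by (induction A rule: infinite_finite_induct) (auto intro: hp_const hp_mult)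

lemma hp_power: "hp n d f \<Longrightarrow> hp n (m * d) (\<lambda>v. f v ^ m)"
  by (induction m) (auto intro: hp_const hp_mult)

lemma hp_refl_coord:
  assumes "i < n"
  shows "hp n (Suc 0) (\<lambda>v. refl n a v i)"
proof -
  have "hp n (Suc 0) (\<lambda>v. v i - (2 * a i / ip n a a) * ip n v a)"
    by (intro hp_diff hp_scale hp_ip hp_coord assms)
  moreover have "(\<lambda>v. refl n a v i) = (\<lambda>v. v i - (2 * a i / ip n a a) * ip n v a)"
    by (simp add: refl_def mult.commute mult.left_commute)
  ultimately show ?thesis by simp
qed

lemma hp_refl: "hp n k f \<Longrightarrow> hp n k (\<lambda>v. f (refl n a v))"
proof (induction rule: hp.induct)
  case (hp_var i k f)
  then show ?case using hp_mult[OF hp_refl_coord[of i n a] hp_var.IH] by simp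
qed (auto intro: hp.intros)

text \<open>The twisted product rule builds the quotient along the construction of \<open>f\<close>:
  the difference of a product is \<open>v i\<close> times the difference of \<open>f\<close>, plus
  the difference of the coordinate times the reflected \<open>f\<close>, and both are multiples of
  \<open>ip n v a\<close>. The clause for \<open>k = 0\<close> makes up for the truncation of
  \<open>k - 1\<close> when a coordinate is multiplied on.\<close>

lemma hp_divided_difference:
  assumes "hp n k f"
  obtains g where "hp n (k - 1) g" "k = 0 \<Longrightarrow> g = (\<lambda>_. 0)"
    "\<And>v. f v - f (refl n a v) = ip n v a * g v"
proof -
  have "\<exists>g. hp n (k - 1) g \<and> (k = 0 \<longrightarrow> g = (\<lambda>_. 0)) \<and> (\<forall>v. f v - f (refl n a v) = ip n v a * g v)"
    using assms
  proof (induction rule: hp.induct)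
    case (hp_zero k)
    then show ?case by (intro exI[of _ "\<lambda>_. 0"]) (auto intro: hp.intros)
  next
    case (hp_const c)
    then show ?case by (intro exI[of _ "\<lambda>_. 0"]) (auto intro: hp.intros)
  next
    case (hp_var i k f)
    then obtain g where g: "hp n (k - 1) g" "k = 0 \<longrightarrow> g = (\<lambda>_. 0)"
      "\<And>v. f v - f (refl n a v) = ip n v a * g v" by auto
    let ?h = "\<lambda>v. v i * g v + (2 * a i / ip n a a) * f (refl n a v)"
    have "hp n k (\<lambda>v. v i * g v)"
    proof (cases k)
      case 0
      then show ?thesis using g by (simp add: hp_zero)
    next
      case (Suc m)
      then show ?thesis using hp.hp_var[OF hp_var(1) g(1)] by simp
    qed
    then have "hp n k ?h" by (intro hp_add hp_scale hp_refl hp_var)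
    moreover have "v i * f v - refl n a v i * f (refl n a v) = ip n v a * ?h v" for v
    proof -
      have "v i * f v - refl n a v i * f (refl n a v)
          = v i * (f v - f (refl n a v)) + (v i - refl n a v i) * f (refl n a v)"
        by (simp add: algebra_simps)
      also have "v i - refl n a v i = ip n v a * (2 * a i / ip n a a)"
        by (simp add: refl_def)
      finally show ?thesis by (simp only: g(3)) (simp add: algebra_simps)
    qed
    ultimately show ?case by (intro exI[of _ ?h]) simp
  next
    case (hp_add k f1 f2)
    then obtain g1 g2 where "hp n (k - 1) g1" "k = 0 \<longrightarrow> g1 = (\<lambda>_. 0)"
      "\<And>v. f1 v - f1 (refl n a v) = ip n v a * g1 v"
      "hp n (k - 1) g2" "k = 0 \<longrightarrow> g2 = (\<lambda>_. 0)"
      "\<And>v. f2 v - f2 (refl n a v) = ip n v a * g2 v"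
      by auto
    note g = this
    have "f1 v + f2 v - (f1 (refl n a v) + f2 (refl n a v)) = ip n v a * (g1 v + g2 v)" for v
    proof -
      have "f1 v + f2 v - (f1 (refl n a v) + f2 (refl n a v))
          = (f1 v - f1 (refl n a v)) + (f2 v - f2 (refl n a v))" by simp
      then show ?thesis by (simp only: g) (simp add: distrib_left)
    qed
    moreover have "k = 0 \<longrightarrow> (\<lambda>v. g1 v + g2 v) = (\<lambda>_. 0)" using g by auto
    ultimately show ?case
      using hp.hp_add[OF g(1,4)] by (intro exI[of _ "\<lambda>v. g1 v + g2 v"] conjI allI)
  qed
  then show thesis using that by blast
qed

lemma hp_cong:
  assumes "hp n k f" "\<And>i. i < n \<Longrightarrow> u i = v i"
  shows "f u = f v"
  using assms by (induction rule: hp.induct) auto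

lemma hp_0_const: "hp n k f \<Longrightarrow> k = 0 \<Longrightarrow> \<exists>c. f = (\<lambda>_. c)"
  by (induction rule: hp.induct) auto

section \<open>Monomials with weighted exponents\<close>

definition mons :: "'a set \<Rightarrow> ('a \<Rightarrow> nat) \<Rightarrow> nat \<Rightarrow> ('a \<Rightarrow> nat) set" where
  "mons A d k = {M. (\<forall>x. x \<notin> A \<longrightarrow> M x = 0) \<and> (\<Sum>x\<in>A. M x * d x) = k}"

definition mon :: "'a set \<Rightarrow> ('a \<Rightarrow> 'v \<Rightarrow> real) \<Rightarrow> ('a \<Rightarrow> nat) \<Rightarrow> 'v \<Rightarrow> real" where
  "mon A \<phi> M v = (\<Prod>x\<in>A. \<phi> x v ^ M x)"

lemma finite_mons:
  assumes "finite A" "\<And>x. x \<in> A \<Longrightarrow> d x \<ge> 1"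
  shows "finite (mons A d k)"
proof -
  have "M x \<le> k" if "M \<in> mons A d k" "x \<in> A" for M x
  proof -
    have "M x \<le> M x * d x" using assms(2)[OF that(2)] by simp
    also have "\<dots> \<le> (\<Sum>x\<in>A. M x * d x)" using that assms by (intro member_le_sum) auto
    finally show ?thesis using that by (simp add: mons_def)
  qed
  then have "mons A d k \<subseteq> {M. \<forall>x. (x \<in> A \<longrightarrow> M x \<in> {..k}) \<and> (x \<notin> A \<longrightarrow> M x = 0)}"
    by (auto simp: mons_def)
  then show ?thesis
    using finite_set_of_finite_funs[OF assms(1), of "{..k}" 0] finite_subset by blast
qed

lemma hp_mon:
  assumes "M \<in> mons A d k" "\<And>x. x \<in> A \<Longrightarrow> hp n (d x) (\<phi> x)"
  shows "hp n k (mon A \<phi> M)"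
proof -
  have "hp n (\<Sum>x\<in>A. M x * d x) (\<lambda>v. \<Prod>x\<in>A. \<phi> x v ^ M x)"
    by (intro hp_prod hp_power assms)
  then show ?thesis
    using assms(1) by (simp add: mons_def mon_def[abs_def])
qed

lemma mon_upd:
  assumes "finite A" "x \<in> A"
  shows "mon A \<phi> (M(x := Suc (M x))) v = \<phi> x v * mon A \<phi> M v"
proof -
  have "(\<Prod>y\<in>A - {x}. \<phi> y v ^ (M(x := Suc (M x))) y) = (\<Prod>y\<in>A - {x}. \<phi> y v ^ M y)"
    by (rule prod.cong) auto
  then show ?thesis
    using assms by (simp add: mon_def prod.remove[of A x])
qed

lemma wt_upd:
  assumes "finite A" "x \<in> A"
  shows "(\<Sum>y\<in>A. (M(x := Suc (M x))) y * d y) = d x + (\<Sum>y\<in>A. M y * d y)"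
proof -
  have "(\<Sum>y\<in>A - {x}. (M(x := Suc (M x))) y * d y) = (\<Sum>y\<in>A - {x}. M y * d y)"
    by (rule sum.cong) auto
  then show ?thesis
    using assms by (simp add: sum.remove[of A x])
qed

lemma mons_decrease:
  assumes "finite A" "y \<in> A" "M \<in> mons A d k" "M y > 0"
  shows "d y \<le> k" "M(y := M y - 1) \<in> mons A d (k - d y)"
proof -
  let ?M = "M(y := M y - 1)"
  have "?M(y := Suc (?M y)) = M" using assms(4) by (intro ext) simp
  then have "k = d y + (\<Sum>x\<in>A. ?M x * d x)"
    using wt_upd[OF assms(1,2), where M = ?M and d = d] assms(3) by (simp add: mons_def)
  then show "d y \<le> k" "?M \<in> mons A d (k - d y)"
    using assms by (auto simp: mons_def)
qed

lemma mons_increase: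
  assumes "finite A" "y \<in> A" "M \<in> mons A d (k - d y)" "d y \<le> k"
  shows "M(y := Suc (M y)) \<in> mons A d k"
proof -
  have "(\<Sum>x\<in>A. (M(y := Suc (M y))) x * d x) = k"
    unfolding wt_upd[OF assms(1,2)] using assms(3,4) by (simp add: mons_def)
  then show ?thesis using assms by (auto simp: mons_def)
qed

abbreviation exps :: "nat \<Rightarrow> nat \<Rightarrow> (nat \<Rightarrow> nat) set" where
  "exps n \<equiv> mons {..<n} (\<lambda>_. Suc 0)"

abbreviation cmon :: "nat \<Rightarrow> (nat \<Rightarrow> nat) \<Rightarrow> (nat \<Rightarrow> real) \<Rightarrow> real" where
  "cmon n \<equiv> mon {..<n} (\<lambda>i v. v i)"

lemma exps_eq: "exps n k = {e. (\<forall>i\<ge>n. e i = 0) \<and> (\<Sum>i<n. e i) = k}"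
  by (auto simp: mons_def)

lemma finite_exps: "finite (exps n k)"
  by (intro finite_mons) auto

lemma homog_poly_iff_cmon: "homog_poly n k f \<longleftrightarrow> (\<exists>C. \<forall>v. f v = (\<Sum>e\<in>exps n k. C e * cmon n e v))"
proof
  assume "homog_poly n k f"
  then obtain C E where E: "finite E" "E \<subseteq> exps n k" "\<And>v. f v = (\<Sum>e\<in>E. C e * (\<Prod>i<n. v i ^ e i))"
    unfolding homog_poly_def exps_eq by blast
  have "f v = (\<Sum>e\<in>exps n k. (if e \<in> E then C e else 0) * cmon n e v)" for v
    unfolding E(3) mon_def using E(1,2) finite_exps
    by (intro sum.mono_neutral_cong_left) auto
  then show "\<exists>C. \<forall>v. f v = (\<Sum>e\<in>exps n k. C e * cmon n e v)"
    by (intro exI[of _ "\<lambda>e. if e \<in> E then C e else 0"]) simp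
next
  assume "\<exists>C. \<forall>v. f v = (\<Sum>e\<in>exps n k. C e * cmon n e v)"
  then obtain C where "\<And>v. f v = (\<Sum>e\<in>exps n k. C e * cmon n e v)" by blast
  then show "homog_poly n k f"
    unfolding homog_poly_def
    by (intro exI[of _ C] exI[of _ "exps n k"]) (use finite_exps in \<open>auto simp: exps_eq mon_def\<close>)
qed

lemma hp_cmon: "e \<in> exps n k \<Longrightarrow> hp n k (cmon n e)"
  by (rule hp_mon) (auto intro: hp_coord)

lemma homog_poly_iff: "homog_poly n k f \<longleftrightarrow> hp n k f"
proof
  assume "homog_poly n k f"
  then obtain C where "\<And>v. f v = (\<Sum>e\<in>exps n k. C e * cmon n e v)"
    using homog_poly_iff_cmon by blast
  then have "f = (\<lambda>v. \<Sum>e\<in>exps n k. C e * cmon n e v)" by auto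
  then show "hp n k f" by (simp add: hp_sum hp_scale hp_cmon)
next
  assume "hp n k f"
  then have "\<exists>C. \<forall>v. f v = (\<Sum>e\<in>exps n k. C e * cmon n e v)"
  proof (induction rule: hp.induct)
    case (hp_zero k)
    then show ?case by (intro exI[of _ "\<lambda>_. 0"]) simp
  next
    case (hp_const c)
    have "exps n 0 = {\<lambda>_. 0}"
      unfolding exps_eq by (auto simp: fun_eq_iff) (metis lessThan_iff not_le)
    then show ?case by (intro exI[of _ "\<lambda>_. c"]) (simp add: mon_def)
  next
    case (hp_var i k f)
    then obtain C where C: "\<And>v. f v = (\<Sum>e\<in>exps n k. C e * cmon n e v)" by auto
    let ?u = "\<lambda>e. e(i := Suc (e i))"
    let ?d = "\<lambda>e. e(i := e i - 1)"
    have inj: "inj_on ?u (exps n k)"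
      by (rule inj_on_inverseI[of _ ?d]) simp
    have sub: "?u ` exps n k \<subseteq> exps n (Suc k)"
    proof
      fix e' assume "e' \<in> ?u ` exps n k"
      then obtain e where e: "e \<in> exps n k" "e' = ?u e" by auto
      have "(\<Sum>y<n. (?u e) y * Suc 0) = Suc 0 + (\<Sum>y<n. e y * Suc 0)"
        by (rule wt_upd) (use hp_var in auto)
      then show "e' \<in> exps n (Suc k)" using e hp_var by (auto simp: mons_def)
    qed
    have "v i * f v = (\<Sum>e\<in>exps n (Suc k). (if e \<in> ?u ` exps n k then C (?d e) else 0) * cmon n e v)" for v
    proof -
      have "(\<Sum>e\<in>exps n (Suc k). (if e \<in> ?u ` exps n k then C (?d e) else 0) * cmon n e v)
          = (\<Sum>e\<in>?u ` exps n k. C (?d e) * cmon n e v)"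
        using sub finite_exps by (intro sum.mono_neutral_cong_right) auto
      also have "\<dots> = (\<Sum>e\<in>exps n k. C e * cmon n (?u e) v)"
        by (subst sum.reindex[OF inj]) simp
      also have "\<dots> = v i * f v"
        using hp_var(1) by (simp add: C mon_upd sum_distrib_left algebra_simps)
      finally show ?thesis by simp
    qed
    then show ?case
      by (intro exI[of _ "\<lambda>e. if e \<in> ?u ` exps n k then C (?d e) else 0"] allI)
  next
    case (hp_add k f g)
    then obtain C D where "\<And>v. f v = (\<Sum>e\<in>exps n k. C e * cmon n e v)"
      "\<And>v. g v = (\<Sum>e\<in>exps n k. D e * cmon n e v)" by blast
    then show ?case by (intro exI[of _ "\<lambda>e. C e + D e"]) (simp add: sum.distrib algebra_simps)
  qed
  then show "homog_poly n k f" by (simp add: homog_poly_iff_cmon)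
qed

lemma hp_expand:
  assumes "hp n k f"
  obtains C where "\<And>v. f v = (\<Sum>e\<in>exps n k. C e * cmon n e v)"
  using assms homog_poly_iff homog_poly_iff_cmon by blast

section \<open>Partial derivatives and Euler's identity\<close>

definition pd :: "nat \<Rightarrow> ((nat \<Rightarrow> real) \<Rightarrow> real) \<Rightarrow> (nat \<Rightarrow> real) \<Rightarrow> real" where
  "pd i f v = deriv (\<lambda>s. f (v(i := s))) (v i)"

text \<open>Existence of the derivative is proved together with its being polynomial, so that
  \<open>pd\<close>, defined through \<open>deriv\<close>, never takes an unspecified value on
  \<open>hp\<close> functions.\<close>

lemma hp_deriv_exists:
  assumes "hp n k f"
  shows "\<exists>g. hp n (k - 1) g \<and> (k = 0 \<longrightarrow> g = (\<lambda>_. 0)) \<and>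
    (\<forall>v. ((\<lambda>s. f (v(i := s))) has_real_derivative g v) (at (v i)))"
  using assms
proof (induction rule: hp.induct)
  case (hp_zero k)
  then show ?case by (intro exI[of _ "\<lambda>_. 0"]) (auto intro: hp.intros)
next
  case (hp_const c)
  then show ?case by (intro exI[of _ "\<lambda>_. 0"]) (auto intro: hp.intros)
next
  case (hp_var j k f)
  then obtain g where g: "hp n (k - 1) g" "k = 0 \<longrightarrow> g = (\<lambda>_. 0)"
    "\<And>v. ((\<lambda>s. f (v(i := s))) has_real_derivative g v) (at (v i))" by blast
  let ?h = "\<lambda>v. of_bool (i = j) * f v + v j * g v"
  have "hp n k (\<lambda>v. v j * g v)"
  proof (cases k)
    case 0
    then show ?thesis using g by (simp add: hp_zero)
  next
    case (Suc m)
    then show ?thesis using hp.hp_var[OF hp_var(1) g(1)] by simp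
  qed
  then have "hp n k ?h" by (intro hp_add hp_scale hp_var)
  moreover have "((\<lambda>s. (v(i := s)) j * f (v(i := s))) has_real_derivative ?h v) (at (v i))" for v
  proof -
    have *: "((\<lambda>s. (v(i := s)) j) has_real_derivative of_bool (i = j)) (at (v i))"
      by (cases "i = j") (auto intro!: derivative_eq_intros)
    show ?thesis
      using DERIV_mult[OF * g(3)[of v]] by (simp add: algebra_simps)
  qed
  moreover have "Suc k = 0 \<longrightarrow> ?h = (\<lambda>_. 0)" by simp
  ultimately show ?case
    unfolding diff_Suc_1 by (intro exI[of _ ?h] conjI allI)
next
  case (hp_add k f1 f2)
  then obtain g1 g2 where g: "hp n (k - 1) g1" "k = 0 \<longrightarrow> g1 = (\<lambda>_. 0)"
    "\<And>v. ((\<lambda>s. f1 (v(i := s))) has_real_derivative g1 v) (at (v i))"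
    "hp n (k - 1) g2" "k = 0 \<longrightarrow> g2 = (\<lambda>_. 0)"
    "\<And>v. ((\<lambda>s. f2 (v(i := s))) has_real_derivative g2 v) (at (v i))"
    by blast
  have "((\<lambda>s. f1 (v(i := s)) + f2 (v(i := s))) has_real_derivative g1 v + g2 v) (at (v i))" for v
    by (rule DERIV_add[OF g(3) g(6)])
  moreover have "k = 0 \<longrightarrow> (\<lambda>v. g1 v + g2 v) = (\<lambda>_. 0)" using g by auto
  ultimately show ?case
    using hp.hp_add[OF g(1,4)]
    by (intro exI[of _ "\<lambda>v. g1 v + g2 v"] conjI allI)
qed

lemma pd_eqI: "((\<lambda>s. f (v(i := s))) has_real_derivative d) (at (v i)) \<Longrightarrow> pd i f v = d"
  unfolding pd_def by (rule DERIV_imp_deriv)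

lemma has_pd:
  assumes "hp n k f"
  shows "((\<lambda>s. f (v(i := s))) has_real_derivative pd i f v) (at (v i))"
  using hp_deriv_exists[OF assms, of i] pd_eqI by metis

lemma hp_pd: "hp n k f \<Longrightarrow> hp n (k - 1) (pd i f)"
  using hp_deriv_exists[of n k f i] pd_eqI by (metis ext)

lemma pd_mult:
  assumes "hp n j f" "hp n k g"
  shows "pd i (\<lambda>v. f v * g v) v = pd i f v * g v + f v * pd i g v"
  using DERIV_mult[OF has_pd[OF assms(1), of v i] has_pd[OF assms(2), of v i]]
  by (intro pd_eqI) (simp add: algebra_simps)

lemma pd_add:
  assumes "hp n j f" "hp n k g"
  shows "pd i (\<lambda>v. f v + g v) v = pd i f v + pd i g v"
  by (rule pd_eqI, rule DERIV_add[OF has_pd[OF assms(1), of v i] has_pd[OF assms(2), of v i]])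

lemma pd_sum:
  assumes "\<And>x. x \<in> A \<Longrightarrow> hp n (d x) (f x)"
  shows "pd i (\<lambda>v. \<Sum>x\<in>A. c x * f x v) v = (\<Sum>x\<in>A. c x * pd i (f x) v)"
  by (rule pd_eqI, rule DERIV_sum, rule DERIV_cmult, rule has_pd[OF assms])

lemma pd_zero: "pd i (\<lambda>_. c) v = 0"
  by (rule pd_eqI) simp

lemma pd_coord: "pd i (\<lambda>v. v j) v = of_bool (i = j)"
  by (rule pd_eqI) (cases "i = j"; auto intro!: derivative_eq_intros)

lemma pd_mon:
  assumes "finite A" "\<And>x. x \<in> A \<Longrightarrow> hp n (d x) (\<phi> x)"
  shows "pd i (mon A \<phi> M) v = (\<Sum>x\<in>A. real (M x) * mon A \<phi> (M(x := M x - 1)) v * pd i (\<phi> x) v)"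
proof (rule pd_eqI)
  have 1: "((\<lambda>s. \<phi> x (v(i := s)) ^ M x) has_real_derivative
      of_nat (M x) * (\<phi> x v ^ (M x - 1) * pd i (\<phi> x) v)) (at (v i))" if "x \<in> A" for x
    using DERIV_power[OF has_pd[OF assms(2)[OF that]], of v i "M x"] by (simp add: algebra_simps)
  have "((\<lambda>s. \<Prod>x\<in>A. \<phi> x (v(i := s)) ^ M x) has_real_derivative
      (\<Sum>x\<in>A. of_nat (M x) * (\<phi> x v ^ (M x - 1) * pd i (\<phi> x) v) * (\<Prod>y\<in>A - {x}. \<phi> y v ^ M y))) (at (v i))"
    using has_field_derivative_prod[OF 1] by (simp add: mult.commute)
  also have "(\<Sum>x\<in>A. of_nat (M x) * (\<phi> x v ^ (M x - 1) * pd i (\<phi> x) v) * (\<Prod>y\<in>A - {x}. \<phi> y v ^ M y))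
      = (\<Sum>x\<in>A. real (M x) * mon A \<phi> (M(x := M x - 1)) v * pd i (\<phi> x) v)"
  proof (rule sum.cong)
    fix x assume "x \<in> A"
    have "(\<Prod>y\<in>A - {x}. \<phi> y v ^ (M(x := M x - 1)) y) = (\<Prod>y\<in>A - {x}. \<phi> y v ^ M y)"
      by (rule prod.cong) auto
    then show "of_nat (M x) * (\<phi> x v ^ (M x - 1) * pd i (\<phi> x) v) * (\<Prod>y\<in>A - {x}. \<phi> y v ^ M y)
        = real (M x) * mon A \<phi> (M(x := M x - 1)) v * pd i (\<phi> x) v"
      using assms \<open>x \<in> A\<close> by (simp add: mon_def prod.remove[of A x])
  qed simp
  finally show "((\<lambda>s. mon A \<phi> M (v(i := s))) has_real_derivative
      (\<Sum>x\<in>A. real (M x) * mon A \<phi> (M(x := M x - 1)) v * pd i (\<phi> x) v)) (at (v i))"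
    unfolding mon_def .
qed

lemma euler_identity: "hp n k f \<Longrightarrow> (\<Sum>i<n. v i * pd i f v) = real k * f v"
proof (induction rule: hp.induct)
  case (hp_zero k)
  then show ?case by (simp add: pd_zero)
next
  case (hp_const c)
  then show ?case by (simp add: pd_zero)
next
  case (hp_var j k f)
  have "pd i (\<lambda>v. v j * f v) v = of_bool (i = j) * f v + v j * pd i f v" for i
    using pd_mult[OF hp_coord[OF hp_var(1)] hp_var(2)] by (simp add: pd_coord)
  then have "(\<Sum>i<n. v i * pd i (\<lambda>v. v j * f v) v)
      = (\<Sum>i<n. of_bool (i = j) * (v i * f v)) + v j * (\<Sum>i<n. v i * pd i f v)"
    by (simp add: sum.distrib sum_distrib_left algebra_simps)
  also have "(\<Sum>i<n. of_bool (i = j) * (v i * f v)) = v j * f v"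
    using hp_var(1) by (simp add: of_bool_def if_distrib[of "\<lambda>z. z * _"] cong: if_cong)
  finally show ?case by (simp add: hp_var.IH algebra_simps)
next
  case (hp_add k f g)
  have "pd i (\<lambda>v. f v + g v) v = pd i f v + pd i g v" for i
    using hp_add(1,2) by (rule pd_add)
  then show ?case using hp_add.IH by (simp add: sum.distrib algebra_simps)
qed

section \<open>The coinvariant algebra and functions on a regular orbit\<close>

text \<open>Degree strictly below \<open>k\<close>: then \<open>k = 0\<close> leaves only the zero
  function, and \<open>k\<close> matches the number of length levels on which values are
  prescribed.\<close>

definition pl :: "nat \<Rightarrow> nat \<Rightarrow> ((nat \<Rightarrow> real) \<Rightarrow> real) \<Rightarrow> bool" where
  "pl n k f \<longleftrightarrow> (\<exists>g. (\<forall>j<k. hp n j (g j)) \<and> (\<forall>v. f v = (\<Sum>j<k. g j v)))"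

lemma pl_0: "pl n 0 f \<longleftrightarrow> (\<forall>v. f v = 0)"
  by (simp add: pl_def)

lemma pl_Suc: "pl n k f \<Longrightarrow> hp n k g \<Longrightarrow> pl n (Suc k) (\<lambda>v. f v + g v)"
  unfolding pl_def
proof (elim exE conjE)
  fix h assume h: "\<forall>j<k. hp n j (h j)" "\<forall>v. f v = (\<Sum>j<k. h j v)" and g: "hp n k g"
  show "\<exists>h. (\<forall>j<Suc k. hp n j (h j)) \<and> (\<forall>v. f v + g v = (\<Sum>j<Suc k. h j v))"
    by (rule exI[of _ "h(k := g)"]) (use h g in \<open>auto simp: less_Suc_eq intro!: sum.cong\<close>)
qed

lemma pl_SucE:
  assumes "pl n (Suc k) f"
  obtains f' g where "pl n k f'" "hp n k g" "\<And>v. f v = f' v + g v"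
proof -
  obtain h where h: "\<forall>j<Suc k. hp n j (h j)" "\<forall>v. f v = (\<Sum>j<Suc k. h j v)"
    using assms unfolding pl_def by blast
  have "pl n k (\<lambda>v. \<Sum>j<k. h j v)" 
    unfolding pl_def by (intro exI[of _ h]) (use h(1) in auto)
  moreover have "hp n k (h k)" using h by simp
  moreover have "f v = (\<Sum>j<k. h j v) + h k v" for v using h(2) by simp
  ultimately show thesis using that by blast
qed

lemma pl_zero: "pl n k (\<lambda>_. 0)"
  unfolding pl_def by (intro exI[of _ "\<lambda>_ _. 0"]) (auto intro: hp_zero)

lemma pl_add:
  assumes "pl n k f" "pl n k g"
  shows "pl n k (\<lambda>v. f v + g v)"
proof -
  obtain f' g' where "\<forall>j<k. hp n j (f' j)" "\<forall>v. f v = (\<Sum>j<k. f' j v)"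
    "\<forall>j<k. hp n j (g' j)" "\<forall>v. g v = (\<Sum>j<k. g' j v)"
    using assms unfolding pl_def by blast
  then show ?thesis
    unfolding pl_def by (intro exI[of _ "\<lambda>j v. f' j v + g' j v"]) (auto simp: sum.distrib intro: hp_add)
qed

lemma pl_scale:
  assumes "pl n k f"
  shows "pl n k (\<lambda>v. c * f v)"
proof -
  obtain f' where "\<forall>j<k. hp n j (f' j)" "\<forall>v. f v = (\<Sum>j<k. f' j v)"
    using assms unfolding pl_def by blast
  then show ?thesis
    unfolding pl_def by (intro exI[of _ "\<lambda>j v. c * f' j v"]) (auto simp: sum_distrib_left intro: hp_scale)
qed

lemma pl_diff: "pl n k f \<Longrightarrow> pl n k g \<Longrightarrow> pl n k (\<lambda>v. f v - g v)"
  using pl_add[OF _ pl_scale, of n k f g "-1"] by simp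

lemma pl_sum: "(\<And>x. x \<in> A \<Longrightarrow> pl n k (f x)) \<Longrightarrow> pl n k (\<lambda>v. \<Sum>x\<in>A. f x v)"
  by (induction A rule: infinite_finite_induct) (auto intro: pl_zero pl_add)

lemma pl_mono:
  assumes "pl n j f" "j \<le> k"
  shows "pl n k f"
  using assms(2)
proof (induction rule: dec_induct)
  case base
  then show ?case by (rule assms(1))
next
  case (step k)
  then show ?case using pl_Suc[OF _ hp_zero] by simp
qed

lemma pl_hp: "hp n j f \<Longrightarrow> j < k \<Longrightarrow> pl n k f"
  using pl_Suc[OF pl_zero, of n j f] pl_mono[of n "Suc j" f k] by simp

lemma pl_affine:
  assumes "pl n k f" "i < n"
  shows "pl n (Suc k) (\<lambda>v. (v i - c) * f v)"
proof -
  obtain g where g: "\<forall>j<k. hp n j (g j)" "\<forall>v. f v = (\<Sum>j<k. g j v)"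
    using assms(1) unfolding pl_def by blast
  have "pl n (Suc k) (\<lambda>v. \<Sum>j<k. v i * g j v)"
    by (rule pl_sum, rule pl_hp, rule hp_var[OF assms(2)]) (use g in auto)
  moreover have "pl n (Suc k) f" using pl_mono[OF assms(1)] by simp
  ultimately have "pl n (Suc k) (\<lambda>v. (\<Sum>j<k. v i * g j v) - c * f v)"
    by (intro pl_diff pl_scale)
  then show ?thesis by (simp add: g(2) sum_distrib_left left_diff_distrib sum_subtractf)
qed

lemma pl_divided_difference:
  assumes "pl n (Suc k) f"
  obtains g where "pl n k g" "\<And>v. f v - f (refl n a v) = ip n v a * g v"
proof -
  have "\<exists>g. pl n k g \<and> (\<forall>v. f v - f (refl n a v) = ip n v a * g v)"
    using assms
  proof (induction k arbitrary: f)
    case 0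
    obtain f' g where *: "pl n 0 f'" "hp n 0 g" "\<And>v. f v = f' v + g v"
      using pl_SucE[OF 0] by blast
    obtain c where "g = (\<lambda>_. c)" using hp_0_const[OF *(2)] by blast
    then show ?case using * by (auto simp: pl_0 intro: exI[of _ "\<lambda>_. 0"])
  next
    case (Suc k)
    obtain f' g where *: "pl n (Suc k) f'" "hp n (Suc k) g" "\<And>v. f v = f' v + g v"
      using pl_SucE[OF Suc.prems] by blast
    obtain f1 where f1: "pl n k f1" "\<And>v. f' v - f' (refl n a v) = ip n v a * f1 v"
      using Suc.IH[OF *(1)] by blast
    obtain g1 where g1: "hp n (Suc k - 1) g1" "\<And>v. g v - g (refl n a v) = ip n v a * g1 v"
      using hp_divided_difference[OF *(2), of a] by blast
    have "f v - f (refl n a v) = ip n v a * (f1 v + g1 v)" for v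
    proof -
      have "f v - f (refl n a v) = (f' v - f' (refl n a v)) + (g v - g (refl n a v))"
        by (simp add: *(3))
      then show ?thesis by (simp only: f1 g1) (simp add: distrib_left)
    qed
    moreover have "pl n (Suc k) (\<lambda>v. f1 v + g1 v)"
      using pl_Suc[OF f1(1)] g1(1) by simp
    ultimately show ?case by (intro exI[of _ "\<lambda>v. f1 v + g1 v"] conjI allI)
  qed
  then show thesis using that by blast
qed

context refl_system
begin

section \<open>Invariants, averaging and the ideal of the positive invariants\<close>

definition Inv :: "nat \<Rightarrow> ((nat \<Rightarrow> real) \<Rightarrow> real) set" where
  "Inv k = {f. hp n k f \<and> (\<forall>a\<in>\<Phi>. \<forall>v. f (refl n a v) = f v)}"

lemma Inv_hp: "f \<in> Inv k \<Longrightarrow> hp n k f"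
  by (simp add: Inv_def)

lemma Inv_coxgrp:
  assumes "f \<in> Inv k" "w \<in> coxgrp n \<Phi>"
  shows "f (w v) = f v"
  using assms(2) by (induction arbitrary: v rule: coxgrp.induct) (use assms(1) in \<open>auto simp: Inv_def\<close>)

lemma Inv_add: "f \<in> Inv k \<Longrightarrow> g \<in> Inv k \<Longrightarrow> (\<lambda>v. f v + g v) \<in> Inv k"
  by (auto simp: Inv_def intro: hp_add)

lemma Inv_scale: "f \<in> Inv k \<Longrightarrow> (\<lambda>v. b * f v) \<in> Inv k"
  by (auto simp: Inv_def intro: hp_scale)

lemma Inv_mult: "f \<in> Inv j \<Longrightarrow> g \<in> Inv k \<Longrightarrow> (\<lambda>v. f v * g v) \<in> Inv (j + k)"
  by (auto simp: Inv_def intro: hp_mult)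

lemma Inv_zero: "(\<lambda>_. 0) \<in> Inv k"
  by (auto simp: Inv_def intro: hp_zero)

lemma Inv_const: "(\<lambda>_. b) \<in> Inv 0"
  by (auto simp: Inv_def intro: hp_const)

lemma Inv_sum: "(\<And>x. x \<in> A \<Longrightarrow> f x \<in> Inv k) \<Longrightarrow> (\<lambda>v. \<Sum>x\<in>A. f x v) \<in> Inv k"
  by (induction A rule: infinite_finite_induct) (auto intro: Inv_zero Inv_add)

lemma Inv_0_const: "f \<in> Inv 0 \<Longrightarrow> \<exists>b. f = (\<lambda>_. b)"
  using hp_0_const Inv_hp by blast

lemma Inv_mon:
  assumes "M \<in> mons A d k" "\<And>x. x \<in> A \<Longrightarrow> \<phi> x \<in> Inv (d x)"
  shows "mon A \<phi> M \<in> Inv k"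
  using hp_mon[of M A d k n \<phi>] assms by (auto simp: Inv_def mon_def intro!: prod.cong)

text \<open>Invariance tested on \<open>vecs n\<close> extends to all sequences, since a polynomial
  reads only the first \<open>n\<close> coordinates and reflections commute with truncation.\<close>

lemma inv_polys_eq_Inv: "inv_polys n \<Phi> k = Inv k"
proof
  show "Inv k \<subseteq> inv_polys n \<Phi> k"
    using Inv_coxgrp by (auto simp: inv_polys_def homog_poly_iff Inv_hp)
  show "inv_polys n \<Phi> k \<subseteq> Inv k"
  proof
    fix f assume f: "f \<in> inv_polys n \<Phi> k"
    then have hp: "hp n k f" by (simp add: inv_polys_def homog_poly_iff)
    let ?r = "\<lambda>v i. if i < n then v i else 0 :: real"
    have r: "f (?r v) = f v" for v by (rule hp_cong[OF hp]) simp
    have "f (refl n a v) = f v" if "a \<in> \<Phi>" for a v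
    proof -
      have "f (refl n a v) = f (?r (refl n a v))" by (rule r[symmetric])
      also have "?r (refl n a v) = refl n a (?r v)"
        by (rule refl_restrict[OF root_vecs[OF that], symmetric])
      also have "f \<dots> = f (?r v)"
        using f coxgrp_refl[OF that] by (auto simp: inv_polys_def vecs_def)
      finally show ?thesis by (simp add: r)
    qed
    then show "f \<in> Inv k" using hp by (simp add: Inv_def)
  qed
qed

text \<open>The Reynolds operator, a projection onto the invariants that is linear over
  them.\<close>

definition avg :: "((nat \<Rightarrow> real) \<Rightarrow> real) \<Rightarrow> (nat \<Rightarrow> real) \<Rightarrow> real" where
  "avg f = (\<lambda>v. (1 / real (card (coxgrp n \<Phi>))) * (\<Sum>w\<in>coxgrp n \<Phi>. f (w v)))"

lemma card_coxgrp_pos: "card (coxgrp n \<Phi>) > 0"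
  using finite_coxgrp coxgrp.id_in by (metis card_gt_0_iff empty_iff)

lemma hp_coxgrp:
  assumes "w \<in> coxgrp n \<Phi>" "hp n k f"
  shows "hp n k (\<lambda>v. f (w v))"
  using assms(1) by induction (use assms(2) hp_refl in auto)

lemma avg_Inv:
  assumes "hp n k f"
  shows "avg f \<in> Inv k"
proof -
  have "hp n k (avg f)"
    unfolding avg_def by (rule hp_scale, rule hp_sum, erule hp_coxgrp[OF _ assms])
  moreover have "avg f (refl n a v) = avg f v" if "a \<in> \<Phi>" for a v
  proof -
    have "bij_betw (\<lambda>w. w \<circ> refl n a) (coxgrp n \<Phi>) (coxgrp n \<Phi>)"
      by (rule bij_betw_byWitness[of _ "\<lambda>w. w \<circ> refl n a"])
        (use that coxgrp.refl_in in \<open>auto simp: fun_eq_iff refl_refl_root\<close>)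
    from sum.reindex_bij_betw[OF this, of "\<lambda>w. f (w v)"] show ?thesis
      by (simp add: avg_def)
  qed
  ultimately show ?thesis by (simp add: Inv_def)
qed

lemma avg_mult: "g \<in> Inv j \<Longrightarrow> avg (\<lambda>v. g v * r v) v = g v * avg r v"
  by (simp add: avg_def Inv_coxgrp sum_distrib_left algebra_simps)

lemma avg_id: "f \<in> Inv j \<Longrightarrow> avg f v = f v"
  using card_coxgrp_pos by (simp add: avg_def Inv_coxgrp)

lemma avg_sum: "avg (\<lambda>v. \<Sum>x\<in>A. f x v) v = (\<Sum>x\<in>A. avg (f x) v)"
  unfolding avg_def by (subst sum.swap) (simp add: sum_distrib_left)

text \<open>The degree \<open>k\<close> part of the ideal generated by the invariants of positive
  degree; the quotient by this ideal is the coinvariant algebra.\<close>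

inductive Id :: "nat \<Rightarrow> ((nat \<Rightarrow> real) \<Rightarrow> real) \<Rightarrow> bool" where
  Id_zero: "Id k (\<lambda>_. 0)"
| Id_gen: "1 \<le> j \<Longrightarrow> g \<in> Inv j \<Longrightarrow> hp n m r \<Longrightarrow> Id (j + m) (\<lambda>v. g v * r v)"
| Id_add: "Id k f \<Longrightarrow> Id k g \<Longrightarrow> Id k (\<lambda>v. f v + g v)"

lemma Id_mult:
  assumes "Id k f" "hp n m s"
  shows "Id (k + m) (\<lambda>v. s v * f v)"
  using assms(1)
proof (induction rule: Id.induct)
  case (Id_zero k)
  then show ?case by (simp add: Id.Id_zero)
next
  case (Id_gen j g l r)
  have "Id (j + (l + m)) (\<lambda>v. g v * (r v * s v))"
    by (intro Id.Id_gen hp_mult Id_gen assms(2))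
  then show ?case by (simp add: ac_simps)
next
  case (Id_add k f g)
  then show ?case by (simp add: distrib_left Id.Id_add)
qed

lemma Id_scale: "Id k f \<Longrightarrow> Id k (\<lambda>v. b * f v)"
  using Id_mult[OF _ hp_const, of k f b] by simp

lemma Id_diff: "Id k f \<Longrightarrow> Id k g \<Longrightarrow> Id k (\<lambda>v. f v - g v)"
  using Id_add[OF _ Id_scale, of k f g "-1"] by simp

lemma Id_sum: "(\<And>x. x \<in> A \<Longrightarrow> Id k (f x)) \<Longrightarrow> Id k (\<lambda>v. \<Sum>x\<in>A. f x v)"
  by (induction A rule: infinite_finite_induct) (auto intro: Id_zero Id_add)

lemma Id_refl:
  assumes "Id k f" "a \<in> \<Phi>"
  shows "Id k (\<lambda>v. f (refl n a v))"
  using assms(1)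
proof (induction rule: Id.induct)
  case (Id_gen j g m r)
  have "Id (j + m) (\<lambda>v. g v * r (refl n a v))"
    by (intro Id.Id_gen hp_refl Id_gen)
  then show ?case using Id_gen(2) assms(2) by (simp add: Inv_def)
qed (auto intro: Id.intros)

lemma Id_Inv: "f \<in> Inv k \<Longrightarrow> 1 \<le> k \<Longrightarrow> Id k f"
  using Id_gen[OF _ _ hp_const, of k f 1] by simp

text \<open>\<open>f\<close> is congruent to all its translates, hence to their average, which is a positive invariant.\<close>
lemma Id_if_refl_diff:
  assumes "hp n k f" "1 \<le> k" "\<And>a. a \<in> \<Phi> \<Longrightarrow> Id k (\<lambda>v. f v - f (refl n a v))"
  shows "Id k f"
proof -
  have w: "Id k (\<lambda>v. f v - f (w v))" if "w \<in> coxgrp n \<Phi>" for w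
    using that
  proof induction
    case id_in
    then show ?case by (simp add: Id_zero)
  next
    case (refl_in w a)
    have "Id k (\<lambda>v. (f v - f (refl n a v)) + (f (refl n a v) - f (w (refl n a v))))"
      by (intro Id_add assms(3) refl_in Id_refl[OF refl_in.IH])
    then show ?case by simp
  qed
  have "Id k (\<lambda>v. (1 / real (card (coxgrp n \<Phi>))) * (\<Sum>w\<in>coxgrp n \<Phi>. f v - f (w v)))"
    by (intro Id_scale Id_sum w)
  also have "(\<lambda>v. (1 / real (card (coxgrp n \<Phi>))) * (\<Sum>w\<in>coxgrp n \<Phi>. f v - f (w v))) = (\<lambda>v. f v - avg f v)"
    using card_coxgrp_pos by (simp add: fun_eq_iff avg_def sum_subtractf right_diff_distrib)
  finally have "Id k (\<lambda>v. f v - avg f v)" .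
  from Id_add[OF this Id_Inv[OF avg_Inv[OF assms(1)] assms(2)]] show ?thesis by simp
qed

section \<open>Interpolation on the orbit by polynomials of bounded degree\<close>

lemma orb_regular': "y \<in> orb \<Longrightarrow> b \<in> \<Phi> \<Longrightarrow> ip n y b \<noteq> 0"
  using orb_regular ip_commute by metis

text \<open>A divided difference along a simple root has smaller degree and vanishes on the points
  of length below \<open>k\<close>, because a simple reflection lengthens by at most one. By
  induction it vanishes on the whole orbit, so \<open>f\<close> is constant there, with the value 0
  at \<open>c\<close>.\<close>

lemma pl_eq_0_on_orb:
  assumes "pl n k f" "\<And>y. y \<in> orb \<Longrightarrow> len y < k \<Longrightarrow> f y = 0" "y \<in> orb"
  shows "f y = 0"
  using assms
proof (induction k arbitrary: f y)
  case 0
  then show ?case by (simp add: pl_0)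
next
  case (Suc k)
  have inv: "f (refl n a u) = f u" if a: "a \<in> simple" and u: "u \<in> orb" for a u
  proof -
    obtain g where g: "pl n k g" "\<And>v. f v - f (refl n a v) = ip n v a * g v"
      using pl_divided_difference[OF Suc.prems(1), of a] by blast
    have "g z = 0" if "z \<in> orb" "len z < k" for z
    proof -
      have "len (refl n a z) < Suc k" "refl n a z \<in> orb"
        using len_refl_simple_le[OF a that(1)] that refl_orb simple_root a by auto
      then have "ip n z a * g z = 0"
        using Suc.prems(2) that g(2)[of z] by simp
      then show ?thesis
        using orb_regular'[OF that(1) simple_root[OF a]] by simp
    qed
    then have "g u = 0" using Suc.IH[OF g(1)] u by blast
    then show ?thesis using g(2)[of u] by simp
  qed
  have "f y = f c"
    using Suc.prems(3) by (induction rule: orb_simple_induct) (auto simp: inv)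
  then show ?case using Suc.prems(2) c_orb len_c by simp
qed

text \<open>The existence counterpart of the uniqueness in \<open>pl_eq_0_on_orb\<close>.\<close>

definition realizable :: "nat \<Rightarrow> ((nat \<Rightarrow> real) \<Rightarrow> real) \<Rightarrow> bool" where
  "realizable k \<phi> \<longleftrightarrow> (\<exists>f. pl n k f \<and> (\<forall>y\<in>orb. len y < k \<longrightarrow> f y = \<phi> y))"

lemma realizable_cong:
  "realizable k \<phi> \<Longrightarrow> (\<And>y. y \<in> orb \<Longrightarrow> len y < k \<Longrightarrow> \<phi> y = \<psi> y) \<Longrightarrow> realizable k \<psi>"
  unfolding realizable_def by fastforce

lemma realizable_pl: "pl n k f \<Longrightarrow> realizable k f"
  unfolding realizable_def by blast

lemma realizable_add: "realizable k \<phi> \<Longrightarrow> realizable k \<psi> \<Longrightarrow> realizable k (\<lambda>y. \<phi> y + \<psi> y)"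
  unfolding realizable_def using pl_add by fastforce

lemma realizable_scale: "realizable k \<phi> \<Longrightarrow> realizable k (\<lambda>y. b * \<phi> y)"
  unfolding realizable_def using pl_scale by fastforce

lemma realizable_diff: "realizable k \<phi> \<Longrightarrow> realizable k \<psi> \<Longrightarrow> realizable k (\<lambda>y. \<phi> y - \<psi> y)"
  using realizable_add[OF _ realizable_scale, of k \<phi> \<psi> "-1"] by simp

lemma realizable_sum: "(\<And>x. x \<in> A \<Longrightarrow> realizable k (\<phi> x)) \<Longrightarrow> realizable k (\<lambda>y. \<Sum>x\<in>A. \<phi> x y)"
proof (induction A rule: infinite_finite_induct)
  case (insert x A)
  then show ?case using realizable_add[of k "\<phi> x" "\<lambda>y. \<Sum>x\<in>A. \<phi> x y"] by simp
qed (simp_all add: realizable_pl[OF pl_zero])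

lemma realizable_all:
  assumes "\<And>z. z \<in> orb \<Longrightarrow> len z < k \<Longrightarrow> realizable k (\<lambda>y. of_bool (y = z))"
  shows "realizable k \<phi>"
proof (rule realizable_cong)
  show "realizable k (\<lambda>y. \<Sum>z\<in>{z\<in>orb. len z < k}. \<phi> z * of_bool (y = z))"
    using assms by (intro realizable_sum realizable_scale) auto
  fix y assume "y \<in> orb" "len y < k"
  then show "(\<Sum>z\<in>{z\<in>orb. len z < k}. \<phi> z * of_bool (y = z)) = \<phi> y"
    using finite_orb by (simp add: of_bool_def if_distrib[of "\<lambda>z. _ * z"] cong: if_cong)
qed

text \<open>Lagrange interpolation: one affine factor for each other point, chosen in a coordinate
  that separates it from \<open>z\<close>.\<close>

lemma realizable_interpolation:
  assumes "card orb \<le> k"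
  shows "realizable k \<phi>"
proof (rule realizable_all)
  fix z assume z: "z \<in> orb"
  have "\<exists>f. pl n (Suc (card F)) f \<and> (\<forall>y\<in>F. f y = 0) \<and> f z = 1"
    if "finite F" "F \<subseteq> orb - {z}" for F
    using that
  proof (induction rule: finite_induct)
    case empty
    have "pl n (Suc 0) (\<lambda>_. 1)" by (intro pl_hp[OF hp_const]) simp
    then show ?case by auto
  next
    case (insert u F)
    then obtain f where f: "pl n (Suc (card F)) f" "\<forall>y\<in>F. f y = 0" "f z = 1" by auto
    have "u \<in> vecs n" "z \<in> vecs n" "u \<noteq> z" using insert z orb_vecs by auto
    then obtain i where i: "u i \<noteq> z i" by auto
    then have "i < n"
      using \<open>u \<in> vecs n\<close> \<open>z \<in> vecs n\<close> unfolding vecs_def by (cases "i < n") auto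
    note i = this i
    have "pl n (Suc (Suc (card F))) (\<lambda>v. (1 / (z i - u i)) * ((v i - u i) * f v))"
      by (intro pl_scale pl_affine f i)
    then show ?case
      using insert(1,2) f i by (intro exI[of _ "\<lambda>v. (1 / (z i - u i)) * ((v i - u i) * f v)"]) auto
  qed
  from this[of "orb - {z}"] finite_orb obtain f where
    f: "pl n (Suc (card (orb - {z}))) f" "\<forall>y\<in>orb - {z}. f y = 0" "f z = 1" by auto
  have "Suc (card (orb - {z})) = card orb" by (rule card_Suc_Diff1[OF finite_orb z])
  then have "pl n k f" using pl_mono[OF f(1)] assms by simp
  then show "realizable k (\<lambda>y. of_bool (y = z))"
    by (rule realizable_cong[OF realizable_pl]) (use f(2,3) in \<open>auto simp: of_bool_def\<close>)
qed

text \<open>The divided difference of a function that is a point mass on the elements of length at most \<open>k\<close>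
  is a combination of two neighbouring point masses on those of length less than \<open>k\<close>.\<close>
lemma realizable_pair:
  assumes full: "\<And>\<phi>. realizable (Suc k) \<phi>" and z: "z \<in> orb" and a: "a \<in> simple"
  shows "realizable k (\<lambda>y. of_bool (y = z) + of_bool (y = refl n a z))"
proof -
  have aP: "a \<in> \<Phi>" using a by (rule simple_root)
  obtain f where f: "pl n (Suc k) f" "\<And>y. y \<in> orb \<Longrightarrow> len y < Suc k \<Longrightarrow> f y = of_bool (y = z)"
    using full[of "\<lambda>y. of_bool (y = z)"] unfolding realizable_def by blast
  obtain g where g: "pl n k g" "\<And>v. f v - f (refl n a v) = ip n v a * g v"
    using pl_divided_difference[OF f(1), of a] by blast
  have "realizable k (\<lambda>y. ip n z a * g y)"
    by (intro realizable_scale realizable_pl g)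
  then show ?thesis
  proof (rule realizable_cong)
    fix y assume y: "y \<in> orb" "len y < k"
    have s: "len (refl n a y) < Suc k" "refl n a y \<in> orb"
      using len_refl_simple_le[OF a y(1)] y refl_orb aP by auto
    have nz: "ip n y a \<noteq> 0" by (rule orb_regular'[OF y(1) aP])
    \<comment> \<open>Both the numerator of the quotient and the pairing with \<open>a\<close>
      change sign between \<open>z\<close> and its mirror image, so the two masses get the same
      sign.\<close>
    have "ip n (refl n a z) a = - ip n z a"
      using root_ip_nz[OF aP] by (simp add: ip_refl_left)
    moreover have "refl n a y = z \<longleftrightarrow> y = refl n a z" using refl_refl_root[OF aP] by metis
    moreover have "refl n a z \<noteq> z"
    proof
      assume "refl n a z = z"
      with calculation(1) have "ip n z a = 0" by simp
      then show False using orb_regular'[OF z aP] by simp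
    qed
    moreover have "ip n y a * g y = of_bool (y = z) - of_bool (refl n a y = z)"
      using g(2)[of y] f(2)[OF y(1)] f(2)[OF s(2,1)] y by simp
    ultimately show "ip n z a * g y = of_bool (y = z) + of_bool (y = refl n a z)"
      using nz by (cases "y = z"; cases "y = refl n a z") auto
  qed
qed

text \<open>Downward induction on the length of \<open>z\<close>: below the maximal length some
  simple reflection lengthens \<open>z\<close>, and the mass at that neighbour is either realizable
  already or lies at length \<open>k\<close>, where it is not seen.\<close>

lemma realizable_step_short:
  assumes full: "\<And>\<phi>. realizable (Suc k) \<phi>" and k: "k \<le> card P"
  shows "realizable k \<phi>"
proof (rule realizable_all)
  fix z assume "z \<in> orb" "len z < k"
  then show "realizable k (\<lambda>y. of_bool (y = z))"
  proof (induction "k - len z" arbitrary: z rule: less_induct)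
    case less
    obtain a where a: "a \<in> simple" "ip n a z > 0"
      using orb_ascend[OF less.prems(1)] less.prems k by auto
    let ?z = "refl n a z"
    have z': "?z \<in> orb" "len ?z = Suc (len z)"
      using len_refl_simple(1)[OF a(1) less.prems(1) a(2)] refl_orb[OF simple_root[OF a(1)] less.prems(1)] by auto
    have pair: "realizable k (\<lambda>y. of_bool (y = z) + of_bool (y = ?z))"
      by (rule realizable_pair[OF full less.prems(1) a(1)])
    show ?case
    proof (cases "len ?z < k")
      case True
      have "realizable k (\<lambda>y. of_bool (y = ?z))"
        by (rule less.hyps) (use z' True less.prems in auto)
      from realizable_diff[OF pair this] show ?thesis by simp
    next
      case False
      show ?thesis by (rule realizable_cong[OF pair]) (use False in auto)
    qed
  qed
qed

text \<open>Beyond the maximal length all point masses agree up to sign modulo restrictions of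
  polynomials, and the product of the positive roots is a sign-alternating one.\<close>
lemma realizable_step_long:
  assumes full: "\<And>\<phi>. realizable (Suc k) \<phi>" and k: "card P < k"
  shows "realizable k \<phi>"
proof (rule realizable_all)
  let ?\<delta> = "\<lambda>z y. of_bool (y = z) :: real"
  have mod: "realizable k (\<lambda>y. ?\<delta> z y - (-1) ^ len z * ?\<delta> c y)" if "z \<in> orb" for z
    using that
  proof (induction rule: orb_simple_induct)
    case base
    then show ?case by (simp add: len_c realizable_pl pl_zero)
  next
    case (step a z)
    have "ip n a z \<noteq> 0" using orb_regular step simple_root by blast
    have nz: "ip n a z < 0 \<or> ip n a z > 0" using \<open>ip n a z \<noteq> 0\<close> by auto
    have sign: "(-1) ^ len (refl n a z) = - ((-1) ^ len z :: real)"
      using nz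
    proof (elim disjE)
      assume "ip n a z < 0"
      then have "len z = Suc (len (refl n a z))"
        using len_refl_simple(2)[OF \<open>a \<in> simple\<close> \<open>z \<in> orb\<close>] by simp
      then show ?thesis by simp
    next
      assume "ip n a z > 0"
      then have "len (refl n a z) = Suc (len z)"
        using len_refl_simple(1)[OF \<open>a \<in> simple\<close> \<open>z \<in> orb\<close>] by simp
      then show ?thesis by simp
    qed
    have "realizable k (\<lambda>y. (?\<delta> z y + ?\<delta> (refl n a z) y) - (?\<delta> z y - (-1) ^ len z * ?\<delta> c y))"
      by (rule realizable_diff[OF realizable_pair[OF full \<open>z \<in> orb\<close> \<open>a \<in> simple\<close>] step.IH])
    then show ?case by (simp add: sign)
  qed
  \<comment> \<open>The sign of \<open>D\<close> at \<open>z\<close> is \<open>(-1) ^ len z\<close>,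
    and its degree \<open>card P\<close> is below \<open>k\<close>.\<close>
  define D where "D = (\<lambda>v. \<Prod>b\<in>P. ip n v b)"
  have "hp n (\<Sum>b\<in>P. Suc 0) D" unfolding D_def by (intro hp_prod hp_ip)
  then have "pl n k D" by (rule pl_hp) (use k in simp)
  then have realD: "realizable k D" by (rule realizable_pl)
  have absD: "(-1) ^ len z * D z > 0" if z: "z \<in> orb" for z
  proof -
    have "(\<Prod>b\<in>P. if ip n b z < 0 then -1 else 1 :: real) = (-1) ^ len z"
      using finite_P by (simp add: prod.If_cases len_def Int_def)
    then have "(-1) ^ len z * D z = (\<Prod>b\<in>P. (if ip n b z < 0 then -1 else 1) * ip n z b)"
      unfolding D_def prod.distrib by simp
    also have "\<dots> > 0"
    proof (rule prod_pos)
      fix b assume "b \<in> P"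
      then have "ip n b z \<noteq> 0" using orb_regular[OF z] P_sub by auto
      then show "0 < (if ip n b z < 0 then -1 else 1) * ip n z b"
        by (cases "ip n b z < 0") (simp_all add: ip_commute[of n z b])
    qed
    finally show ?thesis .
  qed
  \<comment> \<open>Expanding \<open>D\<close> in point masses and reducing each of them by
    \<open>mod\<close> leaves \<open>S\<close> times the mass at \<open>c\<close>; all terms of
    \<open>S\<close> are positive, so one may divide by it.\<close>
  define S where "S = (\<Sum>z\<in>orb. (-1) ^ len z * D z)"
  have S: "S > 0" unfolding S_def using absD finite_orb c_orb by (intro sum_pos) auto
  have "realizable k (\<lambda>y. D y - (\<Sum>z\<in>orb. D z * (?\<delta> z y - (-1) ^ len z * ?\<delta> c y)))"
    by (rule realizable_diff[OF realD], rule realizable_sum, rule realizable_scale, erule mod)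
  then have "realizable k (\<lambda>y. S * ?\<delta> c y)"
  proof (rule realizable_cong)
    fix y assume y: "y \<in> orb"
    have "(\<Sum>z\<in>orb. D z * (?\<delta> z y - (-1) ^ len z * ?\<delta> c y))
        = (\<Sum>z\<in>orb. D z * ?\<delta> z y) - (\<Sum>z\<in>orb. (-1) ^ len z * D z) * ?\<delta> c y"
      by (simp only: sum_distrib_right flip: sum_subtractf) (simp add: algebra_simps)
    also have "(\<Sum>z\<in>orb. D z * ?\<delta> z y) = D y"
      using finite_orb y by (simp add: of_bool_def if_distrib[of "\<lambda>z. _ * z"] cong: if_cong)
    finally show "D y - (\<Sum>z\<in>orb. D z * (?\<delta> z y - (-1) ^ len z * ?\<delta> c y)) = S * ?\<delta> c y"
      by (simp add: S_def)
  qed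
  from realizable_scale[OF this, of "1 / S"] have c: "realizable k (?\<delta> c)" using S by simp
  fix z assume "z \<in> orb"
  then have "realizable k (\<lambda>y. (?\<delta> z y - (-1) ^ len z * ?\<delta> c y) + (-1) ^ len z * ?\<delta> c y)"
    by (intro realizable_add mod realizable_scale c)
  then show "realizable k (?\<delta> z)" by simp
qed

text \<open>Downward induction from \<open>card orb\<close>, where plain interpolation works; the
  step depends on whether the degree bound exceeds \<open>card P\<close>.\<close>

lemma realizable: "realizable k \<phi>"
proof -
  have "\<forall>\<phi>. realizable k \<phi>"
  proof (cases "card orb \<le> k")
    case True
    then show ?thesis using realizable_interpolation by blast
  next
    case False
    then have "k \<le> card orb" by simp
    then show ?thesis
    proof (induction rule: inc_induct)
      case base
      then show ?case using realizable_interpolation by blast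
    next
      case (step m)
      then show ?case
        using realizable_step_short[of m] realizable_step_long[of m] by (meson not_le)
    qed
  qed
  then show ?thesis by blast
qed

text \<open>At a regular point one can divide by the root, so the divided differences of
  \<open>g\<close> and \<open>h\<close> agree on the orbit as well. By induction those of
  \<open>g\<close> lie in the ideal, which makes \<open>g\<close> congruent to its
  reflections.\<close>

lemma Id_if_pl_on_orb:
  assumes "hp n k g" "pl n k h" "\<And>y. y \<in> orb \<Longrightarrow> g y = h y"
  shows "Id k g"
  using assms
proof (induction k arbitrary: g h)
  case 0
  obtain b where b: "g = (\<lambda>_. b)" using hp_0_const[OF 0(1)] by blast
  have "b = 0" using 0(2) 0(3)[OF c_orb] by (simp add: pl_0 b)
  then show ?case by (simp add: b Id_zero)
next
  case (Suc k)
  show ?case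
  proof (rule Id_if_refl_diff[OF Suc.prems(1)])
    fix a assume a: "a \<in> \<Phi>"
    obtain g1 where g1: "hp n (Suc k - 1) g1" "\<And>v. g v - g (refl n a v) = ip n v a * g1 v"
      using hp_divided_difference[OF Suc.prems(1), of a] by blast
    obtain h1 where h1: "pl n k h1" "\<And>v. h v - h (refl n a v) = ip n v a * h1 v"
      using pl_divided_difference[OF Suc.prems(2), of a] by blast
    have "g1 y = h1 y" if "y \<in> orb" for y
    proof -
      have "ip n y a * g1 y = ip n y a * h1 y"
        unfolding g1(2)[symmetric] h1(2)[symmetric]
        using Suc.prems(3)[OF that] Suc.prems(3)[OF refl_orb[OF a that]] by simp
      then show ?thesis using orb_regular'[OF that a] by simp
    qed
    then have "Id k g1" using Suc.IH[of g1 h1] g1 h1 by simp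
    from Id_mult[OF this hp_ip[of n a]] show "Id (Suc k) (\<lambda>v. g v - g (refl n a v))"
      by (simp add: g1(2))
  qed simp
qed

text \<open>The converse of \<open>Id_if_pl_on_orb\<close>: an invariant is constant on the orbit,
  and replacing a positive one by its value at \<open>c\<close> lowers the degree.\<close>

lemma Id_pl_on_orb:
  assumes "Id k f"
  shows "\<exists>p. pl n k p \<and> (\<forall>y\<in>orb. f y = p y)"
  using assms
proof (induction rule: Id.induct)
  case (Id_zero k)
  then show ?case using pl_zero by blast
next
  case (Id_gen j g m r)
  have "g y = g c" if "y \<in> orb" for y
    using that Inv_coxgrp[OF Id_gen(2)] by (auto simp: orb_def)
  moreover have "pl n (j + m) (\<lambda>v. g c * r v)"
    by (intro pl_scale pl_hp[OF Id_gen(3)]) (use Id_gen(1) in simp)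
  ultimately show ?case by (intro exI[of _ "\<lambda>v. g c * r v"]) simp
next
  case (Id_add k f g)
  then obtain p q where "pl n k p" "pl n k q" "\<forall>y\<in>orb. f y = p y" "\<forall>y\<in>orb. g y = q y" by auto
  then show ?case by (intro exI[of _ "\<lambda>v. p v + q v"]) (auto intro: pl_add)
qed

text \<open>The element \<open>e y\<close> is the top-degree part of a polynomial \<open>F y\<close>
  of degree at most \<open>len y\<close> that is the point mass at \<open>y\<close> on the points of
  length at most \<open>len y\<close>. Restriction to the orbit turns membership in the ideal into a
  drop in degree, so coefficients can be read off at the points of length \<open>k\<close>.\<close>

theorem coinvariant_basis:
  "\<exists>e. (\<forall>y\<in>orb. hp n (len y) (e y)) \<and>
     (\<forall>k g. hp n k g \<longrightarrow> (\<exists>b. Id k (\<lambda>v. g v - (\<Sum>y\<in>{y\<in>orb. len y = k}. b y * e y v)))) \<and>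
     (\<forall>k b. Id k (\<lambda>v. \<Sum>y\<in>{y\<in>orb. len y = k}. b y * e y v) \<longrightarrow> (\<forall>y\<in>orb. len y = k \<longrightarrow> b y = 0))"
proof -
  have "\<exists>F. pl n (Suc (len y)) F \<and> (\<forall>u\<in>orb. len u < Suc (len y) \<longrightarrow> F u = of_bool (u = y))" for y
    using realizable[of "Suc (len y)" "\<lambda>u. of_bool (u = y)"] unfolding realizable_def .
  then obtain F where F: "\<And>y. pl n (Suc (len y)) (F y)"
    "\<And>y u. u \<in> orb \<Longrightarrow> len u < Suc (len y) \<Longrightarrow> F y u = of_bool (u = y)" by metis
  have "\<exists>l e. pl n (len y) l \<and> hp n (len y) e \<and> (\<forall>v. F y v = l v + e v)" for y
    using pl_SucE[OF F(1)[of y]] by metis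
  then obtain l e where le: "\<And>y. pl n (len y) (l y)" "\<And>y. hp n (len y) (e y)"
    "\<And>y v. F y v = l y v + e y v" by metis
  let ?L = "\<lambda>k. {y\<in>orb. len y = k}"
  have finL: "finite (?L k)" for k using finite_orb by simp
  have plL: "pl n k (\<lambda>v. \<Sum>y\<in>?L k. b y * l y v)" for k b
    by (intro pl_sum pl_scale) (use le(1) in auto)
  have plF: "pl n (Suc k) (\<lambda>v. \<Sum>y\<in>?L k. b y * F y v)" for k b
    by (intro pl_sum pl_scale) (use F(1) in auto)
  have hpE: "hp n k (\<lambda>v. \<Sum>y\<in>?L k. b y * e y v)" for k b
    by (intro hp_sum hp_scale) (use le(2) in auto)
  have eq: "(\<Sum>y\<in>?L k. b y * F y v) = (\<Sum>y\<in>?L k. b y * l y v) + (\<Sum>y\<in>?L k. b y * e y v)" for k b v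
    by (simp add: le(3) distrib_left sum.distrib)
  have valF: "(\<Sum>y\<in>?L k. b y * F y u) = (if len u = k then b u else 0)"
    if "u \<in> orb" "len u < Suc k" for u k b
  proof -
    have "(\<Sum>y\<in>?L k. b y * F y u) = (\<Sum>y\<in>?L k. b y * of_bool (u = y))"
      by (rule sum.cong) (use that F(2) in auto)
    also have "\<dots> = (if u \<in> ?L k then b u else 0)"
      using finL by (simp add: of_bool_def if_distrib[of "\<lambda>z. _ * z"] cong: if_cong)
    finally show ?thesis using that by simp
  qed
  show ?thesis
  proof (intro exI[of _ e] conjI allI impI ballI)
    show "hp n (len y) (e y)" for y by (rule le(2))
    show "\<exists>b. Id k (\<lambda>v. g v - (\<Sum>y\<in>?L k. b y * e y v))" if g: "hp n k g" for k g
    proof -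
      obtain h where h: "pl n k h" "\<And>y. y \<in> orb \<Longrightarrow> len y < k \<Longrightarrow> h y = g y"
        using realizable[of k g] unfolding realizable_def by blast
      \<comment> \<open>\<open>h\<close> takes over the values at the shorter points; what is left
        at length \<open>k\<close> gives the coefficients.\<close>
      define b where "b = (\<lambda>y. g y - h y)"
      have "pl n (Suc k) (\<lambda>v. (g v - h v) - (\<Sum>y\<in>?L k. b y * F y v))"
        by (intro pl_diff plF pl_hp[OF g] pl_mono[OF h(1)]) auto
      then have 0: "(g u - h u) - (\<Sum>y\<in>?L k. b y * F y u) = 0" if "u \<in> orb" for u
        by (rule pl_eq_0_on_orb[OF _ _ that]) (auto simp: valF b_def h less_Suc_eq)
      have "Id k (\<lambda>v. g v - (\<Sum>y\<in>?L k. b y * e y v))"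
      proof (rule Id_if_pl_on_orb)
        show "hp n k (\<lambda>v. g v - (\<Sum>y\<in>?L k. b y * e y v))" by (intro hp_diff g hpE)
        show "pl n k (\<lambda>v. h v + (\<Sum>y\<in>?L k. b y * l y v))" by (intro pl_add h plL)
        fix y assume "y \<in> orb"
        then show "g y - (\<Sum>y'\<in>?L k. b y' * e y' y) = h y + (\<Sum>y'\<in>?L k. b y' * l y' y)"
          using 0[of y] eq[where b = b and k = k and v = y] by linarith
      qed
      then show ?thesis by blast
    qed
    show "b y = 0" if Id: "Id k (\<lambda>v. \<Sum>y\<in>?L k. b y * e y v)" and y: "y \<in> orb" "len y = k" for k b y
    proof -
      obtain p where p: "pl n k p" "\<And>y. y \<in> orb \<Longrightarrow> (\<Sum>z\<in>?L k. b z * e z y) = p y"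
        using Id_pl_on_orb[OF Id] by blast
      \<comment> \<open>This polynomial of degree below \<open>k\<close> equals the combination of
        the \<open>F y\<close> on the orbit, and that combination vanishes at the points of length
        below \<open>k\<close>.\<close>
      have plp: "pl n k (\<lambda>v. p v + (\<Sum>y\<in>?L k. b y * l y v))" by (intro pl_add p plL)
      have *: "p u + (\<Sum>z\<in>?L k. b z * l z u) = (\<Sum>z\<in>?L k. b z * F z u)" if "u \<in> orb" for u
        using p(2)[OF that] eq[where b = b and k = k and v = u] by simp
      have "p y + (\<Sum>z\<in>?L k. b z * l z y) = 0"
        by (rule pl_eq_0_on_orb[OF plp _ y(1)]) (use * valF in auto)
      then show ?thesis using *[OF y(1)] valF[where u = y and k = k and b = b] y by simp
    qed
  qed
qed

end

section \<open>Relations over the invariants\<close>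

text \<open>Integer grading, in which a function of negative degree vanishes: it spares case distinctions when
  degrees are subtracted.\<close>
definition hpz :: "nat \<Rightarrow> int \<Rightarrow> ((nat \<Rightarrow> real) \<Rightarrow> real) \<Rightarrow> bool" where
  "hpz n k f \<longleftrightarrow> (if k \<ge> 0 then hp n (nat k) f else f = (\<lambda>_. 0))"

lemma hpz_nat: "hpz n (int k) f \<longleftrightarrow> hp n k f"
  by (simp add: hpz_def)

lemma hpz_zero: "hpz n k (\<lambda>_. 0)"
  by (simp add: hpz_def hp_zero)

lemma hpz_hp: "hpz n k f \<Longrightarrow> \<exists>m. hp n m f"
  unfolding hpz_def by (metis hp_zero)

lemma hpz_divided_difference:
  assumes "hpz n k f"
  shows "\<exists>g. hpz n (k - 1) g \<and> (\<forall>v. f v - f (refl n a v) = ip n v a * g v)"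
proof (cases "k \<ge> 0")
  case False
  then have "f = (\<lambda>_. 0)" using assms by (simp add: hpz_def)
  then show ?thesis by (intro exI[of _ "\<lambda>_. 0"]) (simp add: hpz_zero)
next
  case True
  then obtain g where g: "hp n (nat k - 1) g" "nat k = 0 \<Longrightarrow> g = (\<lambda>_. 0)"
    "\<And>v. f v - f (refl n a v) = ip n v a * g v"
    using hp_divided_difference[of n "nat k" f a] assms by (auto simp: hpz_def)
  have "hpz n (k - 1) g"
  proof (cases "k = 0")
    case True
    then show ?thesis using g(2) by (simp add: hpz_zero)
  next
    case False
    then have "nat (k - 1) = nat k - 1" "k - 1 \<ge> 0" using True by auto
    then show ?thesis using g(1) by (simp add: hpz_def)
  qed
  then show ?thesis using g(3) by blast
qed

lemma hp_continuous_line: "hp n k f \<Longrightarrow> continuous_on UNIV (\<lambda>t. f (\<lambda>i. v i + t * u i))"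
  by (induction rule: hp.induct) (auto intro!: continuous_intros)

text \<open>Cancels the linear factor by continuity: off the hyperplane one divides, and a point on
  it is approached along the normal direction.\<close>

lemma ip_times_eq_0D:
  assumes a: "ip n a a \<noteq> 0" and cont: "\<And>v. continuous_on UNIV (\<lambda>t. q (\<lambda>i. v i + t * a i))"
    and zero: "\<And>v. ip n v a * q v = 0"
  shows "q v = 0"
proof (cases "ip n v a = 0")
  case False
  then show ?thesis using zero[of v] by simp
next
  case True
  let ?q = "\<lambda>t::real. q (\<lambda>i. v i + t * a i)"
  have "?q t = 0" if "t \<noteq> 0" for t
  proof -
    have "ip n (\<lambda>i. v i + t * a i) a = t * ip n a a"
      by (simp add: ip_add_left ip_scale_left True)
    then show ?thesis using zero[of "\<lambda>i. v i + t * a i"] that a by simp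
  qed
  then have "(?q \<longlongrightarrow> 0) (at 0)"
    by (intro tendsto_eventually) (auto simp: eventually_at_filter)
  moreover have "(?q \<longlongrightarrow> ?q 0) (at 0)"
    using cont[of v] unfolding continuous_on_def by blast
  ultimately have "?q 0 = 0" using LIM_unique by blast
  then show ?thesis by simp
qed

context refl_system
begin

definition invariant :: "((nat \<Rightarrow> real) \<Rightarrow> real) \<Rightarrow> bool" where
  "invariant f \<longleftrightarrow> (\<forall>a\<in>\<Phi>. \<forall>v. f (refl n a v) = f v)"

lemma Inv_iff: "f \<in> Inv k \<longleftrightarrow> hp n k f \<and> invariant f"
  by (simp add: Inv_def invariant_def)

lemma hpz_avg:
  assumes "hpz n k f"
  shows "hpz n k (avg f)" "invariant (avg f)"
proof -
  have "k \<ge> 0 \<Longrightarrow> avg f \<in> Inv (nat k)" using assms by (intro avg_Inv) (simp add: hpz_def)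
  moreover have "k < 0 \<Longrightarrow> avg f = (\<lambda>_. 0)" using assms by (simp add: hpz_def avg_def)
  ultimately show "hpz n k (avg f)" "invariant (avg f)"
    by (cases "k \<ge> 0"; auto simp: hpz_def Inv_iff invariant_def)+
qed

text \<open>Chevalley's lemma: in a relation over the invariants, either the first coefficient is an
  invariant combination of the others, or its partner lies in the ideal of the positive invariants.\<close>
lemma Id_of_relation:
  assumes A: "finite A" "x0 \<notin> A"
    and h: "\<And>x. x \<in> insert x0 A \<Longrightarrow> \<exists>m. h x \<in> Inv m"
    and p0: "hp n m p0" and p: "\<And>x. x \<in> A \<Longrightarrow> hpz n (e x) (p x)"
    and rel: "\<And>v. h x0 v * p0 v + (\<Sum>x\<in>A. h x v * p x v) = 0"
    and no: "\<not> (\<exists>s. (\<forall>x\<in>A. hpz n (e x - int m) (s x) \<and> invariant (s x)) \<and>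
                 (\<forall>v. h x0 v = (\<Sum>x\<in>A. s x v * h x v)))"
  shows "Id m p0"
  using p0 p rel no
proof (induction m arbitrary: p0 p e)
  case 0
  obtain b where b: "p0 = (\<lambda>_. b)" using hp_0_const[OF 0(1)] by blast
  have hi: "\<exists>m. h x \<in> Inv m" if "x \<in> insert x0 A" for x using h that by blast
  have "b = 0"
  proof (rule ccontr)
    assume "b \<noteq> 0"
    \<comment> \<open>If \<open>p0\<close> is a nonzero constant, averaging the relation and
      dividing by that constant solves for \<open>h x0\<close> with invariant coefficients.\<close>
    define s where "s = (\<lambda>x v. (- 1 / b) * avg (p x) v)"
    have "hpz n (e x - int 0) (s x) \<and> invariant (s x)" if "x \<in> A" for x
      using hpz_avg[OF 0(2)[OF that]]
      by (auto simp: s_def hpz_def invariant_def intro!: hp_scale[of _ _ _ "- 1 / b", simplified])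
    moreover have "h x0 v = (\<Sum>x\<in>A. s x v * h x v)" for v
    proof -
      have "0 = avg (\<lambda>v. h x0 v * b + (\<Sum>x\<in>A. h x v * p x v)) v"
        using 0(3) by (simp add: avg_def b)
      also have "\<dots> = avg (\<lambda>v. h x0 v * b) v + avg (\<lambda>v. \<Sum>x\<in>A. h x v * p x v) v"
        by (simp add: avg_def sum.distrib distrib_left)
      also have "avg (\<lambda>v. h x0 v * b) v = h x0 v * avg (\<lambda>_. b) v"
      proof -
        obtain m where "h x0 \<in> Inv m" using hi by blast
        then show ?thesis by (rule avg_mult)
      qed
      also have "avg (\<lambda>_. b) v = b" using avg_id[OF Inv_const] by simp
      also have "avg (\<lambda>v. \<Sum>x\<in>A. h x v * p x v) v = (\<Sum>x\<in>A. h x v * avg (p x) v)"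
        unfolding avg_sum
      proof (rule sum.cong[OF HOL.refl])
        fix x assume "x \<in> A"
        then obtain m where "h x \<in> Inv m" using hi by blast
        then show "avg (\<lambda>v. h x v * p x v) v = h x v * avg (p x) v" by (rule avg_mult)
      qed
      finally have "h x0 v * b = - (\<Sum>x\<in>A. h x v * avg (p x) v)" by simp
      then have "h x0 v = - (\<Sum>x\<in>A. h x v * avg (p x) v) / b"
        using \<open>b \<noteq> 0\<close> by (simp add: field_simps)
      then show ?thesis
        by (simp add: s_def sum_divide_distrib sum_negf[symmetric] mult.commute)
    qed
    ultimately show False using 0(4) by blast
  qed
  then show ?case by (simp add: b Id_zero)
next
  case (Suc m)
  show ?case
  proof (rule Id_if_refl_diff[OF Suc.prems(1)])
    fix a assume a: "a \<in> \<Phi>"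
    obtain q0 where q0: "hp n (Suc m - 1) q0" "\<And>v. p0 v - p0 (refl n a v) = ip n v a * q0 v"
      using hp_divided_difference[OF Suc.prems(1), of a] by blast
    have "\<exists>q. x \<in> A \<longrightarrow> hpz n (e x - 1) q \<and> (\<forall>v. p x v - p x (refl n a v) = ip n v a * q v)" for x
      using hpz_divided_difference[OF Suc.prems(2), of x a] by blast
    then obtain q where q: "\<And>x. x \<in> A \<Longrightarrow> hpz n (e x - 1) (q x)"
      "\<And>x v. x \<in> A \<Longrightarrow> p x v - p x (refl n a v) = ip n v a * q x v" by metis
    have inv: "h x (refl n a v) = h x v" if "x \<in> insert x0 A" for x v
      using h[OF that] a by (auto simp: Inv_def)
    have rel': "h x0 v * q0 v + (\<Sum>x\<in>A. h x v * q x v) = 0" for v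
    proof (rule ip_times_eq_0D[where q = "\<lambda>v. h x0 v * q0 v + (\<Sum>x\<in>A. h x v * q x v)" and v = v,
          OF root_ip_nz[OF a]])
      fix v
      have hp: "\<exists>m. hp n m (h x)" if "x \<in> insert x0 A" for x using h[OF that] Inv_hp by blast
      have ch: "continuous_on UNIV (\<lambda>t. h x (\<lambda>i. v i + t * a i))" if "x \<in> insert x0 A" for x
        using hp[OF that] hp_continuous_line by blast
      have cq: "continuous_on UNIV (\<lambda>t. q x (\<lambda>i. v i + t * a i))" if "x \<in> A" for x
        using hpz_hp[OF q(1)[OF that]] hp_continuous_line by blast
      show "continuous_on UNIV (\<lambda>t. h x0 (\<lambda>i. v i + t * a i) * q0 (\<lambda>i. v i + t * a i)
          + (\<Sum>x\<in>A. h x (\<lambda>i. v i + t * a i) * q x (\<lambda>i. v i + t * a i)))"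
        by (intro continuous_on_add continuous_on_mult continuous_on_sum ch cq
            hp_continuous_line[OF q0(1)] insertI1 insertI2)
      have "(\<Sum>x\<in>A. h x v * (p x v - p x (refl n a v))) = (\<Sum>x\<in>A. h x v * (ip n v a * q x v))"
        by (intro sum.cong) (simp_all add: q(2))
      then have "ip n v a * (h x0 v * q0 v + (\<Sum>x\<in>A. h x v * q x v))
          = h x0 v * (p0 v - p0 (refl n a v)) + (\<Sum>x\<in>A. h x v * (p x v - p x (refl n a v)))"
        by (simp add: q0(2) distrib_left sum_distrib_left mult.left_commute)
      also have "\<dots> = (h x0 v * p0 v + (\<Sum>x\<in>A. h x v * p x v))
          - (h x0 (refl n a v) * p0 (refl n a v) + (\<Sum>x\<in>A. h x (refl n a v) * p x (refl n a v)))"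
        by (simp add: inv right_diff_distrib sum_subtractf)
      also have "\<dots> = 0" by (simp only: Suc.prems(3))
      finally show "ip n v a * (h x0 v * q0 v + (\<Sum>x\<in>A. h x v * q x v)) = 0" .
    qed
    \<comment> \<open>Dividing by a root lowers \<open>m\<close> and every \<open>e x\<close> by
      one, so the degrees of the excluded coefficients stay the same.\<close>
    have "e x - 1 - int m = e x - int (Suc m)" for x by simp
    then have no: "\<not> (\<exists>s. (\<forall>x\<in>A. hpz n (e x - 1 - int m) (s x) \<and> invariant (s x)) \<and>
                 (\<forall>v. h x0 v = (\<Sum>x\<in>A. s x v * h x v)))"
      using Suc.prems(4) by presburger
    have "Id m q0"
      using Suc.IH[of q0 "\<lambda>x. e x - 1" q, OF _ q(1) rel' no] q0(1) by simp
    from Id_mult[OF this hp_ip[of n a]] show "Id (Suc m) (\<lambda>v. p0 v - p0 (refl n a v))"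
      by (simp add: q0(2))
  qed simp
qed

text \<open>Independence modulo the ideal gives a component \<open>j0\<close> in which
  \<open>p x0\<close> lies outside it, so Chevalley's lemma expresses \<open>h x0\<close> through
  the other \<open>h x\<close> with invariant coefficients \<open>s x\<close>. Substitution leaves a
  shorter relation between the \<open>p' x\<close>, still independent modulo the ideal because each
  \<open>s x\<close> is zero, a constant or a positive invariant. The index \<open>j\<close> admits
  vectors: gradients in one application, single functions in the other.\<close>

lemma independent_over_Inv:
  assumes "finite A"
    and "\<And>x j. x \<in> A \<Longrightarrow> j \<in> J \<Longrightarrow> hp n (e x) (p x j)"
    and "\<And>k b x. (\<And>j. j \<in> J \<Longrightarrow> Id k (\<lambda>v. \<Sum>x\<in>{x\<in>A. e x = k}. b x * p x j v)) \<Longrightarrow>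
           x \<in> A \<Longrightarrow> e x = k \<Longrightarrow> b x = 0"
    and "\<And>x. x \<in> A \<Longrightarrow> hpz n (k - int (e x)) (h x) \<and> invariant (h x)"
    and "\<And>j v. j \<in> J \<Longrightarrow> (\<Sum>x\<in>A. h x v * p x j v) = 0"
  shows "x \<in> A \<Longrightarrow> h x v = 0"
  using assms
proof (induction A arbitrary: p x v rule: finite_induct)
  case empty
  then show ?case by simp
next
  case (insert x0 A)
  note hpP = insert.prems(2) and indep = insert.prems(3) and hH = insert.prems(4) and rel = insert.prems(5)
  have hInv: "\<exists>m. h x \<in> Inv m" if "x \<in> insert x0 A" for x
    using hH[OF that] hpz_hp by (auto simp: Inv_iff)
  have "\<exists>j\<in>J. \<not> Id (e x0) (p x0 j)"
  proof (rule ccontr)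
    assume j0: "\<not> ?thesis"
    then have all: "Id (e x0) (p x0 j)" if "j \<in> J" for j using that j0 by blast
    have "of_bool (x0 = x0) = (0::real)"
    proof (rule indep[of "e x0" "\<lambda>x. of_bool (x = x0)" x0])
      fix j assume "j \<in> J"
      have "(\<lambda>v. \<Sum>x\<in>{x \<in> insert x0 A. e x = e x0}. of_bool (x = x0) * p x j v) = p x0 j"
      proof
        fix v
        have "(\<Sum>x\<in>{x \<in> insert x0 A. e x = e x0}. of_bool (x = x0) * p x j v)
            = (\<Sum>x\<in>{x0}. of_bool (x = x0) * p x j v)"
          using insert.hyps by (intro sum.mono_neutral_right) auto
        then show "(\<Sum>x\<in>{x \<in> insert x0 A. e x = e x0}. of_bool (x = x0) * p x j v) = p x0 j v"
          by simp
      qed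
      then show "Id (e x0) (\<lambda>v. \<Sum>x\<in>{x \<in> insert x0 A. e x = e x0}. of_bool (x = x0) * p x j v)"
        using all[OF \<open>j \<in> J\<close>] by simp
    qed auto
    then show False by simp
  qed
  then obtain j0 where j0: "j0 \<in> J" "\<not> Id (e x0) (p x0 j0)" by blast
  have "\<exists>s. (\<forall>x\<in>A. hpz n (int (e x) - int (e x0)) (s x) \<and> invariant (s x)) \<and>
                 (\<forall>v. h x0 v = (\<Sum>x\<in>A. s x v * h x v))"
  proof (rule ccontr)
    assume no: "\<not> ?thesis"
    have "Id (e x0) (p x0 j0)"
    proof (rule Id_of_relation[OF insert.hyps(1,2) hInv _ _ _ no])
      show "hp n (e x0) (p x0 j0)" using hpP j0 by simp
      show "hpz n (int (e x)) (p x j0)" if "x \<in> A" for x using hpP j0 that by (simp add: hpz_nat)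
      show "h x0 v * p x0 j0 v + (\<Sum>x\<in>A. h x v * p x j0 v) = 0" for v
        using rel[OF j0(1), of v] insert.hyps by simp
    qed
    then show False using j0 by simp
  qed
  then obtain s where s: "\<And>x. x \<in> A \<Longrightarrow> hpz n (int (e x) - int (e x0)) (s x)"
    "\<And>x. x \<in> A \<Longrightarrow> invariant (s x)" "\<And>v. h x0 v = (\<Sum>x\<in>A. s x v * h x v)" by blast
  define p' where "p' = (\<lambda>x j v. p x j v + s x v * p x0 j v)"
  have s_ge: "s x \<in> Inv (e x - e x0)" if "x \<in> A" "e x \<ge> e x0" for x
    using s(1,2)[OF that(1)] that(2) by (simp add: hpz_def Inv_iff nat_diff_distrib)
  have s_lt: "s x = (\<lambda>_. 0)" if "x \<in> A" "e x < e x0" for x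
    using s(1)[OF that(1)] that(2) by (simp add: hpz_def)
  have A0: "h x v = 0" if "x \<in> A" for x v
  proof (rule insert.IH[of x p', OF that])
    show "hp n (e x) (p' x j)" if "x \<in> A" "j \<in> J" for x j
    proof (cases "e x \<ge> e x0")
      case True
      have "hp n ((e x - e x0) + e x0) (\<lambda>v. s x v * p x0 j v)"
        using Inv_hp[OF s_ge[OF that(1) True]] hpP[of x0 j] that by (intro hp_mult) auto
      then show ?thesis
        using hpP[of x j] that True unfolding p'_def by (intro hp_add) auto
    next
      case False
      then show ?thesis using s_lt[OF that(1)] hpP[of x j] that by (simp add: p'_def)
    qed
    show "hpz n (k - int (e x)) (h x) \<and> invariant (h x)" if "x \<in> A" for x
      using hH that by simp
    show "(\<Sum>x\<in>A. h x v * p' x j v) = 0" if "j \<in> J" for j v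
    proof -
      have "(\<Sum>x\<in>A. s x v * h x v) * p x0 j v = (\<Sum>x\<in>A. h x v * (s x v * p x0 j v))"
        unfolding sum_distrib_right by (simp add: ac_simps)
      then have "(\<Sum>x\<in>A. h x v * p' x j v) = (\<Sum>x\<in>A. h x v * p x j v) + (\<Sum>x\<in>A. s x v * h x v) * p x0 j v"
        by (simp add: p'_def distrib_left sum.distrib)
      also have "\<dots> = (\<Sum>x\<in>insert x0 A. h x v * p x j v)"
        using insert.hyps by (simp add: s(3))
      finally show ?thesis using rel[OF that] by simp
    qed
    show "b x = 0" if Id': "\<And>j. j \<in> J \<Longrightarrow> Id k (\<lambda>v. \<Sum>x\<in>{x\<in>A. e x = k}. b x * p' x j v)"
      and x: "x \<in> A" "e x = k" for k b x
    proof -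
      let ?A = "{x\<in>A. e x = k}"
      have finA: "finite ?A" using insert.hyps by simp
      have split: "(\<Sum>x\<in>?A. b x * p' x j v) = (\<Sum>x\<in>?A. b x * p x j v) + (\<Sum>x\<in>?A. b x * s x v) * p x0 j v" for j v
        by (simp add: p'_def distrib_left sum.distrib sum_distrib_right mult.assoc)
      show ?thesis
      proof (cases "k = e x0")
        case False
        then have set: "{x\<in>insert x0 A. e x = k} = ?A" by auto
        show ?thesis
        proof (rule indep[of k b x])
          fix j assume j: "j \<in> J"
          have "Id k (\<lambda>v. (\<Sum>x\<in>?A. b x * s x v) * p x0 j v)"
          proof (cases "k < e x0")
            case True
            then have "(\<Sum>x\<in>?A. b x * s x v) = 0" for v using s_lt by (intro sum.neutral) auto
            then show ?thesis by (simp add: Id_zero)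
          next
            case lt: False
            have "(\<lambda>v. \<Sum>x\<in>?A. b x * s x v) \<in> Inv (k - e x0)"
              by (intro Inv_sum Inv_scale) (use s_ge lt in auto)
            then have "Id ((k - e x0) + e x0) (\<lambda>v. (\<Sum>x\<in>?A. b x * s x v) * p x0 j v)"
              using False lt hpP[of x0 j] j by (intro Id_gen) auto
            then show ?thesis using lt by simp
          qed
          from Id_diff[OF Id'[OF j] this]
          show "Id k (\<lambda>v. \<Sum>x\<in>{x\<in>insert x0 A. e x = k}. b x * p x j v)"
            unfolding set by (simp add: split)
        qed (use x in auto)
      next
        case True
        have "\<exists>t. s x = (\<lambda>_. t)" if "x \<in> ?A" for x
          using s_ge[of x] that True Inv_0_const[of "s x"] by simp
        then obtain t where t: "\<And>x. x \<in> ?A \<Longrightarrow> s x = (\<lambda>_. t x)" by metis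
        have set: "{x\<in>insert x0 A. e x = k} = insert x0 ?A" using True by auto
        \<comment> \<open>In this degree the \<open>s x\<close> are constants, so their
          contributions collect in the coefficient of \<open>x0\<close>.\<close>
        define b' where "b' = b(x0 := \<Sum>x\<in>?A. b x * t x)"
        have "b' x = 0"
        proof (rule indep[of k b' x])
          fix j assume j: "j \<in> J"
          have x0: "x0 \<notin> ?A" using insert.hyps by simp
          have "(\<Sum>x\<in>insert x0 ?A. b' x * p x j v) = (\<Sum>x\<in>?A. b x * p' x j v)" for v
          proof -
            have "(\<Sum>x\<in>?A. b' x * p x j v) = (\<Sum>x\<in>?A. b x * p x j v)"
              by (rule sum.cong) (use x0 in \<open>auto simp: b'_def\<close>)
            moreover have "(\<Sum>x\<in>?A. b x * s x v) = (\<Sum>x\<in>?A. b x * t x)"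
              by (rule sum.cong) (use t in auto)
            ultimately show ?thesis
              unfolding sum.insert[OF finA x0] split by (simp add: b'_def)
          qed
          then show "Id k (\<lambda>v. \<Sum>x\<in>{x\<in>insert x0 A. e x = k}. b' x * p x j v)"
            unfolding set using Id'[OF j] by simp
        qed (use x in auto)
        then show ?thesis using x insert.hyps by (auto simp: b'_def split: if_splits)
      qed
    qed
  qed
  then show ?case
    using insert.prems(1) s(3) by (cases "x = x0") auto
qed

end

text \<open>Jacobian criterion: if the gradients of the \<open>\<phi> x\<close> are independent over a class \<open>Q\<close> of functions
  containing the polynomials in the \<open>\<phi> x\<close>, then the \<open>\<phi> x\<close> are algebraically independent.\<close>
lemma monomials_independent:
  assumes A: "finite A" and d: "\<And>x. x \<in> A \<Longrightarrow> d x \<ge> 1"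
    and \<phi>: "\<And>x. x \<in> A \<Longrightarrow> hp n (d x) (\<phi> x)"
    and Q: "\<And>F b. Q (\<lambda>v. \<Sum>M\<in>F. b M * mon A \<phi> M v)"
    and grad: "\<And>k h x v. (\<And>x. x \<in> A \<Longrightarrow> hpz n (k - int (d x)) (h x) \<and> Q (h x)) \<Longrightarrow>
        (\<And>i v. i < n \<Longrightarrow> (\<Sum>x\<in>A. h x v * pd i (\<phi> x) v) = 0) \<Longrightarrow> x \<in> A \<Longrightarrow> h x v = 0"
    and zero: "\<And>v. (\<Sum>M\<in>mons A d k. b M * mon A \<phi> M v) = 0" and M: "M \<in> mons A d k"
  shows "b M = 0"
  using zero M
proof (induction k arbitrary: b M rule: less_induct)
  case (less k)
  have fin: "finite (mons A d k)" for k by (rule finite_mons[OF A d])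
  show ?case
  proof (cases "k = 0")
    case True
    have only: "M' = (\<lambda>_. 0)" if "M' \<in> mons A d 0" for M'
    proof
      fix x
      show "M' x = 0"
        using that A d[of x] by (cases "x \<in> A") (auto simp: mons_def)
    qed
    then have "mons A d 0 = {M}" using less.prems(2) True by blast
    moreover have "mon A \<phi> M (\<lambda>_. 0) = 1"
      using only[of M] less.prems(2) True by (simp add: mon_def)
    ultimately show ?thesis using less.prems(1)[of "\<lambda>_. 0"] True by simp
  next
    case False
    \<comment> \<open>\<open>h y\<close> is the relation differentiated formally with respect to the
      generator \<open>\<phi> y\<close>. By the chain rule these are the coefficients of a relation
      between the gradients, and a generator of degree above \<open>k\<close> does not
      occur.\<close>
    define h where "h = (\<lambda>y v. if d y \<le> k then
       (\<Sum>M\<in>mons A d (k - d y). (b (M(y := Suc (M y))) * real (Suc (M y))) * mon A \<phi> M v) else 0)"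
    have inner: "(\<Sum>M\<in>mons A d k. b M * (real (M y) * mon A \<phi> (M(y := M y - 1)) v)) = h y v"
      if y: "y \<in> A" for y v
    proof (cases "d y \<le> k")
      case False
      have M0: "M y = 0" if "M \<in> mons A d k" for M
        using mons_decrease(1)[OF A y that] False by blast
      have "(\<Sum>M\<in>mons A d k. b M * (real (M y) * mon A \<phi> (M(y := M y - 1)) v)) = 0"
        by (rule sum.neutral) (simp add: M0)
      then show ?thesis using False by (simp add: h_def)
    next
      case True
      have "(\<Sum>M\<in>mons A d k. b M * (real (M y) * mon A \<phi> (M(y := M y - 1)) v))
          = (\<Sum>M\<in>{M\<in>mons A d k. M y > 0}. b M * (real (M y) * mon A \<phi> (M(y := M y - 1)) v))"
        using fin by (intro sum.mono_neutral_right) auto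
      also have "\<dots> = (\<Sum>M\<in>mons A d (k - d y). (b (M(y := Suc (M y))) * real (Suc (M y))) * mon A \<phi> M v)"
      proof (rule sum.reindex_bij_witness[of _ "\<lambda>M. M(y := Suc (M y))" "\<lambda>M. M(y := M y - 1)"])
        fix M assume M: "M \<in> {M\<in>mons A d k. M y > 0}"
        let ?M = "M(y := M y - 1)"
        show eq: "?M(y := Suc (?M y)) = M" using M by auto
        show "?M \<in> mons A d (k - d y)" using mons_decrease(2)[OF A y] M by blast
        show "b (?M(y := Suc (?M y))) * real (Suc (?M y)) * mon A \<phi> ?M v
          = b M * (real (M y) * mon A \<phi> (M(y := M y - 1)) v)"
          unfolding eq using M by simp
      next
        fix M assume M: "M \<in> mons A d (k - d y)"
        show "(M(y := Suc (M y)))(y := (M(y := Suc (M y))) y - 1) = M" by simp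
        show "M(y := Suc (M y)) \<in> {M\<in>mons A d k. M y > 0}"
          using mons_increase[OF A y M True] by simp
      qed
      finally show ?thesis using True by (simp add: h_def)
    qed
    have hz: "h y v = 0" if y: "y \<in> A" for y v
    proof (rule grad[of "int k" h, OF _ _ y])
      fix x assume x: "x \<in> A"
      show "hpz n (int k - int (d x)) (h x) \<and> Q (h x)"
      proof (cases "d x \<le> k")
        case True
        have "hp n (k - d x) (\<lambda>v. \<Sum>M\<in>mons A d (k - d x). (b (M(x := Suc (M x))) * real (Suc (M x))) * mon A \<phi> M v)"
          by (intro hp_sum hp_scale) (rule hp_mon[OF _ \<phi>])
        then have "hpz n (int k - int (d x)) (h x)"
          using True by (simp add: h_def hpz_def nat_diff_distrib)
        moreover have "Q (h x)" using True Q by (simp add: h_def)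
        ultimately show ?thesis by simp
      next
        case False
        then have "h x = (\<lambda>_. 0)" by (simp add: h_def fun_eq_iff)
        then show ?thesis using Q[of "\<lambda>_. 0" "{}"] by (simp add: hpz_zero)
      qed
    next
      fix i v assume "i < n"
      have "0 = pd i (\<lambda>v. \<Sum>M\<in>mons A d k. b M * mon A \<phi> M v) v"
        using less.prems(1) by (simp add: pd_zero)
      also have "\<dots> = (\<Sum>M\<in>mons A d k. b M * pd i (mon A \<phi> M) v)"
        by (rule pd_sum[where d = "\<lambda>_. k"], rule hp_mon) (use \<phi> in auto)
      also have "\<dots> = (\<Sum>M\<in>mons A d k. \<Sum>x\<in>A. b M * (real (M x) * mon A \<phi> (M(x := M x - 1)) v) * pd i (\<phi> x) v)"
        by (subst pd_mon[OF A \<phi>]) (auto simp: sum_distrib_left mult.assoc)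
      also have "\<dots> = (\<Sum>x\<in>A. (\<Sum>M\<in>mons A d k. b M * (real (M x) * mon A \<phi> (M(x := M x - 1)) v)) * pd i (\<phi> x) v)"
        by (subst sum.swap) (simp add: sum_distrib_right)
      also have "\<dots> = (\<Sum>x\<in>A. h x v * pd i (\<phi> x) v)"
        by (rule sum.cong) (use inner in auto)
      finally show "(\<Sum>x\<in>A. h x v * pd i (\<phi> x) v) = 0" by simp
    qed
    obtain y where y: "y \<in> A" "M y \<noteq> 0"
    proof (rule ccontr)
      assume "\<not> thesis"
      then have "(\<Sum>x\<in>A. M x * d x) = 0" using that by (intro sum.neutral) auto
      then show False using less.prems(2) False by (simp add: mons_def)
    qed
    let ?M = "M(y := M y - 1)"
    have eq: "?M(y := Suc (?M y)) = M" using y by auto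
    have dy: "d y \<le> k" and M': "?M \<in> mons A d (k - d y)"
      using mons_decrease[OF A y(1) less.prems(2)] y(2) by auto
    have "b (?M(y := Suc (?M y))) * real (Suc (?M y)) = 0"
    proof (rule less.IH[of "k - d y" "\<lambda>M. b (M(y := Suc (M y))) * real (Suc (M y))" ?M])
      show "k - d y < k" using dy d[OF y(1)] by simp
      show "(\<Sum>M\<in>mons A d (k - d y). (b (M(y := Suc (M y))) * real (Suc (M y))) * mon A \<phi> M v) = 0" for v
        using hz[OF y(1), of v] dy by (simp add: h_def)
    qed (rule M')
    then show ?thesis unfolding eq by simp
  qed
qed

section \<open>Basic invariants and the Poincare polynomial\<close>

interpretation fv: vector_space "(\<lambda>b f v. b * f v) :: real \<Rightarrow> ('v \<Rightarrow> real) \<Rightarrow> 'v \<Rightarrow> real"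
  by unfold_locales (auto simp: fun_eq_iff algebra_simps)

lemma sum_fun_apply: "(\<Sum>i\<in>I. f i) v = (\<Sum>i\<in>I. f i v)"
  by (induction I rule: infinite_finite_induct) auto

text \<open>Families instead of sets, since different indices might a priori give the same
  function.\<close>

definition lc :: "'i set \<Rightarrow> ('i \<Rightarrow> 'v \<Rightarrow> real) \<Rightarrow> ('v \<Rightarrow> real) \<Rightarrow> bool" where
  "lc I u f \<longleftrightarrow> (\<exists>b. \<forall>v. f v = (\<Sum>i\<in>I. b i * u i v))"

definition indep :: "'i set \<Rightarrow> ('i \<Rightarrow> 'v \<Rightarrow> real) \<Rightarrow> bool" where
  "indep I u \<longleftrightarrow> (\<forall>b. (\<forall>v. (\<Sum>i\<in>I. b i * u i v) = 0) \<longrightarrow> (\<forall>i\<in>I. b i = 0))"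

lemma lc_zero: "lc I u (\<lambda>_. 0)"
  unfolding lc_def by (intro exI[of _ "\<lambda>_. 0"]) simp

lemma lc_base:
  assumes "finite I" "i \<in> I"
  shows "lc I u (u i)"
  unfolding lc_def
proof (intro exI[of _ "\<lambda>j. of_bool (j = i)"] allI)
  fix v
  have "(\<Sum>j\<in>I. of_bool (j = i) * u j v) = (\<Sum>j\<in>{i}. of_bool (j = i) * u j v)"
    using assms by (intro sum.mono_neutral_right) auto
  then show "u i v = (\<Sum>j\<in>I. of_bool (j = i) * u j v)" by simp
qed

lemma lc_add:
  assumes "lc I u f" "lc I u g"
  shows "lc I u (\<lambda>v. f v + g v)"
proof -
  obtain b b' where "\<forall>v. f v = (\<Sum>i\<in>I. b i * u i v)" "\<forall>v. g v = (\<Sum>i\<in>I. b' i * u i v)"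
    using assms unfolding lc_def by blast
  then show ?thesis
    unfolding lc_def by (intro exI[of _ "\<lambda>i. b i + b' i"]) (simp add: distrib_right sum.distrib)
qed

lemma lc_scale:
  assumes "lc I u f"
  shows "lc I u (\<lambda>v. t * f v)"
proof -
  obtain b where "\<forall>v. f v = (\<Sum>i\<in>I. b i * u i v)"
    using assms unfolding lc_def by blast
  then show ?thesis
    unfolding lc_def by (intro exI[of _ "\<lambda>i. t * b i"]) (simp add: sum_distrib_left mult.assoc)
qed

lemma lc_sum:
  assumes "\<And>x. x \<in> A \<Longrightarrow> lc I u (f x)"
  shows "lc I u (\<lambda>v. \<Sum>x\<in>A. f x v)"
  using assms
proof (induction A rule: infinite_finite_induct)
  case (insert x A)
  then show ?case using lc_add[of I u "f x" "\<lambda>v. \<Sum>x\<in>A. f x v"] by simp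
qed (simp_all add: lc_zero)

lemma lc_mult:
  assumes "lc I u f" "lc J w g" "\<And>i j. i \<in> I \<Longrightarrow> j \<in> J \<Longrightarrow> lc K z (\<lambda>v. u i v * w j v)"
  shows "lc K z (\<lambda>v. f v * g v)"
proof -
  obtain b b' where b: "\<And>v. f v = (\<Sum>i\<in>I. b i * u i v)" "\<And>v. g v = (\<Sum>j\<in>J. b' j * w j v)"
    using assms(1,2) unfolding lc_def by blast
  have "lc K z (\<lambda>v. \<Sum>i\<in>I. \<Sum>j\<in>J. (b i * b' j) * (u i v * w j v))"
    by (rule lc_sum, rule lc_sum, rule lc_scale, rule assms(3))
  also have "(\<lambda>v. \<Sum>i\<in>I. \<Sum>j\<in>J. (b i * b' j) * (u i v * w j v)) = (\<lambda>v. f v * g v)"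
    unfolding b sum_product by (simp add: ac_simps)
  finally show ?thesis .
qed

lemma card_le_if_indep:
  assumes "finite I" "finite J" "indep I u" "\<And>i. i \<in> I \<Longrightarrow> lc J w (u i)"
  shows "card I \<le> card J"
proof -
  have inj: "inj_on u I"
  proof (rule inj_onI, rule ccontr)
    fix i j assume ij: "i \<in> I" "j \<in> I" "u i = u j" "i \<noteq> j"
    let ?b = "\<lambda>k. of_bool (k = i) - of_bool (k = j) :: real"
    have "(\<Sum>k\<in>I. ?b k * u k v) = 0" for v
    proof -
      have "(\<Sum>k\<in>I. ?b k * u k v) = (\<Sum>k\<in>{i, j}. ?b k * u k v)"
        using assms(1) ij by (intro sum.mono_neutral_right) auto
      then show ?thesis using ij by simp
    qed
    then have "?b i = 0"
      using assms(3)[unfolded indep_def, rule_format, of ?b i] ij(1) by blast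
    then show False using ij by simp
  qed
  have "fv.independent (u ` I)"
  proof (rule fv.independent_if_scalars_zero)
    show "finite (u ` I)" using assms by simp
    fix f x assume sum: "(\<Sum>x\<in>u ` I. (\<lambda>v. f x * x v)) = 0" and x: "x \<in> u ` I"
    have "(\<Sum>i\<in>I. f (u i) * u i v) = 0" for v
    proof -
      have "(\<Sum>i\<in>I. f (u i) * u i v) = (\<Sum>x\<in>u ` I. (\<lambda>v. f x * x v)) v"
        by (simp add: sum_fun_apply sum.reindex[OF inj])
      then show ?thesis by (simp add: sum)
    qed
    then show "f x = 0"
      using assms(3)[unfolded indep_def, rule_format, of "\<lambda>i. f (u i)"] x by blast
  qed
  moreover have "u ` I \<subseteq> fv.span (w ` J)"
  proof (rule image_subsetI)
    fix i assume "i \<in> I"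
    then obtain b where "\<And>v. u i v = (\<Sum>j\<in>J. b j * w j v)"
      using assms(4) unfolding lc_def by blast
    then have "u i = (\<Sum>j\<in>J. (\<lambda>v. b j * w j v))" by (auto simp: fun_eq_iff sum_fun_apply)
    then show "u i \<in> fv.span (w ` J)"
      by (simp add: fv.span_sum fv.span_scale fv.span_base)
  qed
  ultimately have "card (u ` I) \<le> card (w ` J)"
    using fv.independent_span_bound[of "w ` J" "u ` I"] assms(2) by simp
  also have "\<dots> \<le> card J" by (rule card_image_le[OF assms(2)])
  finally show ?thesis by (simp add: card_image inj)
qed

lemma card_mons_insert:
  assumes A: "finite A" "x \<notin> A" and d: "\<And>y. y \<in> insert x A \<Longrightarrow> d y \<ge> 1"
  shows "card (mons (insert x A) d k)
       = card (mons A d k) + (if d x \<le> k then card (mons (insert x A) d (k - d x)) else 0)"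
proof -
  let ?B = "insert x A"
  have finB: "finite ?B" using A by simp
  let ?Z = "{M\<in>mons ?B d k. M x = 0}" and ?S = "{M\<in>mons ?B d k. M x > 0}"
  have fin: "finite (mons ?B d k)" by (rule finite_mons[OF finB d])
  have "mons ?B d k = ?Z \<union> ?S" by auto
  moreover have "card (?Z \<union> ?S) = card ?Z + card ?S"
    using fin by (intro card_Un_disjoint) auto
  ultimately have "card (mons ?B d k) = card ?Z + card ?S" by (simp only:)
  moreover have "?Z = mons A d k"
    unfolding mons_def sum.insert[OF A] using A(2) by (auto, metis)
  moreover have "card ?S = (if d x \<le> k then card (mons ?B d (k - d x)) else 0)"
  proof (cases "d x \<le> k")
    case True
    have "bij_betw (\<lambda>M. M(x := M x - 1)) ?S (mons ?B d (k - d x))"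
    proof (rule bij_betw_byWitness[of _ "\<lambda>M. M(x := Suc (M x))"])
      show "\<forall>M\<in>?S. (M(x := M x - 1))(x := Suc ((M(x := M x - 1)) x)) = M"
        by (intro ballI ext) simp
      show "\<forall>M\<in>mons ?B d (k - d x). (M(x := Suc (M x)))(x := (M(x := Suc (M x))) x - 1) = M"
        by (intro ballI ext) simp
      show "(\<lambda>M. M(x := M x - 1)) ` ?S \<subseteq> mons ?B d (k - d x)"
        using mons_decrease(2)[OF finB insertI1] by blast
      show "(\<lambda>M. M(x := Suc (M x))) ` mons ?B d (k - d x) \<subseteq> ?S"
        using mons_increase[where y = x and d = d, OF finB insertI1 _ True]
        by (intro image_subsetI) simp
    qed
    then show ?thesis using True by (simp add: bij_betw_same_card)
  next
    case False
    have "M x = 0" if "M \<in> mons ?B d k" for M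
      using mons_decrease(1)[OF finB insertI1 that] False by blast
    then have "?S = {}" by auto
    then show ?thesis using False by (metis (no_types, lifting) card.empty)
  qed
  ultimately show ?thesis by simp
qed

lemma mons_hilbert_series:
  assumes "finite A" "\<And>x. x \<in> A \<Longrightarrow> d x \<ge> 1"
  shows "Abs_fps (\<lambda>k. real (card (mons A d k))) * (\<Prod>x\<in>A. 1 - fps_X ^ d x) = 1"
  using assms
proof (induction A rule: finite_induct)
  case empty
  have "mons {} d k = (if k = 0 then {\<lambda>_. 0} else {})" for k by (auto simp: mons_def)
  then show ?case by (auto simp: fps_eq_iff)
next
  case (insert x A)
  let ?F = "\<lambda>A. Abs_fps (\<lambda>k. real (card (mons A d k)))"
  have "?F (insert x A) * (1 - fps_X ^ d x) = ?F A"
  proof (rule fps_ext)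
    fix k
    have "fps_nth (?F (insert x A) * (1 - fps_X ^ d x)) k
        = fps_nth (?F (insert x A)) k - (if k < d x then 0 else fps_nth (?F (insert x A)) (k - d x))"
      by (simp add: right_diff_distrib fps_X_power_mult_right_nth)
    then show "fps_nth (?F (insert x A) * (1 - fps_X ^ d x)) k = fps_nth (?F A) k"
      using card_mons_insert[OF insert.hyps insert.prems, where k = k] by auto
  qed
  then show ?case
    using insert by (simp add: mult.assoc[symmetric])
qed

section \<open>Decomposable invariants and basic generators\<close>

context refl_system
begin

text \<open>The degree \<open>k\<close> part of the square of the ideal of positive invariants
  within the invariant ring, in a form fit for rule induction; \<open>decomposable_iff_Dec\<close>
  links it to the explicit sums.\<close>

inductive Dec :: "nat \<Rightarrow> ((nat \<Rightarrow> real) \<Rightarrow> real) \<Rightarrow> bool" where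
  Dec_zero: "Dec k (\<lambda>_. 0)"
| Dec_gen: "1 \<le> i \<Longrightarrow> 1 \<le> j \<Longrightarrow> g \<in> Inv i \<Longrightarrow> h \<in> Inv j \<Longrightarrow> Dec (i + j) (\<lambda>v. g v * h v)"
| Dec_add: "Dec k f \<Longrightarrow> Dec k g \<Longrightarrow> Dec k (\<lambda>v. f v + g v)"

lemma Dec_Inv: "Dec k f \<Longrightarrow> f \<in> Inv k"
  by (induction rule: Dec.induct) (simp_all add: Inv_zero Inv_add Inv_mult)

lemma Dec_scale: "Dec k f \<Longrightarrow> Dec k (\<lambda>v. b * f v)"
proof (induction rule: Dec.induct)
  case (Dec_gen i j g h)
  have "Dec (i + j) (\<lambda>v. (b * g v) * h v)" by (intro Dec.Dec_gen Dec_gen Inv_scale)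
  then show ?case by (simp add: mult.assoc)
next
  case (Dec_add k f g)
  from Dec.Dec_add[OF Dec_add.IH] show ?case by (simp add: distrib_left)
qed (simp add: Dec.Dec_zero)

lemma Dec_sum: "(\<And>x. x \<in> A \<Longrightarrow> Dec k (f x)) \<Longrightarrow> Dec k (\<lambda>v. \<Sum>x\<in>A. f x v)"
proof (induction A rule: infinite_finite_induct)
  case (insert x A)
  then show ?case using Dec_add[of k "f x" "\<lambda>v. \<Sum>x\<in>A. f x v"] by simp
qed (simp_all add: Dec_zero)

lemma Dec_imp_decomposable:
  assumes "Dec k f"
  shows "decomposable n \<Phi> k f"
proof -
  have "\<exists>m g h d. (\<forall>j<m. 1 \<le> d j \<and> d j < k \<and> g j \<in> Inv (d j) \<and> h j \<in> Inv (k - d j)) \<and>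
        (\<forall>v. f v = (\<Sum>j<(m::nat). g j v * h j v))"
    using assms
  proof (induction rule: Dec.induct)
    case (Dec_zero k)
    then show ?case by (intro exI[of _ 0]) simp
  next
    case (Dec_gen i j g h)
    then show ?case
      by (intro exI[of _ 1] exI[of _ "\<lambda>_. g"] exI[of _ "\<lambda>_. h"] exI[of _ "\<lambda>_. i"]) auto
  next
    case (Dec_add k f f')
    obtain m g h d where 1: "\<forall>j<m. 1 \<le> d j \<and> d j < k \<and> g j \<in> Inv (d j) \<and> h j \<in> Inv (k - d j)"
        "\<forall>v. f v = (\<Sum>j<(m::nat). g j v * h j v)"
      using Dec_add.IH(1) by blast
    obtain m' g' h' d' where 2: "\<forall>j<m'. 1 \<le> d' j \<and> d' j < k \<and> g' j \<in> Inv (d' j) \<and> h' j \<in> Inv (k - d' j)"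
        "\<forall>v. f' v = (\<Sum>j<(m'::nat). g' j v * h' j v)"
      using Dec_add.IH(2) by blast
    let ?c = "\<lambda>x y j. if j < m then x j else y (j - m)"
    have "\<forall>v. f v + f' v = (\<Sum>j<m + m'. ?c g g' j v * ?c h h' j v)"
    proof
      fix v
      have "{..<m + m'} = {..<m} \<union> (+) m ` {..<m'}"
        by (auto simp: image_iff) (metis add_diff_inverse_nat nat_add_left_cancel_less lessThan_iff)
      moreover have "(\<Sum>j\<in>{..<m} \<union> (+) m ` {..<m'}. ?c g g' j v * ?c h h' j v)
          = (\<Sum>j<m. ?c g g' j v * ?c h h' j v) + (\<Sum>j\<in>(+) m ` {..<m'}. ?c g g' j v * ?c h h' j v)"
        by (rule sum.union_disjoint) auto
      moreover have "(\<Sum>j\<in>(+) m ` {..<m'}. ?c g g' j v * ?c h h' j v) = (\<Sum>j<m'. g' j v * h' j v)"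
        by (subst sum.reindex) auto
      ultimately show "f v + f' v = (\<Sum>j<m + m'. ?c g g' j v * ?c h h' j v)"
        using 1(2) 2(2) by simp
    qed
    moreover have "\<forall>j<m + m'. 1 \<le> ?c d d' j \<and> ?c d d' j < k \<and> ?c g g' j \<in> Inv (?c d d' j)
        \<and> ?c h h' j \<in> Inv (k - ?c d d' j)"
      using 1(1) 2(1) by auto
    ultimately show ?case
      by - (rule exI[of _ "m + m'"], rule exI[of _ "?c g g'"], rule exI[of _ "?c h h'"],
          rule exI[of _ "?c d d'"], rule conjI)
  qed
  then show ?thesis unfolding decomposable_def inv_polys_eq_Inv by blast
qed

lemma decomposable_iff_Dec:
  assumes "f \<in> Inv k"
  shows "decomposable n \<Phi> k f \<longleftrightarrow> Dec k f"
proof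
  assume "decomposable n \<Phi> k f"
  then obtain m g h and d :: "nat \<Rightarrow> nat" where
    *: "\<forall>j<m. 1 \<le> d j \<and> d j < k \<and> g j \<in> Inv (d j) \<and> h j \<in> Inv (k - d j)"
    "\<forall>v\<in>vecs n. f v = (\<Sum>j<(m::nat). g j v * h j v)"
    unfolding decomposable_def inv_polys_eq_Inv by blast
  have gen: "Dec k (\<lambda>v. g j v * h j v)" if "j < m" for j
    using Dec_gen[of "d j" "k - d j" "g j" "h j"] *(1) that by auto
  have "f v = (\<Sum>j<m. g j v * h j v)" for v
  proof -
    let ?r = "\<lambda>i. if i < n then v i else 0 :: real"
    have "f v = f ?r" by (rule hp_cong[OF Inv_hp[OF assms]]) simp
    also have "\<dots> = (\<Sum>j<m. g j ?r * h j ?r)" using *(2) by (simp add: vecs_def)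
    also have "\<dots> = (\<Sum>j<m. g j v * h j v)"
      by (rule sum.cong[OF HOL.refl], rule hp_cong[OF Inv_hp[OF Dec_Inv[OF gen]]]) auto
    finally show ?thesis .
  qed
  then have "f = (\<lambda>v. \<Sum>j<m. g j v * h j v)" by auto
  then show "Dec k f" using Dec_sum[of "{..<m}" k "\<lambda>j v. g j v * h j v"] gen by simp
qed (rule Dec_imp_decomposable)

text \<open>Averaging pulls the positive invariant out of a generator of the ideal. The average left
  behind has degree at least \<open>l\<close>, so it is a second positive invariant.\<close>

lemma Dec_avg_mult:
  assumes "Id k q" "hp n l r" "1 \<le> l"
  shows "Dec (k + l) (avg (\<lambda>v. r v * q v))"
  using assms(1)
proof (induction rule: Id.induct)
  case (Id_zero k)
  then show ?case by (simp add: avg_def Dec_zero)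
next
  case (Id_gen j g m s)
  have "avg (\<lambda>v. r v * (g v * s v)) = (\<lambda>v. g v * avg (\<lambda>v. s v * r v) v)"
    using avg_mult[OF Id_gen(2), of "\<lambda>v. s v * r v"] by (simp add: fun_eq_iff ac_simps)
  moreover have "Dec (j + (m + l)) (\<lambda>v. g v * avg (\<lambda>v. s v * r v) v)"
    by (intro Dec_gen Id_gen avg_Inv hp_mult assms(2)) (use assms(3) in simp)
  ultimately show ?case by (simp add: add.assoc)
next
  case (Id_add k f g)
  have "avg (\<lambda>v. r v * (f v + g v)) = (\<lambda>v. avg (\<lambda>v. r v * f v) v + avg (\<lambda>v. r v * g v) v)"
    by (simp add: avg_def fun_eq_iff distrib_left sum.distrib)
  then show ?case using Id_add.IH by (simp add: Dec_add)
qed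

text \<open>Euler's identity followed by averaging.\<close>
lemma Dec_if_gradient_Id:
  assumes f: "f \<in> Inv (Suc k)" and pd: "\<And>i. i < n \<Longrightarrow> Id k (pd i f)"
  shows "Dec (Suc k) f"
proof -
  have "Dec (Suc k) (\<lambda>v. \<Sum>i<n. avg (\<lambda>v. v i * pd i f v) v)"
  proof (rule Dec_sum)
    fix i assume "i \<in> {..<n}"
    then have "i < n" by simp
    then show "Dec (Suc k) (avg (\<lambda>v. v i * pd i f v))"
      using Dec_avg_mult[OF pd[OF \<open>i < n\<close>] hp_coord[OF \<open>i < n\<close>]] by simp
  qed
  then have "Dec (Suc k) (\<lambda>v. (1 / real (Suc k)) * (\<Sum>i<n. avg (\<lambda>v. v i * pd i f v) v))"
    by (rule Dec_scale)
  also have "(\<lambda>v. (1 / real (Suc k)) * (\<Sum>i<n. avg (\<lambda>v. v i * pd i f v) v)) = f"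
  proof
    fix v
    have "(\<Sum>i<n. avg (\<lambda>v. v i * pd i f v) v) = avg (\<lambda>v. \<Sum>i<n. v i * pd i f v) v"
      by (rule avg_sum[symmetric])
    also have "\<dots> = avg (\<lambda>v. real (Suc k) * f v) v"
      by (simp add: euler_identity[OF Inv_hp[OF f]])
    also have "\<dots> = real (Suc k) * f v"
      by (rule avg_id[OF Inv_scale[OF f]])
    finally show "(1 / real (Suc k)) * (\<Sum>i<n. avg (\<lambda>v. v i * pd i f v) v) = f v" by simp
  qed
  finally show ?thesis .
qed

text \<open>The coinvariant basis ends at degree \<open>card P\<close>, the bound on the
  lengths.\<close>

lemma Id_of_large_degree:
  assumes "hp n k g" "card P < k"
  shows "Id k g"
proof -
  have "\<exists>b e. Id k (\<lambda>v. g v - (\<Sum>y\<in>{y\<in>orb. len y = k}. b y * e y v))"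
    using coinvariant_basis assms(1) by (elim exE conjE) (drule spec, drule spec, drule (1) mp, blast)
  then obtain b e where b: "Id k (\<lambda>v. g v - (\<Sum>y\<in>{y\<in>orb. len y = k}. b y * e y v))"
    by blast
  have "{y\<in>orb. len y = k} = {}" using len_le assms(2) by (auto simp: not_less[symmetric])
  then have "(\<Sum>y\<in>{y\<in>orb. len y = k}. b y * e y v) = 0" for v by (simp only: sum.empty)
  then show ?thesis using b by simp
qed

text \<open>Bounds the degrees of the generators, so that a finite set of them suffices without
  Hilbert's basis theorem. The extra 1 is the degree lost in passing to the gradient.\<close>

lemma Dec_of_large_degree:
  assumes "f \<in> Inv k" "Suc (card P) < k"
  shows "Dec k f"
proof -
  obtain k' where k: "k = Suc k'" using assms(2) by (cases k) auto
  have "Id k' (pd i f)" for i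
    using hp_pd[OF Inv_hp[OF assms(1)], of i] assms(2) by (intro Id_of_large_degree) (auto simp: k)
  then show ?thesis using Dec_if_gradient_Id[of f k'] assms(1) by (simp add: k)
qed

definition basic_generators :: "nat \<Rightarrow> ((nat \<Rightarrow> real) \<Rightarrow> real) set \<Rightarrow> bool" where
  "basic_generators k G \<longleftrightarrow> finite G \<and> G \<subseteq> Inv k \<and>
     (\<forall>f\<in>Inv k. \<exists>b. Dec k (\<lambda>v. f v - (\<Sum>g\<in>G. b g * g v))) \<and>
     (\<forall>b. Dec k (\<lambda>v. \<Sum>g\<in>G. b g * g v) \<longrightarrow> (\<forall>g\<in>G. b g = 0))"

lemmas basic_generatorsD =
  basic_generators_def[THEN iffD1, THEN conjunct1]
  basic_generators_def[THEN iffD1, THEN conjunct2, THEN conjunct1]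
  basic_generators_def[THEN iffD1, THEN conjunct2, THEN conjunct2, THEN conjunct1]
  basic_generators_def[THEN iffD1, THEN conjunct2, THEN conjunct2, THEN conjunct2]

text \<open>A basis of the decomposable part is extended to one of \<open>Inv k\<close>; the added
  elements are the generators. The coordinate monomials span, which bounds the size.\<close>

lemma basic_generators_exist: "\<exists>G. basic_generators k G"
proof -
  let ?D = "{f. Dec k f}"
  have "\<exists>B\<subseteq>?D. fv.independent B \<and> ?D \<subseteq> fv.span B"
    by (rule fv.maximal_independent_subset[of ?D]) blast
  then obtain B where B: "B \<subseteq> ?D" "fv.independent B" "?D \<subseteq> fv.span B"
    by blast
  have BI: "B \<subseteq> Inv k" using B(1) Dec_Inv by blast
  have "\<exists>B'. B \<subseteq> B' \<and> B' \<subseteq> Inv k \<and> fv.independent B' \<and> Inv k \<subseteq> fv.span B'"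
    by (rule fv.maximal_independent_subset_extend[OF BI B(2)]) blast
  then obtain B' where B': "B \<subseteq> B'" "B' \<subseteq> Inv k" "fv.independent B'" "Inv k \<subseteq> fv.span B'"
    by blast
  have "Inv k \<subseteq> fv.span (cmon n ` exps n k)"
  proof
    fix f assume "f \<in> Inv k"
    then obtain C where "\<And>v. f v = (\<Sum>e\<in>exps n k. C e * cmon n e v)"
      using hp_expand[OF Inv_hp] by blast
    then have "f = (\<Sum>e\<in>exps n k. (\<lambda>v. C e * cmon n e v))" by (auto simp: fun_eq_iff sum_fun_apply)
    then show "f \<in> fv.span (cmon n ` exps n k)"
      by (simp add: fv.span_sum fv.span_scale fv.span_base)
  qed
  then have finB': "finite B'"
    using fv.independent_span_bound[of "cmon n ` exps n k" B'] B' finite_exps by blast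
  then have finB: "finite B" using B'(1) finite_subset by blast
  let ?G = "B' - B"
  have split: "(\<Sum>g\<in>B'. b g * g v) = (\<Sum>g\<in>?G. b g * g v) + (\<Sum>g\<in>B. b g * g v)" for b :: "_ \<Rightarrow> real" and v
    by (rule sum.subset_diff[OF B'(1) finB'])
  have DB: "Dec k (\<lambda>v. \<Sum>g\<in>B. b g * g v)" for b
    using B(1) by (intro Dec_sum Dec_scale) auto
  have exp: "\<exists>b. \<forall>v. f v = (\<Sum>g\<in>C. b g * g v)" if "f \<in> fv.span C" "finite C" for f :: "(nat \<Rightarrow> real) \<Rightarrow> real" and C
    using that(1) unfolding fv.span_finite[OF that(2)] by (auto simp: sum_fun_apply)
  have span: "\<forall>f\<in>Inv k. \<exists>b. Dec k (\<lambda>v. f v - (\<Sum>g\<in>?G. b g * g v))"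
  proof
    fix f assume f: "f \<in> Inv k"
    show "\<exists>b. Dec k (\<lambda>v. f v - (\<Sum>g\<in>?G. b g * g v))"
    proof -
      obtain b where "\<And>v. f v = (\<Sum>g\<in>B'. b g * g v)" using exp[of f B'] B'(4) f finB' by blast
      then have "f v - (\<Sum>g\<in>?G. b g * g v) = (\<Sum>g\<in>B. b g * g v)" for v by (simp add: split)
      then show ?thesis using DB[of b] by (intro exI[of _ b]) simp
    qed
  qed
  have ind: "\<forall>b. Dec k (\<lambda>v. \<Sum>g\<in>?G. b g * g v) \<longrightarrow> (\<forall>g\<in>?G. b g = 0)"
  proof (intro allI impI)
    fix b assume Dec: "Dec k (\<lambda>v. \<Sum>g\<in>?G. b g * g v)"
    show "\<forall>g\<in>?G. b g = 0"
    proof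
      fix g assume g: "g \<in> ?G"
      obtain b' where b': "\<And>v. (\<Sum>g\<in>?G. b g * g v) = (\<Sum>g\<in>B. b' g * g v)"
        using exp[of "\<lambda>v. \<Sum>g\<in>?G. b g * g v" B] B(3) Dec finB by blast
      let ?c = "\<lambda>g. if g \<in> B then - b' g else b g"
      have "(\<Sum>g\<in>B'. ?c g * g v) = 0" for v
      proof -
        have "(\<Sum>g\<in>?G. ?c g * g v) = (\<Sum>g\<in>?G. b g * g v)" by (rule sum.cong) auto
        moreover have "(\<Sum>g\<in>B. ?c g * g v) = - (\<Sum>g\<in>B. b' g * g v)"
          unfolding sum_negf[symmetric] by (rule sum.cong) auto
        ultimately show ?thesis unfolding split by (simp add: b')
      qed
      then have "(\<Sum>g\<in>B'. (\<lambda>v. ?c g * g v)) = 0" by (simp add: fun_eq_iff sum_fun_apply)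
      then have "?c g = 0" using fv.independentD[OF B'(3) finB' order_refl, of ?c g] g by blast
      then show "b g = 0" using g by simp
    qed
  qed
  have "finite ?G" "?G \<subseteq> Inv k" using finB' B'(2) by auto
  with span ind have "basic_generators k ?G" unfolding basic_generators_def by (intro conjI)
  then show ?thesis ..
qed

section \<open>Comparison of Hilbert series\<close>

lemma len_shift_product:
  fixes F :: "real fps"
  shows "fps_nth ((\<Sum>y\<in>orb. fps_X ^ len y) * F) k = (\<Sum>y\<in>{y\<in>orb. len y \<le> k}. fps_nth F (k - len y))"
proof -
  have "fps_nth ((\<Sum>y\<in>orb. fps_X ^ len y) * F) k = (\<Sum>y\<in>orb. if len y \<le> k then fps_nth F (k - len y) else 0)"
    unfolding sum_distrib_right fps_sum_nth
    by (rule sum.cong) (simp_all add: fps_X_power_mult_nth)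
  also have "\<dots> = (\<Sum>y\<in>{y\<in>orb. len y \<le> k}. fps_nth F (k - len y))"
    using finite_orb by (simp add: sum.inter_filter)
  finally show ?thesis .
qed

end

text \<open>\<open>W\<close> and the product of the q-integers are both nonzero at 1, so comparing
  orders of vanishing there forces \<open>n = card A\<close>, and the powers of \<open>1 - X\<close>
  cancel.\<close>

lemma poly_factor_cancel:
  fixes W :: "real poly"
  assumes W: "poly W 1 \<noteq> 0" and fin: "finite A" and d: "\<And>x. x \<in> A \<Longrightarrow> d x \<ge> 1"
    and eq: "W * (1 - [:0, 1:]) ^ n = (\<Prod>x\<in>A. 1 - [:0, 1:] ^ d x)"
  shows "W = (\<Prod>x\<in>A. \<Sum>j<d x. [:0, 1:] ^ j)"
proof -
  let ?X = "[:0, 1:] :: real poly"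
  define V where "V = (\<Prod>x\<in>A. \<Sum>j<d x. ?X ^ j)"
  have V1: "poly V 1 \<noteq> 0"
  proof -
    have "poly V 1 = (\<Prod>x\<in>A. real (d x))" by (simp add: V_def poly_prod poly_sum)
    moreover have "d x \<noteq> 0" if "x \<in> A" for x using d[OF that] by simp
    ultimately show ?thesis using fin by simp
  qed
  have "(\<Prod>x\<in>A. 1 - ?X ^ d x) = (\<Prod>x\<in>A. (1 - ?X) * (\<Sum>j<d x. ?X ^ j))"
    by (simp only: one_diff_power_eq)
  also have "\<dots> = (1 - ?X) ^ card A * V"
    by (simp add: V_def prod.distrib)
  finally have eq': "W * (1 - ?X) ^ n = (1 - ?X) ^ card A * V" using eq by simp
  have nz: "1 - ?X \<noteq> 0" by (simp add: one_pCons)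
  have at1: "poly (1 - ?X) 1 = 0" by simp
  have "n = card A"
  proof (cases n "card A" rule: linorder_cases)
    case less
    then have "(1 - ?X) ^ card A = (1 - ?X) ^ n * (1 - ?X) ^ (card A - n)"
      by (simp flip: power_add)
    then have "(1 - ?X) ^ n * W = (1 - ?X) ^ n * ((1 - ?X) ^ (card A - n) * V)"
      using eq' by (simp only: ac_simps)
    then have "W = (1 - ?X) ^ (card A - n) * V" using nz by (metis mult_left_cancel power_not_zero)
    then have "poly W 1 = 0" using less at1 by (simp add: power_0_left)
    then show ?thesis using W by simp
  next
    case greater
    then have "(1 - ?X) ^ n = (1 - ?X) ^ card A * (1 - ?X) ^ (n - card A)"
      by (simp flip: power_add)
    then have "(1 - ?X) ^ card A * ((1 - ?X) ^ (n - card A) * W) = (1 - ?X) ^ card A * V"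
      using eq' by (simp only: ac_simps)
    then have "(1 - ?X) ^ (n - card A) * W = V" using nz by (metis mult_left_cancel power_not_zero)
    then have "poly V 1 = poly ((1 - ?X) ^ (n - card A) * W) 1" by simp
    then have "poly V 1 = 0" using greater at1 by (simp add: power_0_left)
    then show ?thesis using V1 by simp
  qed
  then have "(1 - ?X) ^ n * W = (1 - ?X) ^ n * V" using eq' by (simp add: mult.commute)
  then have "W = V" using nz by (metis mult_left_cancel power_not_zero)
  then show ?thesis by (simp add: V_def)
qed

text \<open>The Jacobian criterion for the coordinates themselves, whose gradients are the unit
  vectors.\<close>

lemma coordinate_monomials_indep: "indep (exps n k) (cmon n)"
  unfolding indep_def
proof (intro allI impI ballI)
  fix b M assume zero: "\<forall>v. (\<Sum>M\<in>exps n k. b M * cmon n M v) = 0" and M: "M \<in> exps n k"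
  show "b M = 0"
  proof (rule monomials_independent[where A = "{..<n}" and d = "\<lambda>_. Suc 0" and n = n and k = k
        and \<phi> = "\<lambda>i v. v i" and Q = "\<lambda>_. True" and b = b and M = M])
    fix h x v
    assume "\<And>i v. i < n \<Longrightarrow> (\<Sum>x<n. h x v * pd i (\<lambda>v. v x) v) = (0::real)" and x: "x \<in> {..<n}"
    then have "(\<Sum>y<n. h y v * pd x (\<lambda>v. v y) v) = 0" by simp
    moreover have "(\<Sum>y<n. h y v * pd x (\<lambda>v. v y) v) = (\<Sum>y\<in>{x}. h y v * pd x (\<lambda>v. v y) v)"
      using x by (intro sum.mono_neutral_right) (auto simp: pd_coord)
    ultimately show "h x v = 0" by (simp add: pd_coord)
  qed (use zero M in \<open>auto intro: hp_coord\<close>)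
qed

lemma lc_exps: "hp n k f \<Longrightarrow> lc (exps n k) (cmon n) f"
  unfolding lc_def using homog_poly_iff homog_poly_iff_cmon by blast

context refl_system
begin

text \<open>\<open>GG\<close> pairs each generator with its degree, so that \<open>fst\<close>
  serves as the weight and multiplicities are numbers of pairs.\<close>

lemma poincare_polynomial_aux:
  fixes G :: "nat \<Rightarrow> ((nat \<Rightarrow> real) \<Rightarrow> real) set"
  defines "GG \<equiv> Sigma {1..Suc (card P)} G"
  assumes G: "\<And>k. basic_generators k (G k)"
  shows "(\<Sum>y\<in>orb. [:0, 1:] ^ len y) = (\<Prod>x\<in>GG. \<Sum>j<fst x. [:0, 1:] ^ j :: real poly)"
proof -
  note finG = basic_generatorsD(1)[OF G] and GInv = basic_generatorsD(2)[OF G]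
    and Gspan = basic_generatorsD(3)[OF G] and Gind = basic_generatorsD(4)[OF G]
  have finGG: "finite GG" unfolding GG_def using finG by auto
  have GGd: "fst x \<ge> 1" if "x \<in> GG" for x using that by (auto simp: GG_def)
  have GGI: "snd x \<in> Inv (fst x)" if "x \<in> GG" for x using that subsetD[OF GInv] by (auto simp: GG_def)
  have sumG: "(\<Sum>x\<in>{x\<in>GG. fst x = k}. F x) = (\<Sum>g\<in>G k. F (k, g))"
    if "1 \<le> k" "k \<le> Suc (card P)" for k and F :: "_ \<Rightarrow> real"
  proof -
    have "{x\<in>GG. fst x = k} = Pair k ` G k" using that by (auto simp: GG_def)
    then show ?thesis by (simp add: sum.reindex inj_on_def)
  qed
  let ?mon = "mon GG snd" and ?mons = "mons GG fst"
  have finM: "finite (?mons k)" for k by (rule finite_mons[OF finGG GGd])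
  have monI: "?mon M \<in> Inv k" if "M \<in> ?mons k" for M k
    using Inv_mon[OF that, of snd] GGI by blast

  \<comment> \<open>If a combination of gradients lay in the ideal,
    \<open>Dec_if_gradient_Id\<close> would make the same combination of generators decomposable,
    against their choice.\<close>
  have grad: "b x = 0"
    if Id: "\<And>j. j \<in> {..<n} \<Longrightarrow> Id k (\<lambda>v. \<Sum>x\<in>{x\<in>GG. fst x - 1 = k}. b x * pd j (snd x) v)"
      and x: "x \<in> GG" "fst x - 1 = k" for k b x
  proof -
    have set: "{x\<in>GG. fst x - 1 = k} = {x\<in>GG. fst x = Suc k}" using GGd by fastforce
    have k: "Suc k \<le> Suc (card P)" "fst x = Suc k" using x GGd[OF x(1)] by (auto simp: GG_def)
    let ?f = "\<lambda>v. \<Sum>x\<in>{x\<in>GG. fst x = Suc k}. b x * snd x v"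
    have f: "?f \<in> Inv (Suc k)"
      using GGI by (intro Inv_sum Inv_scale) auto
    have pdf: "pd j ?f = (\<lambda>v. \<Sum>x\<in>{x\<in>GG. fst x - 1 = k}. b x * pd j (snd x) v)" for j
      unfolding set
      by (rule ext, rule pd_sum[where d = fst and n = n]) (use GGI Inv_hp in auto)
    have "Dec (Suc k) ?f"
      using Dec_if_gradient_Id[OF f] Id unfolding pdf by simp
    then have "Dec (Suc k) (\<lambda>v. \<Sum>g\<in>G (Suc k). b (Suc k, g) * g v)"
      using sumG[of "Suc k"] k by simp
    then have "\<forall>g\<in>G (Suc k). b (Suc k, g) = 0"
      by (rule Gind[of "Suc k", THEN spec[of _ "\<lambda>g. b (Suc k, g)"], THEN mp])
    then have "b (Suc k, snd x) = 0"
      using x k by (auto simp: GG_def)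
    then show ?thesis using k(2) by (metis prod.collapse)
  qed
  have monind: "b M = 0" if zero: "\<And>v. (\<Sum>M\<in>?mons k. b M * ?mon M v) = 0" and M: "M \<in> ?mons k" for k b M
  proof (rule monomials_independent[OF finGG GGd Inv_hp[OF GGI], where Q = invariant and b = b and M = M and k = k])
    show "invariant (\<lambda>v. \<Sum>M\<in>F. b M * ?mon M v)" for F b
      using GGI by (auto simp: invariant_def mon_def Inv_def intro!: sum.cong prod.cong)
    fix k h x v
    assume h: "\<And>x. x \<in> GG \<Longrightarrow> hpz n (k - int (fst x)) (h x) \<and> invariant (h x)"
      and rel: "\<And>i v. i < n \<Longrightarrow> (\<Sum>x\<in>GG. h x v * pd i (snd x) v) = 0" and x: "x \<in> GG"
    show "h x v = 0"
    proof (rule independent_over_Inv[where A = GG and J = "{..<n}" and e = "\<lambda>x. fst x - 1"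
          and p = "\<lambda>x j. pd j (snd x)" and k = "k - 1" and h = h and x = x and v = v])
      \<comment> \<open>Gradients have one degree less than the generators; lowering
        \<open>k\<close> by one too leaves the degrees of the \<open>h x\<close> unchanged.\<close>
      show "hpz n (k - 1 - int (fst x - 1)) (h x) \<and> invariant (h x)" if "x \<in> GG" for x
        using h[OF that] GGd[OF that] by (simp add: of_nat_diff)
      show "hp n (fst x - 1) (pd j (snd x))" if "x \<in> GG" for x j
        by (rule hp_pd[OF Inv_hp[OF GGI[OF that]]])
      show "(\<Sum>x\<in>GG. h x v * pd j (snd x) v) = 0" if "j \<in> {..<n}" for j v
        using rel that by simp
      show "b x = 0"
        if "\<And>j. j \<in> {..<n} \<Longrightarrow> Id k (\<lambda>v. \<Sum>x\<in>{x\<in>GG. fst x - 1 = k}. b x * pd j (snd x) v)"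
          "x \<in> GG" "fst x - 1 = k" for k b x
        using that by (rule grad)
    qed (use finGG x in auto)
  qed (use zero M in auto)

  have mon_mult: "lc (?mons (j + k)) ?mon (\<lambda>v. ?mon M v * ?mon M' v)"
    if "M \<in> ?mons j" "M' \<in> ?mons k" for M M' j k
  proof -
    let ?M = "\<lambda>x. M x + M' x"
    have "?M \<in> ?mons (j + k)"
      using that by (auto simp: mons_def distrib_right sum.distrib)
    moreover have "(\<lambda>v. ?mon M v * ?mon M' v) = ?mon ?M"
      by (simp add: fun_eq_iff mon_def power_add prod.distrib)
    ultimately show ?thesis using lc_base[OF finM] by simp
  qed
  have lc_mon_mult: "lc (?mons (j + k)) ?mon (\<lambda>v. f v * g v)"
    if "lc (?mons j) ?mon f" "lc (?mons k) ?mon g" for j k f g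
    using lc_mult[OF that] mon_mult by blast
  have single: "lc (?mons (fst x)) ?mon (snd x)" if "x \<in> GG" for x
  proof -
    let ?M = "\<lambda>y. of_bool (y = x) :: nat"
    have "(\<Sum>y\<in>GG. ?M y * fst y) = (\<Sum>y\<in>{x}. ?M y * fst y)"
      using finGG that by (intro sum.mono_neutral_right) auto
    then have "?M \<in> ?mons (fst x)" using that by (auto simp: mons_def)
    moreover have "?mon ?M v = snd x v" for v
    proof -
      have "?mon ?M v = (\<Prod>y\<in>{x}. snd y v ^ ?M y)"
        unfolding mon_def using finGG that by (intro prod.mono_neutral_right) auto
      then show ?thesis by simp
    qed
    then have "?mon ?M = snd x" by blast
    ultimately show ?thesis using lc_base[OF finM] by metis
  qed
  have lcDec: "lc (?mons k) ?mon f"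
    if "Dec k f" "\<And>j g. j < k \<Longrightarrow> g \<in> Inv j \<Longrightarrow> lc (?mons j) ?mon g" for k f
    using that
  proof (induction rule: Dec.induct)
    case (Dec_zero k)
    then show ?case by (simp add: lc_zero)
  next
    case (Dec_gen i j g h)
    then show ?case by (intro lc_mon_mult) auto
  next
    case (Dec_add k f g)
    then show ?case by (intro lc_add) auto
  qed
  \<comment> \<open>The generators generate: an invariant is a combination of \<open>G k\<close> up
    to a decomposable part, whose factors have smaller degree, and above \<open>Suc (card P)\<close>
    it is decomposable itself.\<close>
  have S: "lc (?mons k) ?mon f" if "f \<in> Inv k" for k f
    using that
  proof (induction k arbitrary: f rule: less_induct)
    case (less k)
    note lcD = lcDec[OF _ less.IH]
    consider "k = 0" | "1 \<le> k" "k \<le> Suc (card P)" | "Suc (card P) < k" by linarith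
    then show ?case
    proof cases
      case 1
      then obtain b where b: "f = (\<lambda>_. b)" using Inv_0_const[of f] less.prems by blast
      have "(\<lambda>_. 0) \<in> ?mons 0" by (simp add: mons_def)
      from lc_scale[OF lc_base[OF finM this], of ?mon b]
      have "lc (?mons 0) ?mon (\<lambda>v. b * ?mon (\<lambda>_. 0) v)" .
      moreover have "?mon (\<lambda>_. 0) v = 1" for v by (simp add: mon_def)
      ultimately show ?thesis by (simp add: 1 b)
    next
      case 2
      obtain b where b: "Dec k (\<lambda>v. f v - (\<Sum>g\<in>G k. b g * g v))" using Gspan[THEN bspec, OF less.prems] by blast
      have "lc (?mons k) ?mon g" if "g \<in> G k" for g
        using single[of "(k, g)"] that 2 by (simp add: GG_def)
      then have "lc (?mons k) ?mon (\<lambda>v. \<Sum>g\<in>G k. b g * g v)"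
        by (intro lc_sum lc_scale)
      from lc_add[OF lcD[OF b] this] show ?thesis by simp
    next
      case 3
      then show ?thesis using lcD[OF Dec_of_large_degree[OF less.prems]] by blast
    qed
  qed

  obtain e where E: "(\<forall>y\<in>orb. hp n (len y) (e y)) \<and>
     (\<forall>k g. hp n k g \<longrightarrow> (\<exists>b. Id k (\<lambda>v. g v - (\<Sum>y\<in>{y\<in>orb. len y = k}. b y * e y v)))) \<and>
     (\<forall>k b. Id k (\<lambda>v. \<Sum>y\<in>{y\<in>orb. len y = k}. b y * e y v) \<longrightarrow> (\<forall>y\<in>orb. len y = k \<longrightarrow> b y = 0))"
    using coinvariant_basis by (rule exE)
  note e = E[THEN conjunct1, rule_format]
    and espan = E[THEN conjunct2, THEN conjunct1, rule_format]
    and eind = E[THEN conjunct2, THEN conjunct2, rule_format]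
  \<comment> \<open>Indices of the products, of total degree \<open>k\<close>, of a monomial in the
    generators and a coinvariant basis element; these products turn out to be a basis of the forms
    of degree \<open>k\<close>.\<close>
  define I where "I = (\<lambda>k. Sigma {y\<in>orb. len y \<le> k} (\<lambda>y. ?mons (k - len y)))"
  define u where "u = (\<lambda>z v. ?mon (snd z) v * e (fst z) v)"
  have finI: "finite (I k)" for k unfolding I_def using finite_orb finM by auto
  have hpu: "hp n k (u z)" if "z \<in> I k" for z k
  proof -
    have z: "fst z \<in> orb" "len (fst z) \<le> k" "snd z \<in> ?mons (k - len (fst z))"
      using that by (auto simp: I_def)
    have "hp n ((k - len (fst z)) + len (fst z)) (u z)"
      unfolding u_def by (intro hp_mult Inv_hp[OF monI] z e)
    then show ?thesis using z(2) by simp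
  qed
  have umult: "lc (I (j + k)) u (\<lambda>v. g v * f v)" if g: "g \<in> Inv j" and f: "lc (I k) u f" for j k g f
  proof (rule lc_mult[OF S[OF g] f])
    fix M z assume M: "M \<in> ?mons j" and z: "z \<in> I k"
    have z': "fst z \<in> orb" "len (fst z) \<le> k" "snd z \<in> ?mons (k - len (fst z))"
      using z by (auto simp: I_def)
    let ?z = "(fst z, \<lambda>x. M x + snd z x)"
    have "?z \<in> I (j + k)"
      using M z' by (auto simp: I_def mons_def distrib_right sum.distrib)
    moreover have "(\<lambda>v. ?mon M v * u z v) = u ?z"
      by (simp add: u_def fun_eq_iff mon_def power_add prod.distrib mult.assoc)
    ultimately show "lc (I (j + k)) u (\<lambda>v. ?mon M v * u z v)" using lc_base[OF finI] by simp
  qed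
  have lcId: "lc (I k) u f"
    if "Id k f" "\<And>j g. j < k \<Longrightarrow> hp n j g \<Longrightarrow> lc (I j) u g" for k f
    using that
  proof (induction rule: Id.induct)
    case (Id_zero k)
    then show ?case by (simp add: lc_zero)
  next
    case (Id_gen j g m r)
    have "m < j + m" using Id_gen.hyps(1) by simp
    then have "lc (I m) u r" using Id_gen.prems Id_gen.hyps(3) by blast
    then show ?case by (rule umult[OF Id_gen.hyps(2)])
  next
    case (Id_add k f g)
    then show ?case by (intro lc_add) auto
  qed
  have B: "lc (I k) u f" if "hp n k f" for k f
    using that
  proof (induction k arbitrary: f rule: less_induct)
    case (less k)
    obtain b where b: "Id k (\<lambda>v. f v - (\<Sum>y\<in>{y\<in>orb. len y = k}. b y * e y v))"
      using espan[OF less.prems] by blast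
    have "lc (I k) u (e y)" if "y \<in> {y\<in>orb. len y = k}" for y
    proof -
      have "(y, \<lambda>_. 0) \<in> I k" using that by (auto simp: I_def mons_def)
      moreover have "u (y, \<lambda>_. 0) = e y" by (simp add: u_def mon_def fun_eq_iff)
      ultimately show ?thesis using lc_base[OF finI, of "(y, \<lambda>_. 0)" k u] by simp
    qed
    then have "lc (I k) u (\<lambda>v. \<Sum>y\<in>{y\<in>orb. len y = k}. b y * e y v)"
      by (intro lc_sum lc_scale)
    from lc_add[OF lcId[OF b less.IH] this] show ?case by simp
  qed
  have Bind: "indep (I k) u" for k
    unfolding indep_def
  proof (intro allI impI ballI)
    fix b z assume zero: "\<forall>v. (\<Sum>z\<in>I k. b z * u z v) = 0" and z: "z \<in> I k"
    let ?A = "{y\<in>orb. len y \<le> k}"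
    define h where "h = (\<lambda>y v. \<Sum>M\<in>?mons (k - len y). b (y, M) * ?mon M v)"
    have rel: "(\<Sum>y\<in>?A. h y v * e y v) = 0" for v
    proof -
      have "(\<Sum>y\<in>?A. h y v * e y v) = (\<Sum>y\<in>?A. \<Sum>M\<in>?mons (k - len y). b (y, M) * u (y, M) v)"
        by (simp add: h_def u_def sum_distrib_right mult.assoc)
      also have "\<dots> = (\<Sum>z\<in>I k. b z * u z v)"
        unfolding I_def using finite_orb finM by (subst sum.Sigma) (auto intro!: sum.cong)
      finally show ?thesis using zero by simp
    qed
    have hI: "h y \<in> Inv (k - len y)" for y
      unfolding h_def by (intro Inv_sum Inv_scale monI)
    have h0: "h y v = 0" if "y \<in> ?A" for y v
    proof (rule independent_over_Inv[where A = ?A and J = "{()}" and e = len and p = "\<lambda>y _. e y" and k = "int k"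
          and h = h and x = y and v = v])
      show "y \<in> ?A" by (rule that)
      show "finite ?A" using finite_orb by simp
      show "hp n (len y) (e y)" if "y \<in> ?A" for y using e that by simp
      show "hpz n (int k - int (len y)) (h y) \<and> invariant (h y)" if "y \<in> ?A" for y
        using hI[of y] that by (simp add: hpz_def Inv_iff nat_diff_distrib)
      show "(\<Sum>y\<in>?A. h y v * e y v) = 0" for v by (rule rel)
      show "b y = 0" if Id: "\<And>j. j \<in> {()} \<Longrightarrow> Id m (\<lambda>v. \<Sum>y\<in>{y\<in>?A. len y = m}. b y * e y v)"
        and y: "y \<in> ?A" "len y = m" for m b y
      proof -
        have "{y\<in>?A. len y = m} = {y\<in>orb. len y = m}" using y by auto
        then have "Id m (\<lambda>v. \<Sum>y\<in>{y\<in>orb. len y = m}. b y * e y v)" using Id by simp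
        then show ?thesis by (rule eind) (use y in auto)
      qed
    qed
    obtain y M where zy: "z = (y, M)" "y \<in> ?A" "M \<in> ?mons (k - len y)"
      using z by (auto simp: I_def)
    have "b (y, M) = 0"
      by (rule monind[where k = "k - len y" and b = "\<lambda>M. b (y, M)" and M = M])
        (use h0[OF zy(2)] zy(3) in \<open>auto simp: h_def\<close>)
    then show "b z = 0" using zy by simp
  qed
  \<comment> \<open>Two bases of the same space of forms.\<close>
  have card_eq: "card (exps n k) = card (I k)" for k
  proof (rule antisym)
    show "card (exps n k) \<le> card (I k)"
      by (rule card_le_if_indep[OF finite_exps finI coordinate_monomials_indep]) (rule B[OF hp_cmon])
    show "card (I k) \<le> card (exps n k)"
      by (rule card_le_if_indep[OF finI finite_exps Bind]) (rule lc_exps[OF hpu])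
  qed
  define F where "F = Abs_fps (\<lambda>k. real (card (?mons k)))"
  have cardI: "real (card (I k)) = (\<Sum>y\<in>{y\<in>orb. len y \<le> k}. fps_nth F (k - len y))" for k
    unfolding I_def F_def using finite_orb finM by (subst card_SigmaI) auto
  have "Abs_fps (\<lambda>k. real (card (exps n k))) = (\<Sum>y\<in>orb. fps_X ^ len y) * F"
    by (rule fps_ext) (simp add: len_shift_product card_eq cardI)
  moreover have "Abs_fps (\<lambda>k. real (card (exps n k))) * (1 - fps_X) ^ n = 1"
    using mons_hilbert_series[of "{..<n}" "\<lambda>_. Suc 0"] by simp
  moreover have "F * (\<Prod>x\<in>GG. 1 - fps_X ^ fst x) = 1"
    unfolding F_def by (rule mons_hilbert_series[OF finGG GGd])
  ultimately have "(\<Sum>y\<in>orb. fps_X ^ len y) * (1 - fps_X) ^ n = (\<Prod>x\<in>GG. 1 - fps_X ^ fst x :: real fps)"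
    by (metis (no_types, lifting) mult.assoc mult.commute mult.right_neutral)
  \<comment> \<open>Back from power series to polynomials, where evaluation at 1 is
    available.\<close>
  then have "fps_of_poly ((\<Sum>y\<in>orb. [:0, 1:] ^ len y) * (1 - [:0, 1:]) ^ n)
      = fps_of_poly (\<Prod>x\<in>GG. 1 - [:0, 1:] ^ fst x :: real poly)"
    by (simp add: fps_of_poly_mult fps_of_poly_sum fps_of_poly_prod fps_of_poly_power
        fps_of_poly_diff fps_of_poly_fps_X)
  then have eq: "(\<Sum>y\<in>orb. [:0, 1:] ^ len y) * (1 - [:0, 1:]) ^ n = (\<Prod>x\<in>GG. 1 - [:0, 1:] ^ fst x :: real poly)"
    by (simp only: fps_of_poly_eq_iff)
  have "poly (\<Sum>y\<in>orb. [:0, 1:] ^ len y :: real poly) 1 = real (card orb)"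
    by (simp add: poly_sum)
  then have "poly (\<Sum>y\<in>orb. [:0, 1:] ^ len y :: real poly) 1 \<noteq> 0"
    using c_orb finite_orb by auto
  then show ?thesis by (rule poly_factor_cancel[OF _ finGG GGd eq])
qed

text \<open>The first components of \<open>A\<close> are the degrees with multiplicity. A degree
  occurs exactly if it has an indecomposable invariant: a generator is one, and if
  \<open>G k\<close> is empty then every invariant of degree \<open>k\<close> is
  decomposable.\<close>

theorem poincare_polynomial:
  "\<exists>A. finite A \<and> fst ` A = basic_degrees n \<Phi> \<and>
     (\<Sum>y\<in>orb. [:0, 1:] ^ len y) = (\<Prod>x\<in>(A :: (nat \<times> ((nat \<Rightarrow> real) \<Rightarrow> real)) set). \<Sum>j<fst x. [:0, 1:] ^ j :: real poly)"
proof -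
  obtain G where G: "\<And>k. basic_generators k (G k)"
    using basic_generators_exist by metis
  note fin = basic_generatorsD(1)[OF G] and sub = basic_generatorsD(2)[OF G]
    and span = basic_generatorsD(3)[OF G, THEN bspec] and ind = basic_generatorsD(4)[OF G]
  let ?A = "Sigma {1..Suc (card P)} G"
  have "fst ` ?A = basic_degrees n \<Phi>"
  proof (intro equalityI subsetI)
    fix k assume "k \<in> fst ` ?A"
    then obtain g where g: "g \<in> G k" "1 \<le> k" by auto
    have gI: "g \<in> Inv k" using g sub by blast
    have "\<not> Dec k g"
    proof
      assume "Dec k g"
      moreover have "(\<Sum>h\<in>G k. of_bool (h = g) * h v) = g v" for v
      proof -
        have "(\<Sum>h\<in>G k. of_bool (h = g) * h v) = (\<Sum>h\<in>{g}. of_bool (h = g) * h v)"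
          using g fin by (intro sum.mono_neutral_right) auto
        then show ?thesis by simp
      qed
      ultimately have "Dec k (\<lambda>v. \<Sum>h\<in>G k. of_bool (h = g) * h v)" by (simp only:)
      from ind[of k, THEN spec[of _ "\<lambda>h. of_bool (h = g)"], THEN mp, OF this] g(1)
      have "of_bool (g = g) = (0::real)" by (rule bspec)
      then show False by simp
    qed
    then show "k \<in> basic_degrees n \<Phi>"
      unfolding basic_degrees_def inv_polys_eq_Inv using g gI decomposable_iff_Dec[OF gI] by blast
  next
    fix k assume "k \<in> basic_degrees n \<Phi>"
    then obtain f where f: "1 \<le> k" "f \<in> Inv k" "\<not> Dec k f"
      unfolding basic_degrees_def inv_polys_eq_Inv using decomposable_iff_Dec by blast
    have "k \<le> Suc (card P)" using f Dec_of_large_degree[OF f(2)] by linarith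
    moreover have "G k \<noteq> {}"
    proof
      assume "G k = {}"
      then show False using span[OF f(2)] f(3) by simp
    qed
    ultimately show "k \<in> fst ` ?A" using f(1) by force
  qed
  moreover have "finite ?A" using fin by auto
  moreover have "(\<Sum>y\<in>orb. [:0, 1:] ^ len y) = (\<Prod>x\<in>?A. \<Sum>j<fst x. [:0, 1:] ^ j :: real poly)"
    by (rule poincare_polynomial_aux[OF G])
  ultimately show ?thesis by (intro exI[of _ ?A] conjI)
qed

end

section \<open>Statistics whose generating function is a product of q-integers\<close>

lemma pderiv_X_power:
  "poly (pderiv ([:0, 1:] ^ k :: real poly)) 1 = real k"
  "poly (pderiv (pderiv ([:0, 1:] ^ k :: real poly))) 1 = (real k)\<^sup>2 - real k"
proof -
  have m: "[:0, 1:] ^ k = (monom 1 k :: real poly)" by (simp add: monom_altdef)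
  show "poly (pderiv ([:0, 1:] ^ k :: real poly)) 1 = real k"
    by (simp add: m pderiv_monom poly_monom)
  show "poly (pderiv (pderiv ([:0, 1:] ^ k :: real poly))) 1 = (real k)\<^sup>2 - real k"
    unfolding m by (cases k) (simp_all add: pderiv_monom poly_monom power2_eq_square algebra_simps)
qed

lemma pderiv_sum: "pderiv (\<Sum>x\<in>A. p x) = (\<Sum>x\<in>A. pderiv (p x))"
  by (induction A rule: infinite_finite_induct) (simp_all add: pderiv_add)

text \<open>\<open>pmean\<close> and \<open>pvar\<close> are the mean and the variance of the
  distribution with generating function \<open>p / poly p 1\<close>, obtained from derivatives at 1.
  Products correspond to independent sums, so both are additive.\<close>

definition pmean :: "real poly \<Rightarrow> real" where
  "pmean p = poly (pderiv p) 1 / poly p 1"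

definition pvar :: "real poly \<Rightarrow> real" where
  "pvar p = poly (pderiv (pderiv p)) 1 / poly p 1 + pmean p - (pmean p)\<^sup>2"

lemma pmean_mult:
  assumes "poly p 1 \<noteq> 0" "poly q 1 \<noteq> 0"
  shows "pmean (p * q) = pmean p + pmean q"
  using assms by (simp add: pmean_def pderiv_mult field_simps)

lemma pvar_mult:
  assumes "poly p 1 \<noteq> 0" "poly q 1 \<noteq> 0"
  shows "pvar (p * q) = pvar p + pvar q"
proof -
  have "poly (pderiv (pderiv (p * q))) 1 / poly (p * q) 1
      = poly (pderiv (pderiv p)) 1 / poly p 1 + poly (pderiv (pderiv q)) 1 / poly q 1 + 2 * pmean p * pmean q"
    using assms by (simp add: pmean_def pderiv_mult pderiv_add field_simps)
  then show ?thesis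
    unfolding pvar_def pmean_mult[OF assms] by (simp add: power2_sum)
qed

lemma pmean_pvar_prod:
  assumes "finite A" "\<And>x. x \<in> A \<Longrightarrow> poly (p x) 1 \<noteq> 0"
  shows "pmean (\<Prod>x\<in>A. p x) = (\<Sum>x\<in>A. pmean (p x))" "pvar (\<Prod>x\<in>A. p x) = (\<Sum>x\<in>A. pvar (p x))"
proof -
  have "pmean (\<Prod>x\<in>A. p x) = (\<Sum>x\<in>A. pmean (p x)) \<and> pvar (\<Prod>x\<in>A. p x) = (\<Sum>x\<in>A. pvar (p x))"
    using assms
  proof (induction A rule: finite_induct)
    case empty
    then show ?case by (simp add: pvar_def pmean_def pderiv_1)
  next
    case (insert x A)
    have "poly (\<Prod>x\<in>A. p x) 1 \<noteq> 0" using insert by (simp add: poly_prod)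
    then show ?case
      using insert pmean_mult[of "p x" "\<Prod>x\<in>A. p x"] pvar_mult[of "p x" "\<Prod>x\<in>A. p x"] by simp
  qed
  then show "pmean (\<Prod>x\<in>A. p x) = (\<Sum>x\<in>A. pmean (p x))" "pvar (\<Prod>x\<in>A. p x) = (\<Sum>x\<in>A. pvar (p x))"
    by blast+
qed

lemma pmean_pvar_smult:
  assumes "k \<noteq> 0"
  shows "pmean (smult k p) = pmean p" "pvar (smult k p) = pvar p"
  using assms by (simp_all add: pmean_def pvar_def pderiv_smult)

lemma pmean_pvar_gf:
  assumes "finite W" "W \<noteq> {}"
  shows "pmean (\<Sum>w\<in>W. [:0, 1:] ^ N w) = (\<Sum>w\<in>W. real (N w)) / card W"
    and "pvar (\<Sum>w\<in>W. [:0, 1:] ^ N w) = (\<Sum>w\<in>W. (real (N w))\<^sup>2) / card W - ((\<Sum>w\<in>W. real (N w)) / card W)\<^sup>2"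
proof -
  have 1: "poly (\<Sum>w\<in>W. [:0, 1:] ^ N w) 1 = real (card W)" by (simp add: poly_sum)
  have 2: "poly (pderiv (\<Sum>w\<in>W. [:0, 1:] ^ N w)) 1 = (\<Sum>w\<in>W. real (N w))"
    by (simp add: pderiv_sum poly_sum pderiv_X_power)
  have 3: "poly (pderiv (pderiv (\<Sum>w\<in>W. [:0, 1:] ^ N w))) 1 = (\<Sum>w\<in>W. (real (N w))\<^sup>2) - (\<Sum>w\<in>W. real (N w))"
    by (simp add: pderiv_sum poly_sum pderiv_X_power sum_subtractf)
  show m: "pmean (\<Sum>w\<in>W. [:0, 1:] ^ N w) = (\<Sum>w\<in>W. real (N w)) / card W"
    by (simp only: pmean_def 1 2)
  show "pvar (\<Sum>w\<in>W. [:0, 1:] ^ N w) = (\<Sum>w\<in>W. (real (N w))\<^sup>2) / card W - ((\<Sum>w\<in>W. real (N w)) / card W)\<^sup>2"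
    by (simp only: pvar_def m 1 3) (simp add: diff_divide_distrib)
qed

lemma sum_nat_real:
  "(\<Sum>j<d. real j) = real d * (real d - 1) / 2"
  "(\<Sum>j<d. (real j)\<^sup>2) = real d * (real d - 1) * (2 * real d - 1) / 6"
  by (induction d) (simp_all add: field_simps power2_eq_square)

lemma pmean_pvar_q_integer:
  assumes "d \<ge> 1"
  shows "pmean (\<Sum>j<d. [:0, 1:] ^ j) = (real d - 1) / 2"
    and "pvar (\<Sum>j<d. [:0, 1:] ^ j) = ((real d)\<^sup>2 - 1) / 12"
proof -
  have ne: "{..<d} \<noteq> {}" "real d \<noteq> 0" using assms by (auto simp: lessThan_empty_iff)
  show "pmean (\<Sum>j<d. [:0, 1:] ^ j) = (real d - 1) / 2"
    using ne by (simp add: pmean_pvar_gf[of "{..<d}"] sum_nat_real)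
  have "(\<Sum>j<d. (real j)\<^sup>2) / real d = (real d - 1) * (2 * real d - 1) / 6"
    "(\<Sum>j<d. real j) / real d = (real d - 1) / 2"
    using ne by (simp_all add: sum_nat_real)
  moreover have "pvar (\<Sum>j<d. [:0, 1:] ^ j) = (\<Sum>j<d. (real j)\<^sup>2) / real d - ((\<Sum>j<d. real j) / real d)\<^sup>2"
    using pmean_pvar_gf(2)[of "{..<d}" "\<lambda>j. j"] ne by simp
  ultimately have "pvar (\<Sum>j<d. [:0, 1:] ^ j) = (real d - 1) * (2 * real d - 1) / 6 - ((real d - 1) / 2)\<^sup>2"
    by (simp only:)
  then show "pvar (\<Sum>j<d. [:0, 1:] ^ j) = ((real d)\<^sup>2 - 1) / 12"
    by (simp add: field_simps power2_eq_square)
qed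

section \<open>Characteristic functions of centred uniform variables\<close>

lemma map_poly_of_real_mult:
  "map_poly complex_of_real (p * q) = map_poly complex_of_real p * map_poly complex_of_real q"
  by (rule poly_eqI) (simp add: coeff_map_poly coeff_mult)

lemma map_poly_of_real_add:
  "map_poly complex_of_real (p + q) = map_poly complex_of_real p + map_poly complex_of_real q"
  by (rule poly_eqI) (simp add: coeff_map_poly)

lemma map_poly_of_real_1: "map_poly complex_of_real 1 = 1"
  by (rule poly_eqI) (simp add: coeff_map_poly)

lemma map_poly_of_real_sum:
  "map_poly complex_of_real (\<Sum>x\<in>A. p x) = (\<Sum>x\<in>A. map_poly complex_of_real (p x))"
  by (induction A rule: infinite_finite_induct) (simp_all add: map_poly_of_real_add)

lemma map_poly_of_real_prod:
  "map_poly complex_of_real (\<Prod>x\<in>A. p x) = (\<Prod>x\<in>A. map_poly complex_of_real (p x))"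
  by (induction A rule: infinite_finite_induct) (simp_all add: map_poly_of_real_mult map_poly_of_real_1)

lemma map_poly_of_real_X_power: "map_poly complex_of_real ([:0, 1:] ^ k) = [:0, 1:] ^ k"
  by (induction k) (simp_all add: map_poly_of_real_mult map_poly_of_real_1 map_poly_pCons)

text \<open>The characteristic function of a uniform variable on \<open>{0..<d}\<close> minus its
  mean.\<close>

definition psi :: "nat \<Rightarrow> real \<Rightarrow> complex" where
  "psi d u = (\<Sum>j<d. iexp (u * (real j - (real d - 1) / 2))) / of_nat d"

lemma cmod_average_le:
  fixes f :: "'w \<Rightarrow> complex"
  assumes "finite W" "W \<noteq> {}"
  shows "cmod ((\<Sum>w\<in>W. f w) / of_nat (card W)) \<le> (\<Sum>w\<in>W. cmod (f w)) / card W"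
  by (simp add: norm_divide divide_right_mono norm_sum)

lemma norm_psi_le: "d \<ge> 1 \<Longrightarrow> cmod (psi d u) \<le> 1"
  using cmod_average_le[of "{..<d}" "\<lambda>j. iexp (u * (real j - (real d - 1) / 2))"]
  by (simp add: psi_def lessThan_empty_iff)

lemma centred_sums:
  assumes "d \<ge> 1"
  shows "(\<Sum>j<d. real j - (real d - 1) / 2) = 0"
    and "(\<Sum>j<d. (real j - (real d - 1) / 2)\<^sup>2) = real d * (((real d)\<^sup>2 - 1) / 12)"
proof -
  show "(\<Sum>j<d. real j - (real d - 1) / 2) = 0"
    by (simp add: sum_subtractf sum_nat_real)
  have "(\<Sum>j<d. (real j - (real d - 1) / 2)\<^sup>2)
      = (\<Sum>j<d. (real j)\<^sup>2 - (real d - 1) * real j + ((real d - 1) / 2)\<^sup>2)"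
    by (rule sum.cong) (simp_all add: power2_eq_square field_simps)
  also have "\<dots> = (\<Sum>j<d. (real j)\<^sup>2) - (real d - 1) * (\<Sum>j<d. real j) + real d * ((real d - 1) / 2)\<^sup>2"
    by (simp only: sum.distrib sum_subtractf sum_distrib_left[symmetric] sum_constant card_lessThan)
  also have "\<dots> = real d * (((real d)\<^sup>2 - 1) / 12)"
    by (simp only: sum_nat_real) (simp add: power2_eq_square field_simps)
  finally show "(\<Sum>j<d. (real j - (real d - 1) / 2)\<^sup>2) = real d * (((real d)\<^sup>2 - 1) / 12)" .
qed

text \<open>Second-order Taylor expansion under the average: the centred values \<open>y\<close>
  have mean 0 and variance \<open>v\<close>. As \<open>\<bar>y\<bar> \<le> d / 2\<close>, the
  remainder \<open>\<bar>u * y\<bar> ^ 3 / 6\<close> is at most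
  \<open>\<bar>u\<bar> ^ 3 * d / 12 * y\<^sup>2\<close>; keeping \<open>y\<^sup>2\<close> puts the
  factor \<open>v\<close> into the bound, which can then be summed over the degrees.\<close>

lemma psi_approx:
  assumes d: "d \<ge> 1"
  defines "v \<equiv> ((real d)\<^sup>2 - 1) / 12"
  shows "cmod (psi d u - of_real (1 - u\<^sup>2 * v / 2)) \<le> \<bar>u\<bar> ^ 3 * real d * v / 12"
proof -
  let ?y = "\<lambda>j. real j - (real d - 1) / 2"
    and ?R = "\<lambda>x. iexp x - (1 + \<i> * of_real x - of_real (x\<^sup>2 / 2))"
  have d0: "real d > 0" using d by simp
  have ne: "{..<d} \<noteq> {}" using d by (auto simp: lessThan_empty_iff)
  have taylor: "(\<Sum>k\<le>2. (\<i> * complex_of_real x) ^ k / fact k) = 1 + \<i> * of_real x - of_real (x\<^sup>2 / 2)" for x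
  proof -
    have "(\<Sum>k\<le>2. f k) = f 0 + f 1 + f (2::nat)" for f :: "nat \<Rightarrow> complex"
      by (simp add: numeral_2_eq_2)
    then show ?thesis by (simp only:) (simp add: power_mult_distrib)
  qed
  have T: "(\<Sum>j<d. 1 + \<i> * of_real (u * ?y j) - of_real ((u * ?y j)\<^sup>2 / 2))
      = of_nat d * of_real (1 - u\<^sup>2 * v / 2)"
  proof -
    have gen: "(\<Sum>j<d. 1 + \<i> * of_real (u * y j) - of_real ((u * y j)\<^sup>2 / 2))
        = of_nat d + \<i> * of_real (u * (\<Sum>j<d. y j)) - of_real (u\<^sup>2 / 2 * (\<Sum>j<d. (y j)\<^sup>2))"
      for y :: "nat \<Rightarrow> real"
      by (simp add: sum_subtractf sum.distrib sum_distrib_left power_mult_distrib)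
    have "(\<Sum>j<d. 1 + \<i> * of_real (u * ?y j) - of_real ((u * ?y j)\<^sup>2 / 2))
        = of_nat d + \<i> * of_real (u * (\<Sum>j<d. ?y j)) - of_real (u\<^sup>2 / 2 * (\<Sum>j<d. (?y j)\<^sup>2))"
      by (rule gen)
    also have "\<dots> = of_nat d * of_real (1 - u\<^sup>2 * v / 2)"
      unfolding centred_sums[OF d] v_def[symmetric] by (simp add: algebra_simps)
    finally show ?thesis .
  qed
  have third_order: "cmod (?R x) \<le> \<bar>x\<bar> ^ 3 / 6" for x
  proof -
    have "cmod (?R x) \<le> \<bar>x\<bar> ^ Suc 2 / fact (Suc 2)"
      using iexp_approx1[of x 2] unfolding taylor .
    also have "\<bar>x\<bar> ^ Suc 2 / fact (Suc 2) = \<bar>x\<bar> ^ 3 / 6"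
      by (simp add: eval_nat_numeral)
    finally show ?thesis .
  qed
  have eq: "psi d u - of_real (1 - u\<^sup>2 * v / 2)
      = (\<Sum>j<d. ?R (u * ?y j)) / of_nat d"
    using d0 by (simp only: psi_def sum_subtractf[of "\<lambda>j. iexp (u * ?y j)"] T) (simp add: field_simps)
  have "cmod (psi d u - of_real (1 - u\<^sup>2 * v / 2)) \<le> (\<Sum>j<d. cmod (?R (u * ?y j))) / real d"
    unfolding eq using cmod_average_le[OF finite_lessThan ne] unfolding card_lessThan .
  also have "\<dots> \<le> (\<Sum>j<d. \<bar>u\<bar> ^ 3 * (real d / 2) * (?y j)\<^sup>2 / 6) / real d"
  proof (intro divide_right_mono sum_mono)
    fix j assume j: "j \<in> {..<d}"
    have "cmod (?R (u * ?y j))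
        \<le> \<bar>u * ?y j\<bar> ^ 3 / 6"
      by (rule third_order)
    also have "\<dots> = \<bar>u\<bar> ^ 3 * \<bar>?y j\<bar> * (?y j)\<^sup>2 / 6"
    proof -
      have "\<bar>u * y\<bar> ^ 3 / 6 = \<bar>u\<bar> ^ 3 * \<bar>y\<bar> * \<bar>y\<bar>\<^sup>2 / 6" for y
        by (simp add: abs_mult power_mult_distrib power3_eq_cube power2_eq_square del: abs_mult_self_eq)
      then show ?thesis unfolding power2_abs .
    qed
    also have "\<dots> \<le> \<bar>u\<bar> ^ 3 * (real d / 2) * (?y j)\<^sup>2 / 6"
      using j by (intro divide_right_mono mult_right_mono mult_left_mono) (auto simp: abs_if field_simps)
    finally show "cmod (?R (u * ?y j))
        \<le> \<bar>u\<bar> ^ 3 * (real d / 2) * (?y j)\<^sup>2 / 6" .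
  qed simp
  also have "\<dots> = \<bar>u\<bar> ^ 3 * (real d / 2) / 6 * (\<Sum>j<d. (?y j)\<^sup>2) / real d"
    by (simp add: sum_distrib_left sum_divide_distrib)
  also have "\<dots> = \<bar>u\<bar> ^ 3 * real d * v / 12"
    using d0 by (simp only: centred_sums[OF d] v_def) (simp add: field_simps)
  finally show ?thesis .
qed

lemma exp_minus_approx:
  fixes x :: real
  assumes "x \<ge> 0"
  shows "\<bar>exp (- x) - (1 - x)\<bar> \<le> x\<^sup>2"
proof -
  have "1 - x \<le> exp (- x)" using exp_ge_add_one_self[of "- x"] by simp
  moreover have "exp (- x) \<le> 1 - x + x\<^sup>2"
  proof -
    have "exp (- x) = inverse (exp x)" by (rule exp_minus)
    also have "\<dots> \<le> inverse (1 + x)"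
      using assms exp_ge_add_one_self[of x] by (intro le_imp_inverse_le) auto
    also have "\<dots> \<le> 1 - x + x\<^sup>2"
    proof -
      have "1 \<le> (1 - x + x\<^sup>2) * (1 + x)"
        using assms by (simp add: algebra_simps power2_eq_square)
      then show ?thesis using assms by (simp add: inverse_eq_divide pos_divide_le_eq)
    qed
    finally show ?thesis .
  qed
  ultimately show ?thesis by simp
qed

text \<open>All factors have modulus at most 1, so the products differ by at most the sum of the
  differences of their factors. Replacing \<open>exp\<close> by its linear part costs
  \<open>u ^ 4 / 4\<close> times the square of \<open>V x\<close>; bounding one of the two
  \<open>V x\<close> by \<open>D\<^sup>2 / 12\<close> gives the 48.\<close>

lemma prod_psi_approx:
  assumes A: "finite A" and d: "\<And>x. x \<in> A \<Longrightarrow> 1 \<le> d x" "\<And>x. x \<in> A \<Longrightarrow> d x \<le> D"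
  defines "v \<equiv> \<Sum>x\<in>A. ((real (d x))\<^sup>2 - 1) / 12"
  shows "cmod ((\<Prod>x\<in>A. psi (d x) u) - of_real (exp (- (u\<^sup>2 * v / 2))))
       \<le> \<bar>u\<bar> ^ 3 * real D * v / 12 + u ^ 4 * (real D)\<^sup>2 * v / 48"
proof -
  define V where "V = (\<lambda>x. ((real (d x))\<^sup>2 - 1) / 12)"
  have V0: "V x \<ge> 0" if "x \<in> A" for x
    using d(1)[OF that] by (simp add: V_def)
  have VD: "V x \<le> (real D)\<^sup>2 / 12" if "x \<in> A" for x
  proof -
    have "(real (d x))\<^sup>2 \<le> (real D)\<^sup>2" using d(2)[OF that] by (intro power_mono) auto
    then have "(real (d x))\<^sup>2 - 1 \<le> (real D)\<^sup>2" by linarith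
    then show ?thesis unfolding V_def by (rule divide_right_mono) simp
  qed
  have v: "v = (\<Sum>x\<in>A. V x)" by (simp add: v_def V_def)
  have "exp (- (u\<^sup>2 * v / 2)) = (\<Prod>x\<in>A. exp (- (u\<^sup>2 * V x / 2)))"
    unfolding v using A by (simp add: exp_sum sum_negf sum_distrib_left sum_divide_distrib flip: exp_sum)
  then have "cmod ((\<Prod>x\<in>A. psi (d x) u) - of_real (exp (- (u\<^sup>2 * v / 2))))
      = cmod ((\<Prod>x\<in>A. psi (d x) u) - (\<Prod>x\<in>A. of_real (exp (- (u\<^sup>2 * V x / 2)))))"
    by simp
  also have "\<dots> \<le> (\<Sum>x\<in>A. cmod (psi (d x) u - of_real (exp (- (u\<^sup>2 * V x / 2)))))"
    using V0 d(1) by (intro norm_prod_diff norm_psi_le) (auto simp: norm_of_real)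
  also have "\<dots> \<le> (\<Sum>x\<in>A. (\<bar>u\<bar> ^ 3 * real D / 12 + u ^ 4 * (real D)\<^sup>2 / 48) * V x)"
  proof (rule sum_mono)
    fix x assume x: "x \<in> A"
    have "cmod (psi (d x) u - of_real (exp (- (u\<^sup>2 * V x / 2))))
        \<le> cmod (psi (d x) u - of_real (1 - u\<^sup>2 * V x / 2))
          + cmod (of_real (1 - u\<^sup>2 * V x / 2) - of_real (exp (- (u\<^sup>2 * V x / 2))))"
      using norm_triangle_ineq[of "psi (d x) u - of_real (1 - u\<^sup>2 * V x / 2)"
          "of_real (1 - u\<^sup>2 * V x / 2) - of_real (exp (- (u\<^sup>2 * V x / 2)))"] by simp
    also have "cmod (psi (d x) u - of_real (1 - u\<^sup>2 * V x / 2)) \<le> \<bar>u\<bar> ^ 3 * real (d x) * V x / 12"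
      unfolding V_def by (rule psi_approx[OF d(1)[OF x]])
    also have "\<dots> \<le> \<bar>u\<bar> ^ 3 * real D * V x / 12"
      using d(2)[OF x] V0[OF x] by (intro divide_right_mono mult_right_mono mult_left_mono) auto
    also have "cmod (of_real (1 - u\<^sup>2 * V x / 2) - of_real (exp (- (u\<^sup>2 * V x / 2))))
        = \<bar>exp (- (u\<^sup>2 * V x / 2)) - (1 - u\<^sup>2 * V x / 2)\<bar>"
      unfolding of_real_diff[symmetric] norm_of_real by simp
    also have "\<dots> \<le> (u\<^sup>2 * V x / 2)\<^sup>2"
      using V0[OF x] by (intro exp_minus_approx) simp
    also have "\<dots> = u ^ 4 / 4 * V x * V x"
      by (simp add: power2_eq_square eval_nat_numeral)
    also have "\<dots> \<le> u ^ 4 / 4 * ((real D)\<^sup>2 / 12) * V x"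
      using V0[OF x] VD[OF x] by (intro mult_right_mono mult_left_mono) auto
    finally show "cmod (psi (d x) u - of_real (exp (- (u\<^sup>2 * V x / 2))))
        \<le> (\<bar>u\<bar> ^ 3 * real D / 12 + u ^ 4 * (real D)\<^sup>2 / 48) * V x"
      by (simp add: algebra_simps)
  qed
  also have "\<dots> = \<bar>u\<bar> ^ 3 * real D * v / 12 + u ^ 4 * (real D)\<^sup>2 * v / 48"
    unfolding v sum_distrib_left[symmetric] by (simp add: algebra_simps)
  finally show ?thesis .
qed

lemma iexp_power: "iexp (u * real j) = iexp u ^ j"
  by (simp add: exp_of_nat_mult[symmetric] ac_simps)

lemma psi_eq: "psi d u = iexp (- (u * ((real d - 1) / 2))) * (\<Sum>j<d. iexp u ^ j) / of_nat d"
proof -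
  have "iexp (u * (real j - (real d - 1) / 2)) = iexp (- (u * ((real d - 1) / 2))) * iexp u ^ j" for j
    unfolding iexp_power[symmetric] by (simp add: exp_add[symmetric] algebra_simps)
  then show ?thesis by (simp add: psi_def sum_distrib_left)
qed

text \<open>The numerator is a full sum of powers of a \<open>d\<close>-th root of unity, which
  differs from 1 as \<open>d \<ge> 2\<close>.\<close>

lemma psi_zero:
  assumes "d \<ge> 2"
  shows "psi d (2 * pi / real d) = 0"
proof -
  let ?z = "iexp (2 * pi / real d)"
  have "?z ^ d = iexp (2 * pi)"
    unfolding iexp_power[symmetric] using assms by simp
  moreover have "iexp (2 * pi) = 1"
    by (simp only: cis_conv_exp[symmetric] cis_2pi)
  ultimately have 1: "?z ^ d = 1" by simp
  have "?z \<noteq> 1"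
  proof
    assume "?z = 1"
    then obtain m :: int where "2 * pi / real d = of_int (2 * m) * pi"
      unfolding exp_eq_1 by auto
    then have m: "1 = real_of_int m * real d" using assms by (simp add: field_simps)
    then have "real_of_int (m * int d) = real_of_int 1" by simp
    then have "m * int d = 1" by (simp only: of_int_eq_iff)
    then have "int d dvd 1" by (metis dvd_triv_right)
    then show False using assms by simp
  qed
  then have "(\<Sum>j<d. ?z ^ j) = 0" using 1 by (simp add: geometric_sum)
  then show ?thesis by (simp add: psi_eq)
qed

text \<open>\<open>\<kappa>\<close> makes room for the stabilizer of \<open>c\<close>: the sum over
  the group is that multiple of the sum over the orbit.\<close>

locale q_integer_statistic =
  fixes W :: "'w set" and N :: "'w \<Rightarrow> nat" and A :: "'x set" and d :: "'x \<Rightarrow> nat" and \<kappa> :: real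
  assumes finite_W: "finite W" and W_nonempty: "W \<noteq> {}"
    and finite_A: "finite A" and d_ge_1: "\<And>x. x \<in> A \<Longrightarrow> d x \<ge> 1"
    and gf: "(\<Sum>w\<in>W. [:0, 1:] ^ N w) = smult \<kappa> (\<Prod>x\<in>A. \<Sum>j<d x. [:0, 1:] ^ j :: real poly)"
begin

definition \<mu> :: real where "\<mu> = (\<Sum>x\<in>A. (real (d x) - 1) / 2)"

definition v :: real where "v = (\<Sum>x\<in>A. ((real (d x))\<^sup>2 - 1) / 12)"

definition X :: "real pmf" where "X = map_pmf (\<lambda>w. real (N w)) (pmf_of_set W)"

definition Z :: "real measure" where
  "Z = distr (measure_pmf X) borel (\<lambda>x. (x - \<mu>) / sqrt v)"

lemma card_W: "real (card W) = \<kappa> * (\<Prod>x\<in>A. real (d x))"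
  using arg_cong[OF gf, of "\<lambda>p. poly p 1"] by (simp add: poly_sum poly_prod)

lemma card_W_pos: "card W > 0"
  using finite_W W_nonempty by (simp add: card_gt_0_iff)

lemma kappa_nz: "\<kappa> \<noteq> 0"
  using card_W card_W_pos by auto

lemma expectation_X:
  fixes f :: "real \<Rightarrow> 'b :: {banach, second_countable_topology}"
  shows "measure_pmf.expectation X f = (1 / real (card W)) *\<^sub>R (\<Sum>w\<in>W. f (real (N w)))"
proof -
  have "measure_pmf.expectation X f = measure_pmf.expectation (pmf_of_set W) (\<lambda>w. f (real (N w)))"
    by (simp add: X_def)
  also have "\<dots> = (\<Sum>w\<in>W. pmf (pmf_of_set W) w *\<^sub>R f (real (N w)))"
    using finite_W W_nonempty by (intro integral_measure_pmf) auto
  also have "\<dots> = (\<Sum>w\<in>W. (1 / real (card W)) *\<^sub>R f (real (N w)))"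
    using finite_W W_nonempty by (intro sum.cong) (auto simp: pmf_of_set)
  finally show ?thesis by (simp only: scaleR_sum_right)
qed

lemma moments: "(\<Sum>w\<in>W. real (N w)) / card W = \<mu>"
  "(\<Sum>w\<in>W. (real (N w))\<^sup>2) / card W - \<mu>\<^sup>2 = v"
proof -
  have nz: "poly (\<Sum>j<d x. [:0, 1:] ^ j) 1 \<noteq> (0 :: real)" if "x \<in> A" for x
    using d_ge_1[OF that] by (simp add: poly_sum)
  have m: "pmean (\<Sum>w\<in>W. [:0, 1:] ^ N w) = \<mu>"
  proof -
    have "pmean (\<Prod>x\<in>A. \<Sum>j<d x. [:0, 1:] ^ j) = (\<Sum>x\<in>A. pmean (\<Sum>j<d x. [:0, 1:] ^ j))"
      by (rule pmean_pvar_prod(1)[OF finite_A nz])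
    also have "\<dots> = \<mu>"
      unfolding \<mu>_def by (intro sum.cong pmean_pvar_q_integer(1) d_ge_1) simp_all
    finally show ?thesis unfolding gf pmean_pvar_smult[OF kappa_nz] .
  qed
  have s: "pvar (\<Sum>w\<in>W. [:0, 1:] ^ N w) = v"
  proof -
    have "pvar (\<Prod>x\<in>A. \<Sum>j<d x. [:0, 1:] ^ j) = (\<Sum>x\<in>A. pvar (\<Sum>j<d x. [:0, 1:] ^ j))"
      by (rule pmean_pvar_prod(2)[OF finite_A nz])
    also have "\<dots> = v"
      unfolding v_def by (intro sum.cong pmean_pvar_q_integer(2) d_ge_1) simp_all
    finally show ?thesis unfolding gf pmean_pvar_smult[OF kappa_nz] .
  qed
  show "(\<Sum>w\<in>W. real (N w)) / card W = \<mu>"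
    using m pmean_pvar_gf(1)[OF finite_W W_nonempty, of N] by simp
  then show "(\<Sum>w\<in>W. (real (N w))\<^sup>2) / card W - \<mu>\<^sup>2 = v"
    using s pmean_pvar_gf(2)[OF finite_W W_nonempty, of N] by simp
qed

lemma mean_X: "measure_pmf.expectation X (\<lambda>y. y) = \<mu>"
  using moments(1) by (simp add: expectation_X)

lemma centred_square: "(\<Sum>w\<in>W. (real (N w) - \<mu>)\<^sup>2) / card W = v"
proof -
  have "(\<Sum>w\<in>W. (real (N w) - \<mu>)\<^sup>2) = (\<Sum>w\<in>W. (real (N w))\<^sup>2 - 2 * \<mu> * real (N w) + \<mu>\<^sup>2)"
    by (rule sum.cong) (simp_all add: power2_diff)
  also have "\<dots> = (\<Sum>w\<in>W. (real (N w))\<^sup>2) - 2 * \<mu> * (\<Sum>w\<in>W. real (N w)) + real (card W) * \<mu>\<^sup>2"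
    by (simp only: sum.distrib sum_subtractf sum_distrib_left[symmetric] sum_constant)
  also have "\<dots> / card W = (\<Sum>w\<in>W. (real (N w))\<^sup>2) / card W - 2 * \<mu> * ((\<Sum>w\<in>W. real (N w)) / card W) + \<mu>\<^sup>2"
    using card_W_pos by (simp add: add_divide_distrib diff_divide_distrib)
  also have "\<dots> = v"
    using moments(2) by (simp only: moments(1)) (simp add: power2_eq_square)
  finally show ?thesis .
qed

lemma variance_X: "measure_pmf.variance X (\<lambda>y. y) = v"
  unfolding mean_X using centred_square by (simp add: expectation_X)

lemma char_Z_sum: "char Z t = (\<Sum>w\<in>W. iexp (t * ((real (N w) - \<mu>) / sqrt v))) / of_nat (card W)"
proof -
  have "char Z t = measure_pmf.expectation X (\<lambda>x. iexp (t * ((x - \<mu>) / sqrt v)))"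
    unfolding char_def Z_def by (subst integral_distr) auto
  then show ?thesis
    by (simp add: expectation_X scaleR_conv_of_real)
qed

lemma gf_complex:
  fixes z :: complex
  shows "(\<Sum>w\<in>W. z ^ N w) = of_real \<kappa> * (\<Prod>x\<in>A. \<Sum>j<d x. z ^ j)"
proof -
  have "smult \<kappa> p = [:\<kappa>:] * p" for p by simp
  then have "poly (map_poly complex_of_real (\<Sum>w\<in>W. [:0, 1:] ^ N w)) z
      = poly (map_poly complex_of_real ([:\<kappa>:] * (\<Prod>x\<in>A. \<Sum>j<d x. [:0, 1:] ^ j))) z"
    by (simp only: gf)
  then show ?thesis
    unfolding map_poly_of_real_mult map_poly_of_real_sum map_poly_of_real_prod map_poly_of_real_X_power
    by (simp add: poly_sum poly_prod map_poly_pCons)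
qed

lemma char_Z: "char Z t = (\<Prod>x\<in>A. psi (d x) (t / sqrt v))"
proof -
  define u where "u = t / sqrt v"
  have "iexp (t * ((real (N w) - \<mu>) / sqrt v)) = iexp (- (u * \<mu>)) * iexp u ^ N w" for w
    unfolding iexp_power[symmetric] u_def
    by (simp add: exp_add[symmetric] diff_divide_distrib right_diff_distrib algebra_simps)
  then have "char Z t = iexp (- (u * \<mu>)) * (\<Sum>w\<in>W. iexp u ^ N w) / of_nat (card W)"
    by (simp add: char_Z_sum sum_distrib_left)
  also have "\<dots> = iexp (- (u * \<mu>)) * (of_real \<kappa> * (\<Prod>x\<in>A. \<Sum>j<d x. iexp u ^ j)) / of_real (real (card W))"
    by (simp only: gf_complex of_real_of_nat_eq)
  also have "\<dots> = iexp (- (u * \<mu>)) * (\<Prod>x\<in>A. \<Sum>j<d x. iexp u ^ j) / (\<Prod>x\<in>A. of_nat (d x))"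
    using kappa_nz by (simp add: card_W)
  also have "iexp (- (u * \<mu>)) = (\<Prod>x\<in>A. iexp (- (u * ((real (d x) - 1) / 2))))"
    using finite_A by (simp add: exp_sum[symmetric] \<mu>_def sum_distrib_left sum_negf[symmetric])
  also have "\<dots> * (\<Prod>x\<in>A. \<Sum>j<d x. iexp u ^ j) / (\<Prod>x\<in>A. of_nat (d x)) = (\<Prod>x\<in>A. psi (d x) u)"
    by (simp add: psi_eq prod.distrib prod_dividef)
  finally show ?thesis by (simp add: u_def)
qed

text \<open>The Lipschitz constant is the first absolute moment, at most \<open>(1 + 1) / 2\<close>
  because the second moment is 1. That it is the same for all groups is what the converse of the
  limit theorem needs.\<close>

lemma char_Z_lipschitz:
  assumes "v > 0"
  shows "cmod (char Z s - char Z t) \<le> \<bar>s - t\<bar>"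
proof -
  let ?z = "\<lambda>w. (real (N w) - \<mu>) / sqrt v"
  have lip: "cmod (iexp a - iexp b) \<le> \<bar>a - b\<bar>" for a b
  proof -
    have "iexp a - iexp b = iexp b * (iexp (a - b) - 1)"
      by (simp add: right_diff_distrib exp_add[symmetric])
    then show ?thesis
      using iexp_approx1[of "a - b" 0] by (simp add: norm_mult)
  qed
  have lip': "cmod (iexp (s * z) - iexp (t * z)) \<le> \<bar>s - t\<bar> * \<bar>z\<bar>" for z
    using lip[of "s * z" "t * z"] by (simp only: left_diff_distrib[symmetric] abs_mult)
  have am: "\<bar>y\<bar> \<le> (1 + y\<^sup>2) / 2" for y :: real
  proof -
    have "0 \<le> (\<bar>y\<bar> - 1)\<^sup>2" by (rule zero_le_power2)
    moreover have "(\<bar>y\<bar> - 1)\<^sup>2 = \<bar>y\<bar>\<^sup>2 + 1\<^sup>2 - 2 * \<bar>y\<bar> * 1"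
      by (rule power2_diff)
    ultimately have "0 \<le> y\<^sup>2 + 1 - 2 * \<bar>y\<bar>"
      by (simp only: power2_abs one_power2 mult_1_right)
    then show ?thesis by (simp add: field_simps)
  qed
  have sq: "(\<Sum>w\<in>W. (?z w)\<^sup>2) = real (card W)"
    using centred_square assms card_W_pos by (simp add: power_divide sum_divide_distrib[symmetric] field_simps)
  have eq: "char Z s - char Z t = (\<Sum>w\<in>W. iexp (s * ?z w) - iexp (t * ?z w)) / of_nat (card W)"
    by (simp add: char_Z_sum sum_subtractf diff_divide_distrib)
  have "cmod (char Z s - char Z t) \<le> (\<Sum>w\<in>W. cmod (iexp (s * ?z w) - iexp (t * ?z w))) / card W"
    unfolding eq by (rule cmod_average_le[OF finite_W W_nonempty])
  also have "\<dots> \<le> (\<Sum>w\<in>W. \<bar>s - t\<bar> * ((1 + (?z w)\<^sup>2) / 2)) / card W"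
  proof (intro divide_right_mono sum_mono)
    fix w assume "w \<in> W"
    have "\<bar>?z w\<bar> \<le> (1 + (?z w)\<^sup>2) / 2" by (rule am)
    then have "\<bar>s - t\<bar> * \<bar>?z w\<bar> \<le> \<bar>s - t\<bar> * ((1 + (?z w)\<^sup>2) / 2)"
      by (rule mult_left_mono) simp
    then show "cmod (iexp (s * ?z w) - iexp (t * ?z w)) \<le> \<bar>s - t\<bar> * ((1 + (?z w)\<^sup>2) / 2)"
      using lip'[of "?z w"] by (rule order_trans[rotated])
  qed simp
  also have "\<dots> = \<bar>s - t\<bar>"
  proof -
    have "(\<Sum>w\<in>W. \<bar>s - t\<bar> * ((1 + (?z w)\<^sup>2) / 2)) = \<bar>s - t\<bar> * ((real (card W) + (\<Sum>w\<in>W. (?z w)\<^sup>2)) / 2)"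
      by (simp only: sum_distrib_left[symmetric] sum_divide_distrib[symmetric] sum.distrib) simp
    then show ?thesis using card_W_pos by (simp only: sq) simp
  qed
  finally show ?thesis .
qed

lemma char_Z_approx:
  assumes "v > 0" "\<And>x. x \<in> A \<Longrightarrow> d x \<le> D"
  shows "cmod (char Z t - of_real (exp (- (t\<^sup>2) / 2)))
       \<le> \<bar>t\<bar> ^ 3 / 12 * (real D / sqrt v) + t ^ 4 / 48 * (real D / sqrt v)\<^sup>2"
proof -
  define s where "s = sqrt v"
  have s: "s > 0" "v = s\<^sup>2" using assms(1) by (auto simp: s_def)
  have "cmod (char Z t - of_real (exp (- ((t / s)\<^sup>2 * v / 2))))
      \<le> \<bar>t / s\<bar> ^ 3 * real D * v / 12 + (t / s) ^ 4 * (real D)\<^sup>2 * v / 48"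
    unfolding char_Z s_def v_def 
    by (rule prod_psi_approx[where A = A and d = d and D = D, OF finite_A d_ge_1 assms(2)])
  moreover have "(t / s)\<^sup>2 * v / 2 = t\<^sup>2 / 2" using s by (simp add: power_divide)
  moreover have "\<bar>t / s\<bar> ^ 3 * real D * v / 12 = \<bar>t\<bar> ^ 3 / 12 * (real D / s)"
    using s by (simp add: power_divide abs_divide power2_eq_square power3_eq_cube)
  moreover have "(t / s) ^ 4 * (real D)\<^sup>2 * v / 48 = t ^ 4 / 48 * (real D / s)\<^sup>2"
    using s by (simp add: power_divide power2_eq_square eval_nat_numeral)
  ultimately show ?thesis by (simp add: s_def)
qed

lemma char_Z_zero:
  assumes "v > 0" "x \<in> A" "d x \<ge> 2"
  shows "char Z (2 * pi / (real (d x) / sqrt v)) = 0"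
proof -
  have "2 * pi / (real (d x) / sqrt v) / sqrt v = 2 * pi / real (d x)" using assms(1) by simp
  then have "psi (d x) (2 * pi / (real (d x) / sqrt v) / sqrt v) = 0"
    using psi_zero[OF assms(3)] by simp
  then show ?thesis unfolding char_Z using finite_A assms(2) by (intro prod_zero) auto
qed

lemma v_pos:
  assumes "x \<in> A" "d x \<ge> 2"
  shows "v > 0"
proof -
  have "(real (d x))\<^sup>2 \<ge> 2\<^sup>2" using assms(2) by (intro power_mono) auto
  then have "0 < ((real (d x))\<^sup>2 - 1) / 12" by simp
  moreover have "((real (d x))\<^sup>2 - 1) / 12 \<le> v"
    unfolding v_def using finite_A assms(1) d_ge_1 by (intro member_le_sum) auto
  ultimately show ?thesis by simp
qed

end

section \<open>The central limit criterion\<close>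

context refl_system
begin

lemma coxgrp_inv:
  assumes "w \<in> coxgrp n \<Phi>"
  shows "inv w \<in> coxgrp n \<Phi>" "inv (inv w) = w" "ninv \<Phi> P w = len (inv w c)"
proof -
  obtain u where u: "u \<in> coxgrp n \<Phi>" "u \<circ> w = id" "w \<circ> u = id" "\<forall>x y. ip n (w x) y = ip n x (u y)"
    using coxgrp_inverse[OF assms] by blast
  have iw: "inv w = u" by (rule inv_unique_comp[OF u(3,2)])
  show "inv w \<in> coxgrp n \<Phi>" using u(1) by (simp add: iw)
  show "inv (inv w) = w" unfolding iw by (rule inv_unique_comp[OF u(2,3)])
  show "ninv \<Phi> P w = len (inv w c)" unfolding iw using inv_vs_len[OF assms u(1)] u(4) by blast
qed

text \<open>The stabilizer of \<open>c\<close> is in fact trivial, but equality of all fibres of the orbit map suffices.\<close>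
lemma sum_ninv:
  fixes g :: "nat \<Rightarrow> 'a :: comm_semiring_1"
  shows "(\<Sum>w\<in>coxgrp n \<Phi>. g (ninv \<Phi> P w))
       = of_nat (card {u\<in>coxgrp n \<Phi>. u c = c}) * (\<Sum>y\<in>orb. g (len y))"
proof -
  let ?W = "coxgrp n \<Phi>"
  have "(\<Sum>w\<in>?W. g (ninv \<Phi> P w)) = (\<Sum>u\<in>?W. g (len (u c)))"
    by (rule sum.reindex_bij_witness[of _ inv inv]) (simp_all add: coxgrp_inv)
  also have "\<dots> = (\<Sum>y\<in>orb. \<Sum>u\<in>{u\<in>?W. u c = y}. g (len (u c)))"
    unfolding orb_def by (rule sum.image_gen[OF finite_coxgrp])
  also have "\<dots> = (\<Sum>y\<in>orb. of_nat (card {u\<in>?W. u c = c}) * g (len y))"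
  proof (rule sum.cong[OF HOL.refl])
    fix y assume "y \<in> orb"
    then obtain w where w: "w \<in> ?W" "y = w c" by (auto simp: orb_def)
    obtain w' where w': "w' \<in> ?W" "w' \<circ> w = id" "w \<circ> w' = id"
      using coxgrp_inverse[OF w(1)] by blast
    have ww: "w' (w x) = x" "w (w' x) = x" for x
      using w'(2,3) by (auto simp: fun_eq_iff)
    have "bij_betw (\<lambda>u. w \<circ> u) {u\<in>?W. u c = c} {u\<in>?W. u c = y}"
      by (rule bij_betw_byWitness[of _ "\<lambda>u. w' \<circ> u"])
        (use w(1) w'(1) in \<open>auto simp: w(2) ww w'(2,3) comp_assoc[symmetric] intro: coxgrp_compose\<close>)
    then have "card {u\<in>?W. u c = y} = card {u\<in>?W. u c = c}"
      by (rule bij_betw_same_card[symmetric])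
    then show "(\<Sum>u\<in>{u\<in>?W. u c = y}. g (len (u c))) = of_nat (card {u\<in>?W. u c = c}) * g (len y)"
      by simp
  qed
  finally show ?thesis by (simp add: sum_distrib_left)
qed

lemma ninv_q_integer_statistic:
  assumes A: "finite A" "fst ` A = basic_degrees n \<Phi>"
    and eq: "(\<Sum>y\<in>orb. [:0, 1:] ^ len y) = (\<Prod>x\<in>(A :: (nat \<times> 'b) set). \<Sum>j<fst x. [:0, 1:] ^ j :: real poly)"
  shows "q_integer_statistic (coxgrp n \<Phi>) (ninv \<Phi> P) A fst (real (card {u\<in>coxgrp n \<Phi>. u c = c}))"
proof
  show "finite (coxgrp n \<Phi>)" by (rule finite_coxgrp)
  show "coxgrp n \<Phi> \<noteq> {}" using coxgrp.id_in by blast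
  show "finite A" by (rule A)
  show "fst x \<ge> 1" if "x \<in> A" for x
  proof -
    have "fst x \<in> basic_degrees n \<Phi>" using A(2) that by blast
    then show ?thesis by (simp add: basic_degrees_def)
  qed
  have "(\<Sum>w\<in>coxgrp n \<Phi>. [:0, 1:] ^ ninv \<Phi> P w)
      = of_nat (card {u\<in>coxgrp n \<Phi>. u c = c}) * (\<Sum>y\<in>orb. [:0, 1:] ^ len y :: real poly)"
    by (rule sum_ninv)
  then show "(\<Sum>w\<in>coxgrp n \<Phi>. [:0, 1:] ^ ninv \<Phi> P w)
      = smult (real (card {u\<in>coxgrp n \<Phi>. u c = c})) (\<Prod>x\<in>A. \<Sum>j<fst x. [:0, 1:] ^ j)"
    by (simp add: eq of_nat_poly)
qed

lemma root_exists:
  assumes "n \<ge> 1"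
  shows "\<Phi> \<noteq> {}"
proof
  assume "\<Phi> = {}"
  let ?v = "\<lambda>i::nat. if i = 0 then 1 else 0 :: real"
  have "?v \<in> vecs n" using assms by (auto simp: vecs_def)
  then obtain k where "?v = (\<lambda>i. \<Sum>a\<in>\<Phi>. k a * a i)" using spanning by blast
  then have "?v 0 = (\<Sum>a\<in>\<Phi>. k a * a 0)" by (rule fun_cong)
  then show False using \<open>\<Phi> = {}\<close> by simp
qed

text \<open>Were all degrees 1, evaluation at 1 would make the orbit a single point, yet a
  reflection moves \<open>c\<close>. This secures a positive variance and a maximal degree for which
  the characteristic function has its zero.\<close>

lemma degree_ge_2_exists:
  assumes "n \<ge> 1" and A: "finite A" "fst ` A = basic_degrees n \<Phi>"
    and eq: "(\<Sum>y\<in>orb. [:0, 1:] ^ len y) = (\<Prod>x\<in>(A :: (nat \<times> 'b) set). \<Sum>j<fst x. [:0, 1:] ^ j :: real poly)"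
  shows "\<exists>x\<in>A. fst x \<ge> 2"
proof (rule ccontr)
  assume "\<not> ?thesis"
  then have lt: "fst x < 2" if "x \<in> A" for x using that by force
  have ge: "fst x \<ge> 1" if "x \<in> A" for x
  proof -
    have "fst x \<in> basic_degrees n \<Phi>" using A(2) that by blast
    then show ?thesis by (simp add: basic_degrees_def)
  qed
  have one: "fst x = 1" if "x \<in> A" for x using lt[OF that] ge[OF that] by simp
  have "real (card orb) = (\<Prod>x\<in>A. real (fst x))"
    using arg_cong[OF eq, of "\<lambda>p. poly p 1"] by (simp add: poly_sum poly_prod)
  also have "\<dots> = 1" using one by (intro prod.neutral) simp
  finally have "card orb = 1" by simp
  moreover obtain a where a: "a \<in> \<Phi>" using root_exists[OF assms(1)] by blast
  ultimately have "refl n a c = c"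
    using c_orb refl_orb[OF a c_orb] by (auto simp: card_1_singleton_iff)
  moreover have "ip n a (refl n a c) = - ip n a c"
    by (simp add: ip_refl_symm[symmetric] refl_self a ip_neg_left)
  ultimately show False using c_regular[OF a] by simp
qed

lemma standardized_inversions:
  assumes "n \<ge> 1"
  defines "X \<equiv> inv_pmf n \<Phi> P"
  defines "M \<equiv> distr (measure_pmf X) borel
              (\<lambda>x. (x - measure_pmf.expectation X (\<lambda>y. y)) / sqrt (measure_pmf.variance X (\<lambda>y. y)))"
  defines "\<delta> \<equiv> real (max_degree n \<Phi>) / sqrt (measure_pmf.variance X (\<lambda>y. y))"
  shows "\<delta> > 0"
    and "cmod (char M t - of_real (exp (- (t\<^sup>2) / 2))) \<le> \<bar>t\<bar> ^ 3 / 12 * \<delta> + t ^ 4 / 48 * \<delta>\<^sup>2"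
    and "cmod (char M s - char M t) \<le> \<bar>s - t\<bar>"
    and "char M (2 * pi / \<delta>) = 0"
proof -
  obtain A :: "(nat \<times> ((nat \<Rightarrow> real) \<Rightarrow> real)) set" where A: "finite A" "fst ` A = basic_degrees n \<Phi>"
    "(\<Sum>y\<in>orb. [:0, 1:] ^ len y) = (\<Prod>x\<in>A. \<Sum>j<fst x. [:0, 1:] ^ j :: real poly)"
    using poincare_polynomial by blast
  interpret Q: q_integer_statistic "coxgrp n \<Phi>" "ninv \<Phi> P" A fst "real (card {u\<in>coxgrp n \<Phi>. u c = c})"
    by (rule ninv_q_integer_statistic[OF A])
  have X: "X = Q.X" by (simp add: X_def inv_pmf_def Q.X_def)
  have var: "measure_pmf.variance X (\<lambda>y. y) = Q.v" unfolding X by (rule Q.variance_X)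
  have M: "M = Q.Z"
    unfolding M_def var unfolding X Q.mean_X Q.Z_def ..
  obtain x0 where x0: "x0 \<in> A" "fst x0 \<ge> 2" using degree_ge_2_exists[OF assms(1) A] by blast
  have v: "Q.v > 0" by (rule Q.v_pos[OF x0])
  have max: "max_degree n \<Phi> = Max (fst ` A)" by (simp add: max_degree_def A(2))
  have fin: "finite (fst ` A)" using A(1) by simp
  have le: "fst x \<le> max_degree n \<Phi>" if "x \<in> A" for x
    unfolding max using fin that by (intro Max_ge) auto
  have "max_degree n \<Phi> \<in> fst ` A" unfolding max using fin x0 by (intro Max_in) auto
  then obtain x where x: "x \<in> A" "fst x = max_degree n \<Phi>" by auto
  have D2: "max_degree n \<Phi> \<ge> 2" using le[OF x0(1)] x0(2) by simp
  have \<delta>: "\<delta> = real (max_degree n \<Phi>) / sqrt Q.v" by (simp only: \<delta>_def var)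
  show "\<delta> > 0" using v D2 by (simp add: \<delta>)
  show "cmod (char M t - of_real (exp (- (t\<^sup>2) / 2))) \<le> \<bar>t\<bar> ^ 3 / 12 * \<delta> + t ^ 4 / 48 * \<delta>\<^sup>2"
    unfolding M \<delta> by (rule Q.char_Z_approx[OF v le])
  show "cmod (char M s - char M t) \<le> \<bar>s - t\<bar>"
    unfolding M by (rule Q.char_Z_lipschitz[OF v])
  show "char M (2 * pi / \<delta>) = 0"
    using Q.char_Z_zero[OF v x(1)] x(2) D2 by (simp add: M \<delta>)
qed

end

text \<open>The zeros of the characteristic functions at \<open>2 * pi / \<delta> k\<close> must escape to infinity when the
  characteristic functions converge, locally uniformly, to a function without zeros.\<close>
lemma normal_limit_iff:
  fixes M :: "nat \<Rightarrow> real measure" and \<delta> :: "nat \<Rightarrow> real"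
  assumes real: "\<And>k. real_distribution (M k)"
    and pos: "\<And>k. k \<ge> 1 \<Longrightarrow> \<delta> k > 0"
    and approx: "\<And>k t. k \<ge> 1 \<Longrightarrow> cmod (char (M k) t - of_real (exp (- (t\<^sup>2) / 2)))
      \<le> \<bar>t\<bar> ^ 3 / 12 * \<delta> k + t ^ 4 / 48 * (\<delta> k)\<^sup>2"
    and lip: "\<And>k s t. k \<ge> 1 \<Longrightarrow> cmod (char (M k) s - char (M k) t) \<le> \<bar>s - t\<bar>"
    and zero: "\<And>k. k \<ge> 1 \<Longrightarrow> char (M k) (2 * pi / \<delta> k) = 0"
  shows "weak_conv_m M std_normal_distribution \<longleftrightarrow> \<delta> \<longlonglongrightarrow> 0"
proof
  assume \<delta>: "\<delta> \<longlonglongrightarrow> 0"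
  show "weak_conv_m M std_normal_distribution"
  proof (rule levy_continuity[OF real real_dist_normal_dist])
    fix t
    have lim: "(\<lambda>k. \<bar>t\<bar> ^ 3 / 12 * \<delta> k + t ^ 4 / 48 * (\<delta> k)\<^sup>2) \<longlonglongrightarrow> 0"
    proof -
      have "(\<lambda>k. \<bar>t\<bar> ^ 3 / 12 * \<delta> k + t ^ 4 / 48 * (\<delta> k)\<^sup>2)
          \<longlonglongrightarrow> \<bar>t\<bar> ^ 3 / 12 * 0 + t ^ 4 / 48 * 0\<^sup>2"
        by (intro tendsto_add tendsto_mult tendsto_power tendsto_const \<delta>)
      then show ?thesis by simp
    qed
    have "(\<lambda>k. char (M k) t - of_real (exp (- (t\<^sup>2) / 2))) \<longlonglongrightarrow> 0"
      by (rule Lim_null_comparison[OF _ lim])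
        (use approx in \<open>auto simp: eventually_sequentially intro!: exI[of _ 1]\<close>)
    then show "(\<lambda>k. char (M k) t) \<longlonglongrightarrow> char std_normal_distribution t"
      unfolding char_std_normal_distribution by (rule LIM_zero_cancel)
  qed
next
  assume conv: "weak_conv_m M std_normal_distribution"
  have char: "(\<lambda>k. char (M k) t) \<longlonglongrightarrow> of_real (exp (- (t\<^sup>2) / 2))" for t
    using levy_continuity1[OF real real_dist_normal_dist conv, of t]
    unfolding char_std_normal_distribution .
  show "\<delta> \<longlonglongrightarrow> 0"
  proof (rule ccontr)
    assume "\<not> \<delta> \<longlonglongrightarrow> 0"
    then obtain \<epsilon> where \<epsilon>: "\<epsilon> > 0" "\<not> (\<forall>\<^sub>F k in sequentially. dist (\<delta> k) 0 < \<epsilon>)"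
      unfolding tendsto_iff by blast
    \<comment> \<open>Index 0 is kept out of the subsequence here, since the bounds are assumed from
      1 on.\<close>
    have "\<not> (\<forall>\<^sub>F k in sequentially. \<not> (k \<ge> 1 \<and> \<delta> k \<ge> \<epsilon>))"
    proof
      assume "\<forall>\<^sub>F k in sequentially. \<not> (k \<ge> 1 \<and> \<delta> k \<ge> \<epsilon>)"
      then have "\<forall>\<^sub>F k in sequentially. dist (\<delta> k) 0 < \<epsilon>"
        using eventually_ge_at_top[of 1]
      proof eventually_elim
        case (elim k)
        then show ?case using pos[of k] by simp
      qed
      then show False using \<epsilon>(2) by simp
    qed
    then obtain r :: "nat \<Rightarrow> nat" where r: "strict_mono r" "\<And>k. r k \<ge> 1 \<and> \<delta> (r k) \<ge> \<epsilon>"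
      using not_eventually_sequentiallyD by force
    \<comment> \<open>Along this subsequence the zeros stay in a compact interval, so they
      accumulate at some \<open>l\<close>.\<close>
    define z where "z = (\<lambda>k. 2 * pi / \<delta> (r k))"
    have "z k \<in> {0..2 * pi / \<epsilon>}" for k
      using r(2)[of k] \<epsilon>(1) by (auto simp: z_def intro!: divide_left_mono divide_nonneg_pos)
    then obtain l q where q: "strict_mono q" "(z \<circ> q) \<longlonglongrightarrow> l"
      using compact_Icc[of 0 "2 * pi / \<epsilon>"] unfolding compact_def by metis
    have sub: "(\<lambda>k. char (M (r (q k))) l) \<longlonglongrightarrow> of_real (exp (- (l\<^sup>2) / 2))"
      using LIMSEQ_subseq_LIMSEQ[OF char strict_mono_o[OF r(1) q(1)], of l] by (simp add: o_def)
    have "(\<lambda>k. \<bar>l - z (q k)\<bar>) \<longlonglongrightarrow> \<bar>l - l\<bar>"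
      using q(2) by (intro tendsto_intros) (simp add: o_def)
    then have lim: "(\<lambda>k. \<bar>l - z (q k)\<bar>) \<longlonglongrightarrow> 0" by simp
    \<comment> \<open>The common Lipschitz bound carries the zeros near \<open>l\<close> over to
      \<open>l\<close>, where the limit would then vanish although it is positive.\<close>
    have "cmod (char (M (r (q k))) l) \<le> \<bar>l - z (q k)\<bar>" for k
      using lip[of "r (q k)" l "z (q k)"] zero[of "r (q k)"] r(2)[of "q k"] by (simp add: z_def)
    then have "(\<lambda>k. char (M (r (q k))) l) \<longlonglongrightarrow> 0"
      by (intro Lim_null_comparison[OF _ lim]) simp
    then have "complex_of_real (exp (- (l\<^sup>2) / 2)) = 0"
      using LIMSEQ_unique[OF sub] by blast
    then show False by simp
  qed
qed

theorem theorem6p1: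
  fixes \<Phi> P :: "nat \<Rightarrow> (nat \<Rightarrow> real) set"
  assumes "\<And>n. n \<ge> 1 \<Longrightarrow> root_system n (\<Phi> n)"
    and "\<And>n. n \<ge> 1 \<Longrightarrow> positive_system n (\<Phi> n) (P n)"
  shows "satisfies_CLT (\<lambda>n. inv_pmf n (\<Phi> n) (P n)) \<longleftrightarrow>
         (\<lambda>n. real (max_degree n (\<Phi> n)) / sqrt (measure_pmf.variance (inv_pmf n (\<Phi> n) (P n)) (\<lambda>y. y)))
           \<longlonglongrightarrow> 0"
proof -
  have sys: "\<exists>c. refl_system k (\<Phi> k) (P k) c" if "k \<ge> 1" for k
    using assms(1,2)[OF that] unfolding positive_system_def refl_system_def by blast
  note std = refl_system.standardized_inversions
  show ?thesis
    unfolding satisfies_CLT_def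
  proof (rule normal_limit_iff, goal_cases)
    case (1 k)
    show ?case
      unfolding real_distribution_def real_distribution_axioms_def
      by (auto intro!: measure_pmf.prob_space_distr)
  next
    case (2 k)
    then show ?case using std(1) sys by blast
  next
    case (3 k t)
    then obtain c where "refl_system k (\<Phi> k) (P k) c" using sys by blast
    from std(2)[OF this 3] show ?case .
  next
    case (4 k s t)
    then obtain c where "refl_system k (\<Phi> k) (P k) c" using sys by blast
    from std(3)[OF this 4] show ?case .
  next
    case (5 k)
    then obtain c where "refl_system k (\<Phi> k) (P k) c" using sys by blast
    from std(4)[OF this 5] show ?case .
  qed
qed

end
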